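(* Let $c_A,c_B,e_A,e_B>0$ and consider the system of ordinary differential equations on $\mathbb{R}^5_+=\{x\in\mathbb{R}^5 : x_j\ge 0,\ j=1,\dots,5\}$ given (indices mod $5$) by $$\frac{dx_j}{dt}=x_j\left(1-X-c_A x_{j+1}+e_B x_{j+2}-c_B x_{j+3}+e_A x_{j+4}\right),\quad j=1,\dots,5,\qquad X=x_1+x_2+x_3+x_4+x_5 .$$ Let $Z=Z_1Z_2\dots Z_m$, with $Z_i\in\{A,B\}$ and $m\ge 1$, be a root sequence, and let $\{\mathcal{M}_{Z^j},\ j=1,\dots,m\}$ be the collection of transition matrices for $Z$, where (indices of $Z$ taken mod $m$) $\mathcal{M}_{Z^j}$ is the product of $m$ matrices $$\mathcal{M}_{Z^j}=M_{Z_{j-2}\to Z_{j-1}}\,M_{Z_{j-3}\to Z_{j-2}}\cdots M_{Z_{j}\to Z_{j+1}}\,M_{Z_{j-1}\to Z_{j}} .$$ If, for each $j=1,\dots,m$, the matrix $\mathcal{M}_{Z^j}$ is of fragmentary asymptotic stability type, then the root sequence $Z$ is fragmentarily asymptotically stable.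
   Context: **Network.** Let $\xi_1,\dots,\xi_5$ be the equilibria $\xi_1=(1,0,0,0,0)$, $\xi_2=(0,1,0,0,0)$, etc. (the standard unit vectors; subscripts mod $5$). The Jacobian at $\xi_1$ has eigenvalues $-1,e_A,-c_B,e_B,-c_A$ in the $x_1,x_2,x_3,x_4,x_5$ directions respectively. The heteroclinic network is $\Sigma=\bigcup_{j=1}^5\left(\{\xi_j\}\cup W^u(\xi_j)\right)\cap\mathbb{R}^5_+$, where $W^u$ denotes the unstable manifold. $F_t$ denotes the flow of the system and $|x-\Sigma|$ the distance from $x$ to $\Sigma$. **Itineraries.** Fix $0<H<\frac12\min_{i\neq j}|\xi_i-\xi_j|$. For $x\in\mathbb{R}^5_+$ let $M(x)=k$ if $|x-\xi_k|\le H$, and $M(x)=0$ if there is no such $k$. For a trajectory $F_t(x_0)$, let $\tilde M(t)$ be the index of the last visited equilibrium: $\tilde M(t)=M(F_{\tilde t}(x_0))$ with $\tilde t=\sup\{\tilde t\le t : M(F_{\tilde t}(x_0))\ne 0\}$. The itinerary $m(n)$, $n\in\mathbb{N}$, with epochs $\tau(n)$, is defined by $\tilde M(t)=m(n)$ for $t\in[\tau(n),\tau(n+1))$ and $m(n+1)\ne m(n)$. The associated word is $W(F_t(x_0))=\{w(n) : n\in\mathbb{N}\}$, where $w(n)=A$ if $m(n+1)-m(n)=1\pmod 5$ and $w(n)=B$ if $m(n+1)-m(n)=3\pmod 5$. The sequence $w(n)$ is *eventually periodic* with period $p$ and *root sequence* $w^\star\in\{A,B\}^p$ if there is $N\in\mathbb{N}$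 such that $w(n+p)=w(n)$ for all $n>N$ and $w(N+j)=w^\star(j)$ for $j=1,\dots,p$. **Stability of a sequence.** For $w\in\{A,B\}^p$ and $\delta>0$, the $\delta$-local basin of attraction $\mathcal{B}_\delta(w)$ is the set of $x_0\in\mathbb{R}^5_+$ such that $W(F_t(x_0))$ is eventually periodic with root sequence $w$, $|F_t(x_0)-\Sigma|<\delta$ for all $t\ge0$, and $\lim_{t\to\infty}|F_t(x_0)-\Sigma|=0$. The sequence $w$ is *fragmentarily asymptotically stable* if $\mu(\mathcal{B}_\delta(w))>0$ for all $\delta>0$, where $\mu$ is Lebesgue measure on $\mathbb{R}^5$. **Transition matrices.** ($M_{X\to Y}$ is used when the previous transition is of type $X$ and the current one is of type $Y$.) $$M_{A\to A}=\begin{pmatrix}\frac{c_B}{e_A}&0&1\\ \frac{c_A}{e_A}&0&0\\ -\frac{e_B}{e_A}&1&0\end{pmatrix},\quad M_{A\to B}=\begin{pmatrix}0&\frac{c_A}{e_B}&0\\ 1&-\frac{e_A}{e_B}&0\\ 0&\frac{c_B}{e_B}&1\end{pmatrix},$$ $$M_{B\to B}=\begin{pmatrix}0&\frac{c_A}{e_B}&1\\ 1&-\frac{e_A}{e_B}&0\\ 0&\frac{c_B}{e_B}&0\end{pmatrix},\quad M_{B\to A}=\begin{pmatrix}\frac{c_B}{e_A}&0&0\\ \frac{c_A}{e_A}&0&1\\ -\frac{e_B}{e_A}&1&0\end{pmatrix}.$$ For example, $\mathcal{M}_{Z^1}=M_{Z_{m-1}\to Z_m}M_{Z_{m-2}\to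 Z_{m-1}}\cdots M_{Z_1\to Z_2}M_{Z_m\to Z_1}$; for $m=1$ and $Z=A$ (resp. $Z=B$) the only matrix is $M_{A\to A}$ (resp. $M_{B\to B}$). **Fragmentary asymptotic stability type.** Let $\mathcal{M}$ be a transition matrix, let $\lambda_{\max}$ be the eigenvalue of $\mathcal{M}$ with largest absolute value, and let $w^{\max}$ be the associated eigenvector. Suppose $\lambda_{\max}\neq1$. Then $\mathcal{M}$ is of *fragmentary asymptotic stability type* if (i) $\lambda_{\max}$ is real; (ii) $\lambda_{\max}>1$; (iii) $w^{\max}_l w^{\max}_q>0$ for all $l,q$ (all entries of $w^{\max}$ are non-zero and of the same sign). *)

theory Defs
  imports "HOL-Analysis.Analysis" "Jordan_Normal_Form.Char_Poly"
begin

(* Leaves "$" to the components of vectors in real ^ 5. *)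
no_notation vec_index (infixl "$" 100)

(* Coordinates are indexed by the five-element type 5, whose arithmetic is arithmetic mod 5;
   the index written 5 in the usual labelling 1,...,5 is the element 0. *)

definition orthant :: "(real ^ 5) set" where
  "orthant = {x. \<forall>j. 0 \<le> x $ j}"

definition vfield :: "real \<Rightarrow> real \<Rightarrow> real \<Rightarrow> real \<Rightarrow> real ^ 5 \<Rightarrow> real ^ 5" where
  "vfield cA cB eA eB x =
     (\<chi> j. x $ j * (1 - (\<Sum>i\<in>UNIV. x $ i)
        - cA * x $ (j + 1) + eB * x $ (j + 2) - cB * x $ (j + 3) + eA * x $ (j + 4)))"

(* The field is defined on the whole space; since x $ j is a factor of its j-th component,
   a solution that meets the orthant stays in it. *)
definition solution_on ::
    "real \<Rightarrow> real \<Rightarrow> real \<Rightarrow> real \<Rightarrow> real set \<Rightarrow> (real \<Rightarrow> real ^ 5) \<Rightarrow> bool" where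
  "solution_on cA cB eA eB T f \<longleftrightarrow>
     (\<forall>t\<in>T. (f has_vector_derivative vfield cA cB eA eB (f t)) (at t within T))"

definition \<xi> :: "5 \<Rightarrow> real ^ 5" where
  "\<xi> j = axis j 1"

definition unstable_manifold ::
    "real \<Rightarrow> real \<Rightarrow> real \<Rightarrow> real \<Rightarrow> real ^ 5 \<Rightarrow> (real ^ 5) set" where
  "unstable_manifold cA cB eA eB p =
     {x. \<exists>f. solution_on cA cB eA eB {..0} f \<and> f 0 = x \<and> (f \<longlongrightarrow> p) at_bot}"

definition network :: "real \<Rightarrow> real \<Rightarrow> real \<Rightarrow> real \<Rightarrow> (real ^ 5) set" where
  "network cA cB eA eB =
     (\<Union>j. {\<xi> j} \<union> unstable_manifold cA cB eA eB (\<xi> j)) \<inter> orthant"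

datatype transition = Type_A | Type_B

(* None plays the role of the value 0, "no equilibrium within distance H". The index is unique
   because H is less than half the minimal distance between two equilibria. *)
definition near_eq :: "real \<Rightarrow> real ^ 5 \<Rightarrow> 5 option" where
  "near_eq H x = (if \<exists>k. dist x (\<xi> k) \<le> H then Some (THE k. dist x (\<xi> k) \<le> H) else None)"

(* None before the first visit, when the set below is empty. For a continuous f the visiting
   times form a closed set, so the supremum is itself a visiting time. *)
definition last_eq :: "real \<Rightarrow> (real \<Rightarrow> real ^ 5) \<Rightarrow> real \<Rightarrow> 5 option" where
  "last_eq H f t =
     (let V = {s. 0 \<le> s \<and> s \<le> t \<and> near_eq H (f s) \<noteq> None}
      in if V = {} then None else near_eq H (f (Sup V)))"

(* tau 0 is the time of the first visit, and the epochs cover all later times. *)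
definition itinerary ::
    "real \<Rightarrow> (real \<Rightarrow> real ^ 5) \<Rightarrow> (nat \<Rightarrow> 5) \<Rightarrow> (nat \<Rightarrow> real) \<Rightarrow> bool" where
  "itinerary H f m \<tau> \<longleftrightarrow>
     0 \<le> \<tau> 0 \<and> strict_mono \<tau> \<and> filterlim \<tau> at_top sequentially \<and>
     (\<forall>t. 0 \<le> t \<and> t < \<tau> 0 \<longrightarrow> last_eq H f t = None) \<and>
     (\<forall>n. m (Suc n) \<noteq> m n \<and> (\<forall>t\<in>{\<tau> n..<\<tau> (Suc n)}. last_eq H f t = Some (m n)))"

definition word_of :: "(nat \<Rightarrow> 5) \<Rightarrow> (nat \<Rightarrow> transition) \<Rightarrow> bool" where
  "word_of m w \<longleftrightarrow>
     (\<forall>n. (w n = Type_A \<and> m (Suc n) - m n = 1) \<or> (w n = Type_B \<and> m (Suc n) - m n = 3))"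

definition eventually_periodic :: "(nat \<Rightarrow> transition) \<Rightarrow> transition list \<Rightarrow> bool" where
  "eventually_periodic w r \<longleftrightarrow>
     (\<exists>N. (\<forall>n>N. w (n + length r) = w n) \<and> (\<forall>j\<in>{1..length r}. w (N + j) = r ! (j - 1)))"

(* The trajectory f of x0 is unique because the field is locally Lipschitz. Forward solutions
   of the system may blow up in finite time, so its existence for all t >= 0 is part of the
   condition. *)
definition local_basin ::
    "real \<Rightarrow> real \<Rightarrow> real \<Rightarrow> real \<Rightarrow> real \<Rightarrow> real \<Rightarrow> transition list \<Rightarrow> (real ^ 5) set" where
  "local_basin cA cB eA eB H \<delta> r =
     {x0 \<in> orthant. \<exists>f. solution_on cA cB eA eB {0..} f \<and> f 0 = x0 \<and>
        (\<exists>m \<tau> w. itinerary H f m \<tau> \<and> word_of m w \<and> eventually_periodic w r) \<and>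
        (\<forall>t\<ge>0. infdist (f t) (network cA cB eA eB) < \<delta>) \<and>
        ((\<lambda>t. infdist (f t) (network cA cB eA eB)) \<longlongrightarrow> 0) at_top}"

definition frag_asymp_stable ::
    "real \<Rightarrow> real \<Rightarrow> real \<Rightarrow> real \<Rightarrow> real \<Rightarrow> transition list \<Rightarrow> bool" where
  "frag_asymp_stable cA cB eA eB H r \<longleftrightarrow>
     (\<forall>\<delta>>0. emeasure lebesgue (local_basin cA cB eA eB H \<delta> r) > 0)"

(* First transition argument: the previous transition; second one: the current transition. *)
fun trans_mat ::
    "real \<Rightarrow> real \<Rightarrow> real \<Rightarrow> real \<Rightarrow> transition \<Rightarrow> transition \<Rightarrow> real mat" where
  "trans_mat cA cB eA eB Type_A Type_A = mat_of_rows_list 3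
     [[cB / eA, 0, 1],
      [cA / eA, 0, 0],
      [- (eB / eA), 1, 0]]"
| "trans_mat cA cB eA eB Type_A Type_B = mat_of_rows_list 3
     [[0, cA / eB, 0],
      [1, - (eA / eB), 0],
      [0, cB / eB, 1]]"
| "trans_mat cA cB eA eB Type_B Type_B = mat_of_rows_list 3
     [[0, cA / eB, 1],
      [1, - (eA / eB), 0],
      [0, cB / eB, 0]]"
| "trans_mat cA cB eA eB Type_B Type_A = mat_of_rows_list 3
     [[cB / eA, 0, 0],
      [cA / eA, 0, 1],
      [- (eB / eA), 1, 0]]"

(* The letter Z_i, with i >= 0 read mod the length m of Z and the letters numbered Z_1,...,Z_m;
   in particular i = 0 gives Z_m. *)
definition letter :: "transition list \<Rightarrow> nat \<Rightarrow> transition" where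
  "letter Z i = Z ! ((i + length Z - 1) mod length Z)"

(* The factors, from right to left, are M_{Z_{j-1+k} -> Z_{j+k}} for k = 0,...,m-1. *)
definition seq_trans_mat ::
    "real \<Rightarrow> real \<Rightarrow> real \<Rightarrow> real \<Rightarrow> transition list \<Rightarrow> nat \<Rightarrow> real mat" where
  "seq_trans_mat cA cB eA eB Z j =
     foldr (*) (map (\<lambda>k. trans_mat cA cB eA eB (letter Z (j - 1 + k)) (letter Z (j + k)))
                    (rev [0..<length Z])) (1\<^sub>m 3)"

(* Eigenvalues are taken over the complex numbers. Dominance is strict, so that there is
   at most one dominant eigenvalue. *)
definition dominant_eigenvalue :: "real mat \<Rightarrow> complex \<Rightarrow> bool" where
  "dominant_eigenvalue M l \<longleftrightarrow>
     eigenvalue (map_mat complex_of_real M) l \<and>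
     (\<forall>\<mu>. eigenvalue (map_mat complex_of_real M) \<mu> \<and> \<mu> \<noteq> l \<longrightarrow> cmod \<mu> < cmod l)"

(* The sign condition does not depend on the scaling of the eigenvector w. Being required of
   every w, it forces the eigenspace to be a line. *)
definition frag_asymp_stability_type :: "real mat \<Rightarrow> bool" where
  "frag_asymp_stability_type M \<longleftrightarrow>
     (\<exists>l. dominant_eigenvalue M l \<and> l \<noteq> 1 \<and> l \<in> \<real> \<and> Re l > 1 \<and>
        (\<forall>w. eigenvector M w (Re l) \<longrightarrow>
           (\<forall>i<dim_vec w. \<forall>q<dim_vec w. vec_index w i * vec_index w q > 0)))"

end

theory Submission
  imports Defs "Jordan_Normal_Form.Schur_Decomposition"
begin

no_notation vec_index (infixl "$" 100)
no_notation scalar_prod (infix "\<bullet>" 70)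

text \<open>In logarithmic coordinates \<open>y = ln x\<close> the system is linear in x. Near the equilibrium k the
  combination of \<open>y $ j\<close>, \<open>y $ k\<close> and \<open>y $ l\<close> that cancels \<open>x $ k\<close> in its rate is conserved up to a
  bounded error, and the transition to the next equilibrium l takes bounded time. Hence the
  three logarithmic distances tracked by the transition matrices are multiplied by these matrices
  up to a bounded error at every step. Dominance and positivity of the eigenvectors make the
  exact orbits that start near a positive multiple of the eigenvector grow exponentially in all
  components, and for a large multiple the bounded errors do not matter. So the logarithms stay
  below every threshold that a passage requires, and an open box of initial conditions follows
  the sequence forever. Near the equilibria the distance to the network is small by construction.
  On the transitions it is small, and tends to 0, by compactness: a limit of solutions that spend
  longer and longer times in the box before leaving it is a solution on the unstable manifold.

  Since the basin is shown to be a Borel set, containing an open set gives positive measure.\<close>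

section \<open>Differential inequalities and global solutions\<close>

text \<open>Three obstacles shape the proof. The transition matrices have negative entries, so the
  positive cone need not be invariant and bounded errors cannot be absorbed by monotonicity. They
  are summed by variation of constants instead, which needs upper and lower bounds for the matrix
  products at the same rate \<open>\<beta> ^ n * real (Suc n) ^ d\<close>, including the polynomial
  factor of a defective eigenvalue. Next, the radius \<open>H\<close> of the itinerary is prescribed
  while the boxes have a small size \<open>h\<close>, so a curve might enter and leave an
  \<open>H\<close>-ball repeatedly on a transition. The order of visits follows from the strict
  growth of \<open>y $ l - y $ k\<close> during a whole passage, because inside the ball around
  \<open>\<xi> j\<close> the coordinate j is the largest. Finally, \<open>emeasure\<close> is 0 on
  nonmeasurable sets, so measurability of the basin is a real obligation. Its definition quantifies
  over curves, epochs and words; it is rewritten with the unique solution, countably many words and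
  rational times.\<close>

lemma at_within_Icc_atLeast:
  fixes a b t :: real
  assumes "t < b"
  shows "at t within {a..b} = at t within {a..}"
  by (rule at_within_nhd[where S = "{..<b}"]) (use assms in auto)

lemma at_within_Icc_atMost:
  fixes a b t :: real
  assumes "a < t"
  shows "at t within {a..b} = at t within {..b}"
  by (rule at_within_nhd[where S = "{a<..}"]) (use assms in auto)

lemma nonneg_deriv_within_imp_le:
  fixes u :: "real \<Rightarrow> real"
  assumes "a \<le> b"
    and "\<And>t. t \<in> {a..b} \<Longrightarrow> (u has_real_derivative u' t) (at t within {a..b})"
    and "\<And>t. t \<in> {a<..<b} \<Longrightarrow> 0 \<le> u' t"
  shows "u a \<le> u b"
proof (cases "a < b")
  case True
  then obtain x where "x \<in> {a<..<b}" "u b - u a = u' x * (b - a)"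
    using mvt_simple[of a b u "\<lambda>x. (*) (u' x)"] assms(2)
    by (auto simp: has_field_derivative_def)
  with assms(3)[of x] True show ?thesis
    by (smt (verit) mult_nonneg_nonneg)
qed (use assms(1) in auto)

text \<open>Comparison principle behind the estimates in boxes and on transitions: above the level c
  the function loses at least d per unit of time, and once it has come down to c it cannot be above
  c again. With \<open>d = 0\<close> it expresses invariance of a level.\<close>

lemma decay_barrier:
  fixes u :: "real \<Rightarrow> real"
  assumes "a \<le> b"
    and der: "\<And>t. t \<in> {a..b} \<Longrightarrow> (u has_real_derivative u' t) (at t within {a..b})"
    and dec: "\<And>t. t \<in> {a..b} \<Longrightarrow> c \<le> u t \<Longrightarrow> u' t \<le> - d"
    and "u a \<le> M" "0 \<le> d"
  shows "u b \<le> max c (M - d * (b - a))"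
proof (rule ccontr)
  assume "\<not> ?thesis"
  then have ub: "c < u b" "M - d * (b - a) < u b" by auto
  have cont: "continuous_on {a..b} u"
    using der by (meson DERIV_continuous continuous_on_eq_continuous_within)
  have drop: "u b \<le> u s - d * (b - s)" if "s \<in> {a..b}" "\<And>t. t \<in> {s<..<b} \<Longrightarrow> c \<le> u t" for s
  proof -
    have "- (u s + d * s) \<le> - (u b + d * b)"
    proof (rule nonneg_deriv_within_imp_le[where u = "\<lambda>t. - (u t + d * t)" and u' = "\<lambda>t. - (u' t + d)"])
      fix t assume "t \<in> {s..b}"
      then have "(u has_real_derivative u' t) (at t within {s..b})"
        using that by (intro DERIV_subset[OF der]) auto
      then show "((\<lambda>t. - (u t + d * t)) has_real_derivative - (u' t + d)) (at t within {s..b})"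
        by (auto intro!: derivative_eq_intros)
    next
      fix t assume "t \<in> {s<..<b}"
      with that show "0 \<le> - (u' t + d)"
        using dec[of t] by auto
    qed (use that in auto)
    then show ?thesis by (simp add: algebra_simps)
  qed
  \<comment> \<open>If the level c is met at all, the last such time starts a stretch on which u is
    at least c, hence non-increasing up to b, which contradicts \<open>c < u b\<close>.\<close>
  let ?S = "{t \<in> {a..b}. u t \<le> c}"
  show False
  proof (cases "?S = {}")
    case True
    then have "c \<le> u t" if "t \<in> {a<..<b}" for t
      using that less_eq_real_def not_le by auto
    then have "u b \<le> u a - d * (b - a)"
      using \<open>a \<le> b\<close> by (intro drop) auto
    with ub \<open>u a \<le> M\<close> show False by auto
  next
    case False
    have "?S = {a..b} \<inter> u -` {..c}" by auto
    then have cl: "closed ?S"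
      using continuous_closed_preimage[OF cont, of "{..c}"] by simp
    have bdd: "bdd_above ?S" by (auto intro!: bdd_aboveI[of _ b])
    have S: "Sup ?S \<in> ?S"
      by (rule closed_contains_Sup[OF False bdd cl])
    have "u b \<le> u (Sup ?S) - d * (b - Sup ?S)"
    proof (rule drop)
      fix t assume t: "t \<in> {Sup ?S<..<b}"
      show "c \<le> u t"
      proof (rule ccontr)
        assume "\<not> ?thesis"
        then have "t \<in> ?S" using t S by auto
        then have "t \<le> Sup ?S" using bdd by (rule cSup_upper)
        with t show False by auto
      qed
    qed (use S in auto)
    moreover have "0 \<le> d * (b - Sup ?S)" using S \<open>0 \<le> d\<close> by auto
    ultimately show False using S ub by auto
  qed
qed

lemma growth_barrier:
  fixes u :: "real \<Rightarrow> real"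
  assumes "a \<le> b"
    and der: "\<And>t. t \<in> {a..b} \<Longrightarrow> (u has_real_derivative u' t) (at t within {a..b})"
    and inc: "\<And>t. t \<in> {a..b} \<Longrightarrow> u t \<le> c \<Longrightarrow> d \<le> u' t"
    and "M \<le> u a" "0 \<le> d"
  shows "min c (M + d * (b - a)) \<le> u b"
proof -
  have "- u b \<le> max (- c) (- M - d * (b - a))"
    by (rule decay_barrier[where u' = "\<lambda>t. - u' t"])
      (use assms in \<open>auto intro!: derivative_eq_intros\<close>)
  then show ?thesis by linarith
qed

text \<open>The derivative of the squared distance has modulus at most \<open>2 * L\<close> times
  that squared distance, so exponential bounds hold in both time directions. The backward one is
  needed for limits of solutions that are normalised at their final time.\<close>

lemma gronwall_two_solutions:
  fixes f g :: "real \<Rightarrow> 'a::real_inner"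
  assumes "a \<le> b"
    and f: "\<And>t. t \<in> {a..b} \<Longrightarrow> (f has_vector_derivative f' t) (at t within {a..b})"
    and g: "\<And>t. t \<in> {a..b} \<Longrightarrow> (g has_vector_derivative g' t) (at t within {a..b})"
    and lip: "\<And>t. t \<in> {a..b} \<Longrightarrow> norm (f' t - g' t) \<le> L * norm (f t - g t)"
  shows "norm (f b - g b) \<le> exp (L * (b - a)) * norm (f a - g a)"
    and "norm (f a - g a) \<le> exp (L * (b - a)) * norm (f b - g b)"
proof -
  define \<phi> where "\<phi> t = (f t - g t) \<bullet> (f t - g t)" for t
  define \<phi>' where "\<phi>' t = 2 * ((f t - g t) \<bullet> (f' t - g' t))" for t
  have d: "(\<phi> has_real_derivative \<phi>' t) (at t within {a..b})" if "t \<in> {a..b}" for t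
  proof -
    have "((\<lambda>t. f t - g t) has_vector_derivative f' t - g' t) (at t within {a..b})"
      using f[OF that] g[OF that] by (rule has_vector_derivative_diff)
    then have D: "((\<lambda>t. f t - g t) has_derivative (\<lambda>h. h *\<^sub>R (f' t - g' t))) (at t within {a..b})"
      by (simp add: has_vector_derivative_def)
    show ?thesis
      using has_derivative_inner[OF D D] unfolding has_field_derivative_def \<phi>_def \<phi>'_def
      by (rule has_derivative_eq_rhs) (auto simp: fun_eq_iff inner_commute algebra_simps)
  qed
  have bd: "\<bar>\<phi>' t\<bar> \<le> 2 * L * \<phi> t" if "t \<in> {a..b}" for t
  proof -
    have "\<bar>(f t - g t) \<bullet> (f' t - g' t)\<bar> \<le> norm (f t - g t) * norm (f' t - g' t)"
      by (rule Cauchy_Schwarz_ineq2)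
    also have "\<dots> \<le> norm (f t - g t) * (L * norm (f t - g t))"
      by (intro mult_left_mono lip that) auto
    finally show ?thesis
      unfolding \<phi>_def \<phi>'_def by (simp add: dot_square_norm power2_eq_square algebra_simps)
  qed
  have sq: "norm (f s - g s) \<le> exp (L * (b - a)) * norm (f t - g t)"
    if "\<phi> s \<le> exp (2 * L * (b - a)) * \<phi> t" for s t
  proof -
    have "(norm (f s - g s))\<^sup>2 \<le> (exp (L * (b - a)) * norm (f t - g t))\<^sup>2"
      using that unfolding \<phi>_def dot_square_norm power_mult_distrib
      by (simp add: exp_of_nat_mult[symmetric] mult.assoc flip: exp_double)
    then show ?thesis by (rule power2_le_imp_le) auto
  qed
  have "- (exp (- 2 * L * (a - a)) * \<phi> a) \<le> - (exp (- 2 * L * (b - a)) * \<phi> b)"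
  proof (rule nonneg_deriv_within_imp_le[where u = "\<lambda>t. - (exp (- 2 * L * (t - a)) * \<phi> t)"
        and u' = "\<lambda>t. exp (- 2 * L * (t - a)) * (2 * L * \<phi> t - \<phi>' t)"])
    fix t assume t: "t \<in> {a..b}"
    show "((\<lambda>t. - (exp (- 2 * L * (t - a)) * \<phi> t)) has_real_derivative
       exp (- 2 * L * (t - a)) * (2 * L * \<phi> t - \<phi>' t)) (at t within {a..b})"
      by (rule derivative_eq_intros d[OF t] refl)+ (simp add: algebra_simps)
  next
    fix t assume "t \<in> {a<..<b}"
    then show "0 \<le> exp (- 2 * L * (t - a)) * (2 * L * \<phi> t - \<phi>' t)"
      using bd[of t] by (auto intro!: mult_nonneg_nonneg)
  qed (use \<open>a \<le> b\<close> in auto)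
  then have "exp (- (2 * L * (b - a))) * \<phi> b \<le> \<phi> a" by simp
  then have "exp (2 * L * (b - a)) * (exp (- (2 * L * (b - a))) * \<phi> b) \<le> exp (2 * L * (b - a)) * \<phi> a"
    by (rule mult_left_mono) auto
  then have "\<phi> b \<le> exp (2 * L * (b - a)) * \<phi> a"
    by (simp flip: mult.assoc exp_add)
  then show "norm (f b - g b) \<le> exp (L * (b - a)) * norm (f a - g a)" by (rule sq)
  have "exp (2 * L * (a - a)) * \<phi> a \<le> exp (2 * L * (b - a)) * \<phi> b"
  proof (rule nonneg_deriv_within_imp_le[where u = "\<lambda>t. exp (2 * L * (t - a)) * \<phi> t"
        and u' = "\<lambda>t. exp (2 * L * (t - a)) * (2 * L * \<phi> t + \<phi>' t)"])
    fix t assume t: "t \<in> {a..b}"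
    show "((\<lambda>t. exp (2 * L * (t - a)) * \<phi> t) has_real_derivative
       exp (2 * L * (t - a)) * (2 * L * \<phi> t + \<phi>' t)) (at t within {a..b})"
      by (rule derivative_eq_intros d[OF t] refl)+ (simp add: algebra_simps)
  next
    fix t assume "t \<in> {a<..<b}"
    then show "0 \<le> exp (2 * L * (t - a)) * (2 * L * \<phi> t + \<phi>' t)"
      using bd[of t] by (auto intro!: mult_nonneg_nonneg)
  qed (use \<open>a \<le> b\<close> in auto)
  then show "norm (f a - g a) \<le> exp (L * (b - a)) * norm (f b - g b)" by (intro sq) simp
qed

text \<open>\<open>has_derivative_sequence\<close> yields some limit function with the right
  derivative; pointwise limits are unique, so it agrees with g on S.\<close>

lemma has_vector_derivative_uniform_limit:
  fixes f :: "nat \<Rightarrow> real \<Rightarrow> 'a::banach"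
  assumes "convex S"
    and f: "\<And>n t. t \<in> S \<Longrightarrow> (f n has_vector_derivative f' n t) (at t within S)"
    and lim: "uniform_limit S f' g' sequentially"
    and g: "\<And>t. t \<in> S \<Longrightarrow> (\<lambda>n. f n t) \<longlonglongrightarrow> g t"
    and "t \<in> S"
  shows "(g has_vector_derivative g' t) (at t within S)"
proof -
  have "\<exists>h. \<forall>x\<in>S. (\<lambda>n. f n x) \<longlonglongrightarrow> h x \<and>
      (h has_derivative (\<lambda>r. r *\<^sub>R g' x)) (at x within S)"
  proof (rule has_derivative_sequence[where f = f and f' = "\<lambda>n x r. r *\<^sub>R f' n x"
        and l = "g t", OF \<open>convex S\<close> _ _ \<open>t \<in> S\<close> g[OF \<open>t \<in> S\<close>]])
    show "(f n has_derivative (\<lambda>r. r *\<^sub>R f' n x)) (at x within S)" if "x \<in> S" for n x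
      using f[OF that] by (simp add: has_vector_derivative_def)
    fix e :: real assume "0 < e"
    with lim have "\<forall>\<^sub>F n in sequentially. \<forall>x\<in>S. dist (f' n x) (g' x) < e"
      by (rule uniform_limitD)
    then show "\<forall>\<^sub>F n in sequentially. \<forall>x\<in>S. \<forall>h. norm (h *\<^sub>R f' n x - h *\<^sub>R g' x) \<le> e * norm h"
    proof eventually_elim
      case (elim n)
      show ?case
      proof (intro ballI allI)
        fix x h assume "x \<in> S"
        with elim have "norm (f' n x - g' x) \<le> e" by (auto simp: dist_norm intro: less_imp_le)
        then show "norm (h *\<^sub>R f' n x - h *\<^sub>R g' x) \<le> e * norm h"
          by (simp add: mult.commute[of e] mult_left_mono flip: scaleR_diff_right)
      qed
    qed
  qed
  then obtain h where h: "\<And>x. x \<in> S \<Longrightarrow> (\<lambda>n. f n x) \<longlonglongrightarrow> h x"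
    "\<And>x. x \<in> S \<Longrightarrow> (h has_derivative (\<lambda>r. r *\<^sub>R g' x)) (at x within S)" by blast
  have "h x = g x" if "x \<in> S" for x
    using h(1)[OF that] g[OF that] by (rule LIMSEQ_unique)
  then show ?thesis
    unfolding has_vector_derivative_def
    by (intro has_derivative_transform[OF \<open>t \<in> S\<close> _ h(2)[OF \<open>t \<in> S\<close>]]) auto
qed

text \<open>With a global Lipschitz constant the Picard iterates converge uniformly on every
  \<open>{0..T}\<close>, because the factorials in their increments make the majorant an exponential
  series. Hence neither short times nor a continuation argument enter.\<close>

theorem picard_lindeloef_global:
  fixes F :: "'a::euclidean_space \<Rightarrow> 'a"
  assumes lip: "\<And>x y. norm (F x - F y) \<le> L * norm (x - y)" and "0 \<le> L"
  shows "\<exists>y. y 0 = y0 \<and> (\<forall>t\<ge>0. (y has_vector_derivative F (y t)) (at t within {0..}))"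
proof -
  have contF: "continuous_on UNIV F"
    using lip \<open>0 \<le> L\<close> by (intro lipschitz_on_continuous_on[of L] lipschitz_onI) (auto simp: dist_norm)
  define f where "f = rec_nat (\<lambda>_::real. y0) (\<lambda>_ h t. y0 + integral {0..t} (\<lambda>s. F (h s)))"
  have f0: "f 0 = (\<lambda>_. y0)" and fS: "f (Suc n) = (\<lambda>t. y0 + integral {0..t} (\<lambda>s. F (f n s)))" for n
    by (auto simp: f_def)
  have cont: "continuous_on {0..T} (f n)" for n T
  proof (induction n arbitrary: T)
    case (Suc n)
    have "continuous_on {0..T} (\<lambda>s. F (f n s))"
      by (rule continuous_on_compose2[OF contF Suc]) auto
    then show ?case
      unfolding fS by (intro continuous_intros indefinite_integral_continuous_1 integrable_continuous_real)
  qed (simp add: f0)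
  have contF: "continuous_on {0..T} (\<lambda>s. F (f n s))" for n T
    by (rule continuous_on_compose2[OF contF cont]) auto
  have der: "(f (Suc n) has_vector_derivative F (f n t)) (at t within {0..T})" if "t \<in> {0..T}" for n t T
    unfolding fS
    using has_vector_derivative_add[OF has_vector_derivative_const[of y0]
        integral_has_vector_derivative[OF contF that]] by simp
  define B where "B = norm (F y0)"
  have step: "norm (f (Suc n) t - f n t) \<le> B * L ^ n * (t ^ Suc n / fact (Suc n))" if "0 \<le> t" for n t
    using that
  proof (induction n arbitrary: t)
    case 0
    then show ?case by (simp add: fS f0 B_def)
  next
    case (Suc n)
    have e: "f (Suc k) t = y0 + integral {0..t} (\<lambda>s. F (f k s))" for k
      by (simp only: fS[of k])
    have "norm (f (Suc (Suc n)) t - f (Suc n) t)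
        = norm (integral {0..t} (\<lambda>s. F (f (Suc n) s) - F (f n s)))"
      unfolding e[of "Suc n"] e[of n]
      by (subst integral_diff) (auto intro!: integrable_continuous_real contF)
    also have "\<dots> \<le> integral {0..t} (\<lambda>s. L * (B * L ^ n * (s ^ Suc n / fact (Suc n))))"
    proof (rule integral_norm_bound_integral)
      fix s assume "s \<in> {0..t}"
      then have "norm (F (f (Suc n) s) - F (f n s)) \<le> L * norm (f (Suc n) s - f n s)"
        by (intro lip)
      also have "\<dots> \<le> L * (B * L ^ n * (s ^ Suc n / fact (Suc n)))"
        using \<open>s \<in> {0..t}\<close> by (intro mult_left_mono Suc.IH \<open>0 \<le> L\<close>) auto
      finally show "norm (F (f (Suc n) s) - F (f n s)) \<le> L * (B * L ^ n * (s ^ Suc n / fact (Suc n)))" .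
    qed (auto intro!: integrable_continuous_real continuous_intros contF)
    also have "\<dots> = B * L ^ Suc n * (t ^ Suc (Suc n) / fact (Suc (Suc n)))"
    proof (rule integral_unique)
      have "((\<lambda>s. L * (B * L ^ n * (s ^ Suc n / fact (Suc n)))) has_integral
          B * L ^ Suc n * (t ^ Suc (Suc n) / fact (Suc (Suc n)))
          - B * L ^ Suc n * (0 ^ Suc (Suc n) / fact (Suc (Suc n)))) {0..t}"
      proof (rule fundamental_theorem_of_calculus[OF Suc.prems])
        fix s assume "s \<in> {0..t}"
        have "((\<lambda>s. B * L ^ Suc n * (s ^ Suc (Suc n) / fact (Suc (Suc n)))) has_real_derivative
           B * L ^ Suc n * (real (Suc (Suc n)) * s ^ Suc n / fact (Suc (Suc n)))) (at s within {0..t})"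
        proof -
          have "((\<lambda>s. s ^ Suc (Suc n)) has_real_derivative real (Suc (Suc n)) * s ^ Suc n) (at s within {0..t})"
            using DERIV_pow[of "Suc (Suc n)" s "{0..t}"] by (simp only: diff_Suc_Suc minus_nat.diff_0)
          from DERIV_cmult[OF DERIV_cdivide[OF this]] show ?thesis .
        qed
        moreover have "real (Suc (Suc n)) * s ^ Suc n / fact (Suc (Suc n)) = s ^ Suc n / fact (Suc n)"
          by (simp add: fact_Suc[of "Suc n"] del: power_Suc fact_Suc of_nat_Suc)
        ultimately show "((\<lambda>s. B * L ^ Suc n * (s ^ Suc (Suc n) / fact (Suc (Suc n)))) has_vector_derivative
           L * (B * L ^ n * (s ^ Suc n / fact (Suc n)))) (at s within {0..t})"
          by (simp add: has_real_derivative_iff_has_vector_derivative[symmetric] mult_ac)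
      qed
      then show "((\<lambda>s. L * (B * L ^ n * (s ^ Suc n / fact (Suc n)))) has_integral
          B * L ^ Suc n * (t ^ Suc (Suc n) / fact (Suc (Suc n)))) {0..t}" by simp
    qed
    finally show ?case .
  qed
  define y where "y t = y0 + (\<Sum>i. f (Suc i) t - f i t)" for t
  have sum: "f n t = y0 + (\<Sum>i<n. f (Suc i) t - f i t)" for n t
    by (subst sum_lessThan_telescope) (simp add: f0)
  have ul: "uniform_limit {0..T} f y sequentially" for T
  proof -
    have "uniform_limit {0..T} (\<lambda>n t. \<Sum>i<n. f (Suc i) t - f i t) (\<lambda>t. \<Sum>i. f (Suc i) t - f i t) sequentially"
    proof (rule Weierstrass_m_test)
      fix n t assume t: "t \<in> {0..T}"
      have "norm (f (Suc n) t - f n t) \<le> B * L ^ n * (t ^ Suc n / fact (Suc n))"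
        using t by (intro step) auto
      \<comment> \<open>Weakening \<open>fact (Suc n)\<close> to \<open>fact n\<close> turns the
        majorant into \<open>B * T\<close> times the exponential series of
        \<open>L * T\<close>.\<close>
      also have "\<dots> \<le> B * L ^ n * (T ^ Suc n / fact n)"
        using t \<open>0 \<le> L\<close> by (intro mult_left_mono frac_le power_mono) (auto simp: B_def fact_mono)
      finally show "norm (f (Suc n) t - f n t) \<le> B * L ^ n * (T ^ Suc n / fact n)" .
    next
      have "summable (\<lambda>n. (L * T) ^ n /\<^sub>R fact n)" by (rule summable_exp_generic)
      then have "summable (\<lambda>n. B * T * ((L * T) ^ n /\<^sub>R fact n))" by (rule summable_mult)
      then show "summable (\<lambda>n. B * L ^ n * (T ^ Suc n / fact n))"
        by (simp add: power_mult_distrib mult_ac divide_inverse)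
    qed
    then have "uniform_limit {0..T} (\<lambda>n t. y0 + (\<Sum>i<n. f (Suc i) t - f i t)) y sequentially"
      unfolding y_def[abs_def] by (intro uniform_limit_intros)
    then show ?thesis
      by (simp only: sum[symmetric])
  qed
  have ulF: "uniform_limit {0..T} (\<lambda>n t. F (f n t)) (\<lambda>t. F (y t)) sequentially" for T
    unfolding uniform_limit_sequentially_iff
  proof (intro allI impI)
    fix e :: real assume "0 < e"
    then have "0 < e / (L + 1)" using \<open>0 \<le> L\<close> by auto
    then obtain N where N: "\<And>n x. n \<ge> N \<Longrightarrow> x \<in> {0..T} \<Longrightarrow> dist (f n x) (y x) < e / (L + 1)"
      using ul[of T] unfolding uniform_limit_sequentially_iff by meson
    show "\<exists>N. \<forall>n\<ge>N. \<forall>x\<in>{0..T}. dist (F (f n x)) (F (y x)) < e"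
    proof (intro exI[of _ N] allI ballI impI)
      fix n x assume "N \<le> n" "x \<in> {0..T}"
      then have d: "norm (f n x - y x) < e / (L + 1)" using N by (auto simp: dist_norm)
      have "norm (F (f n x) - F (y x)) \<le> L * norm (f n x - y x)" by (rule lip)
      also have "\<dots> \<le> L * (e / (L + 1))" using d \<open>0 \<le> L\<close> by (intro mult_left_mono) auto
      also have "\<dots> < e" using \<open>0 \<le> L\<close> \<open>0 < e\<close> by (simp add: field_simps)
      finally show "dist (F (f n x)) (F (y x)) < e" by (simp add: dist_norm)
    qed
  qed
  have "(y has_vector_derivative F (y t)) (at t within {0..})" if "0 \<le> t" for t
  proof -
    \<comment> \<open>The interval ends at \<open>t + 1\<close> so that t is not its right end and
      the derivative transfers to \<open>{0..}\<close>.\<close>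
    have "(y has_vector_derivative F (y t)) (at t within {0..t+1})"
    proof (rule has_vector_derivative_uniform_limit[where f = "\<lambda>n. f (Suc n)"
          and f' = "\<lambda>n s. F (f n s)" and g' = "\<lambda>s. F (y s)"])
      show "(\<lambda>n. f (Suc n) s) \<longlonglongrightarrow> y s" if "s \<in> {0..t+1}" for s
        using tendsto_uniform_limitI[OF ul that] by (rule LIMSEQ_Suc)
    qed (use that der ulF in auto)
    then show ?thesis
      using at_within_Icc_atLeast[of t "t + 1" 0] by simp
  qed
  moreover have "y 0 = y0"
  proof -
    have "f n 0 = y0" for n by (cases n) (auto simp: f0 fS)
    then show ?thesis by (simp add: y_def)
  qed
  ultimately show ?thesis by blast
qed

section \<open>The field and its logarithmic form\<close>

lemma exhaust_5:
  fixes x :: 5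
  shows "x = 0 \<or> x = 1 \<or> x = 2 \<or> x = 3 \<or> x = 4"
proof (induct x)
  case (of_int z)
  then have "0 \<le> z" "z < 5" by simp_all
  then have "z = 0 \<or> z = 1 \<or> z = 2 \<or> z = 3 \<or> z = 4" by arith
  then show ?case by auto
qed

lemma UNIV_5: "(UNIV :: 5 set) = {0, 1, 2, 3, 4}"
  using exhaust_5 by auto

lemma minus_5: "- (1::5) = 4" "- (2::5) = 3" "- (3::5) = 2" "- (4::5) = 1"
  by simp_all

lemma distinct_5:
  "(0::5) \<noteq> 1" "(0::5) \<noteq> 2" "(0::5) \<noteq> 3" "(0::5) \<noteq> 4" "(1::5) \<noteq> 2"
  "(1::5) \<noteq> 3" "(1::5) \<noteq> 4" "(2::5) \<noteq> 3" "(2::5) \<noteq> 4" "(3::5) \<noteq> 4"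
  by simp_all

lemma sum_abs_le_norm:
  fixes x :: "real ^ 5"
  shows "(\<Sum>i\<in>UNIV. \<bar>x $ i\<bar>) \<le> 5 * norm x"
  using sum_bounded_above[of UNIV "\<lambda>i. \<bar>x $ i\<bar>" "norm x"] component_le_norm_cart[of x] by simp

lemma solution_on_subset:
  "solution_on cA cB eA eB T f \<Longrightarrow> S \<subseteq> T \<Longrightarrow> solution_on cA cB eA eB S f"
  unfolding solution_on_def by (meson has_vector_derivative_within_subset subsetD)

lemma solution_on_cong:
  assumes "solution_on cA cB eA eB T f" "\<And>t. t \<in> T \<Longrightarrow> f t = g t"
  shows "solution_on cA cB eA eB T g"
  using assms unfolding solution_on_def by (metis has_vector_derivative_transform)

lemma solution_on_continuous:
  "solution_on cA cB eA eB T f \<Longrightarrow> continuous_on T f"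
  unfolding solution_on_def
  by (meson continuous_on_eq_continuous_within has_vector_derivative_continuous)

lemma solution_on_shift:
  assumes "solution_on cA cB eA eB {a..b} f"
  shows "solution_on cA cB eA eB {a - c..b - c} (\<lambda>t. f (t + c))"
  unfolding solution_on_def
proof
  fix t assume t: "t \<in> {a - c..b - c}"
  then have "(f has_vector_derivative vfield cA cB eA eB (f (t + c))) (at (t + c) within {a..b})"
    using assms unfolding solution_on_def by auto
  moreover have "(\<lambda>t. t + c) ` {a - c..b - c} = {a..b}" by simp
  ultimately have "((f \<circ> (\<lambda>t. t + c)) has_vector_derivative 1 *\<^sub>R vfield cA cB eA eB (f (t + c)))
      (at t within {a - c..b - c})"
    by (intro vector_diff_chain_within) (auto intro!: derivative_eq_intros)
  then show "((\<lambda>t. f (t + c)) has_vector_derivative vfield cA cB eA eB (f (t + c)))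
      (at t within {a - c..b - c})"
    by (simp add: o_def)
qed

locale lotka_volterra =
  fixes cA cB eA eB :: real
  assumes pos: "0 < cA" "0 < cB" "0 < eA" "0 < eB"
begin

text \<open>At \<open>\<xi> i\<close> the Jacobian has the eigenvalue \<open>al (j - i)\<close> in
  each direction j other than i. The value at 0 is 0 and not the radial eigenvalue -1, because
  \<open>al\<close> enters logarithmic rates, and the rate of coordinate i vanishes at
  \<open>\<xi> i\<close>.\<close>

definition al :: "5 \<Rightarrow> real" where
  "al d = (if d = 1 then eA else if d = 2 then - cB else if d = 3 then eB else if d = 4 then - cA else 0)"

text \<open>The derivative of \<open>ln (x $ j)\<close> along positive solutions; the coefficients
  \<open>al (j - i)\<close> make the cyclic symmetry explicit.\<close>

definition rate :: "real ^ 5 \<Rightarrow> 5 \<Rightarrow> real" where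
  "rate x j = 1 + (\<Sum>i\<in>UNIV. (al (j - i) - 1) * x $ i)"

definition Lam :: real where "Lam = 1 + cA + cB + eA + eB"

definition mu :: real where "mu = min (min cA cB) (min eA eB)"

abbreviation V where "V \<equiv> vfield cA cB eA eB"
abbreviation sol where "sol \<equiv> solution_on cA cB eA eB"
abbreviation \<Sigma> where "\<Sigma> \<equiv> network cA cB eA eB"

lemma al_simps: "al 0 = 0" "al 1 = eA" "al 2 = - cB" "al 3 = eB" "al 4 = - cA"
  by (simp_all add: al_def)

lemma Lam_gt_1: "1 < Lam" and mu_pos: "0 < mu"
  using pos by (auto simp: Lam_def mu_def)

lemma abs_al: "\<bar>al d\<bar> \<le> Lam - 1" and abs_al_minus: "\<bar>al d - 1\<bar> \<le> Lam"
  using exhaust_5[of d] pos by (auto simp: al_simps Lam_def)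

lemma mu_le_abs_al: "d \<noteq> 0 \<Longrightarrow> mu \<le> \<bar>al d\<bar>"
  using exhaust_5[of d] pos by (auto simp: al_simps mu_def)

text \<open>On a connection from k to \<open>k + d\<close>, \<open>al d\<close> is the unstable
  eigenvalue at its start, and \<open>al (- d)\<close> the stable eigenvalue at its end in the
  direction of the equilibrium left behind. Both signs drive the transition.\<close>

lemma al_out: "d \<in> {1, 3} \<Longrightarrow> mu \<le> al d \<and> al (- d) \<le> - mu"
  using pos by (auto simp: al_simps mu_def minus_5)

lemma al_nonneg_or: "d \<noteq> 0 \<Longrightarrow> mu \<le> al d \<or> al d \<le> - mu"
  using mu_le_abs_al[of d] by linarith

lemma vfield_nth: "V x $ j = x $ j * rate x j"
proof -
  \<comment> \<open>Substituting \<open>i = j + d\<close> gives the coefficient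
    \<open>al (- d)\<close>, which is -cA, eB, -cB, eA for d = 1, 2, 3, 4.\<close>
  have "(\<Sum>i\<in>UNIV. al (j - i) * x $ i) = (\<Sum>d\<in>UNIV. al (- d) * x $ (j + d))"
    by (rule sum.reindex_bij_witness[of _ "\<lambda>d. j + d" "\<lambda>i. i - j"]) auto
  also have "\<dots> = - cA * x $ (j + 1) + eB * x $ (j + 2) - cB * x $ (j + 3) + eA * x $ (j + 4)"
    unfolding UNIV_5 by (simp add: distinct_5 al_simps minus_5)
  finally have "rate x j = 1 - (\<Sum>i\<in>UNIV. x $ i)
      - cA * x $ (j + 1) + eB * x $ (j + 2) - cB * x $ (j + 3) + eA * x $ (j + 4)"
    by (simp add: rate_def left_diff_distrib sum_subtractf)
  then show ?thesis by (simp add: vfield_def)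
qed

lemma rate_diff: "\<bar>rate x j - rate z j\<bar> \<le> Lam * (\<Sum>i\<in>UNIV. \<bar>x $ i - z $ i\<bar>)"
proof -
  have "rate x j - rate z j = (\<Sum>i\<in>UNIV. (al (j - i) - 1) * (x $ i - z $ i))"
    by (simp add: rate_def right_diff_distrib sum_subtractf)
  also have "\<bar>\<dots>\<bar> \<le> (\<Sum>i\<in>UNIV. Lam * \<bar>x $ i - z $ i\<bar>)"
    by (rule order.trans[OF sum_abs]) (auto intro!: sum_mono mult_right_mono abs_al_minus simp: abs_mult)
  finally show ?thesis by (simp add: sum_distrib_left)
qed

lemma abs_rate: "\<bar>rate x j\<bar> \<le> 1 + Lam * (\<Sum>i\<in>UNIV. \<bar>x $ i\<bar>)"
  using rate_diff[of x j 0] by (simp add: rate_def)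

lemma abs_rate_box:
  assumes "\<And>i. \<bar>x $ i\<bar> \<le> R"
  shows "\<bar>rate x j\<bar> \<le> 1 + 5 * Lam * R"
proof -
  have "(\<Sum>i\<in>UNIV. \<bar>x $ i\<bar>) \<le> 5 * R"
    using sum_bounded_above[of UNIV "\<lambda>i. \<bar>x $ i\<bar>" R] assms by simp
  then have "Lam * (\<Sum>i\<in>UNIV. \<bar>x $ i\<bar>) \<le> Lam * (5 * R)"
    using Lam_gt_1 by (intro mult_left_mono) auto
  with abs_rate[of x j] show ?thesis by simp
qed

text \<open>The constant comes from the product \<open>x $ j * rate x j\<close>:
  \<open>1 + 5 * Lam * R\<close> bounds the rate, another \<open>5 * Lam * R\<close> is R times the
  Lipschitz constant of the rate, and the factor 5 passes from components to the norm.\<close>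

definition lipV :: "real \<Rightarrow> real" where "lipV R = 5 * (1 + 10 * Lam * R)"

lemma lipschitz_V:
  assumes "norm x \<le> R" "norm z \<le> R"
  shows "norm (V x - V z) \<le> lipV R * norm (x - z)"
proof -
  have R: "0 \<le> R" using assms norm_ge_zero order_trans by blast
  have "\<bar>(V x - V z) $ j\<bar> \<le> (1 + 10 * Lam * R) * norm (x - z)" for j
  proof -
    have "(V x - V z) $ j = (x - z) $ j * rate x j + z $ j * (rate x j - rate z j)"
      by (simp add: vfield_nth algebra_simps)
    then have "\<bar>(V x - V z) $ j\<bar> \<le> \<bar>(x - z) $ j\<bar> * \<bar>rate x j\<bar> + \<bar>z $ j\<bar> * \<bar>rate x j - rate z j\<bar>"
      by (metis abs_mult abs_triangle_ineq)
    also have "\<dots> \<le> norm (x - z) * (1 + 5 * Lam * R) + R * (Lam * (5 * norm (x - z)))"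
    proof (intro add_mono mult_mono)
      show "\<bar>(x - z) $ j\<bar> \<le> norm (x - z)" by (rule component_le_norm_cart)
      show "\<bar>rate x j\<bar> \<le> 1 + 5 * Lam * R"
        using component_le_norm_cart[of x] assms by (intro abs_rate_box) (meson order_trans)
      show "\<bar>z $ j\<bar> \<le> R" using component_le_norm_cart[of z j] assms by linarith
      have "\<bar>rate x j - rate z j\<bar> \<le> Lam * (\<Sum>i\<in>UNIV. \<bar>(x - z) $ i\<bar>)"
        using rate_diff[of x j z] by simp
      also have "\<dots> \<le> Lam * (5 * norm (x - z))"
        using Lam_gt_1 by (intro mult_left_mono sum_abs_le_norm) auto
      finally show "\<bar>rate x j - rate z j\<bar> \<le> Lam * (5 * norm (x - z))" .
    qed (use R in auto)
    finally show ?thesis by (simp add: algebra_simps)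
  qed
  then have "(\<Sum>j\<in>UNIV. \<bar>(V x - V z) $ j\<bar>) \<le> (\<Sum>j\<in>(UNIV::5 set). (1 + 10 * Lam * R) * norm (x - z))"
    by (intro sum_mono)
  then show ?thesis
    using norm_le_l1_cart[of "V x - V z"] by (simp add: lipV_def algebra_simps)
qed

lemma sol_dist:
  assumes f: "sol {a..b} f" "\<And>t. t \<in> {a..b} \<Longrightarrow> norm (f t) \<le> R"
    and g: "sol {a..b} g" "\<And>t. t \<in> {a..b} \<Longrightarrow> norm (g t) \<le> R"
    and c: "c = a \<or> c = b" and t: "t \<in> {a..b}"
  shows "norm (f t - g t) \<le> exp (lipV R * (b - a)) * norm (f c - g c)"
proof -
  have R: "0 \<le> R" using f(2)[OF t] norm_ge_zero order_trans by blast
  then have L: "0 \<le> lipV R" using Lam_gt_1 by (simp add: lipV_def)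
  have gr: "norm (f s - g s) \<le> exp (lipV R * (s' - s)) * norm (f s' - g s')"
       "norm (f s' - g s') \<le> exp (lipV R * (s' - s)) * norm (f s - g s)"
    if "a \<le> s" "s \<le> s'" "s' \<le> b" for s s'
  proof -
    have "sol {s..s'} f" "sol {s..s'} g"
      using f(1) g(1) that by (auto elim!: solution_on_subset)
    then have "\<And>t. t \<in> {s..s'} \<Longrightarrow> (f has_vector_derivative V (f t)) (at t within {s..s'})"
        "\<And>t. t \<in> {s..s'} \<Longrightarrow> (g has_vector_derivative V (g t)) (at t within {s..s'})"
      by (auto simp: solution_on_def)
    note gr = gronwall_two_solutions[OF that(2) this, of "lipV R"]
    have "norm (V (f t) - V (g t)) \<le> lipV R * norm (f t - g t)" if "t \<in> {s..s'}" for t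
      using f(2) g(2) that \<open>a \<le> s\<close> \<open>s' \<le> b\<close> by (intro lipschitz_V) auto
    with gr show "norm (f s - g s) \<le> exp (lipV R * (s' - s)) * norm (f s' - g s')"
       "norm (f s' - g s') \<le> exp (lipV R * (s' - s)) * norm (f s - g s)" by auto
  qed
  have "norm (f t - g t) \<le> exp (lipV R * \<bar>t - c\<bar>) * norm (f c - g c)"
    using c gr[of a t] gr[of t b] t by auto
  also have "\<dots> \<le> exp (lipV R * (b - a)) * norm (f c - g c)"
    using c t L by (intro mult_right_mono) (auto intro!: mult_left_mono)
  finally show ?thesis .
qed

text \<open>By Gronwall, convergence at one endpoint c forces uniform convergence on the interval,
  and the Lipschitz bound carries it over to the derivatives. The case \<open>c = b\<close> serves
  backward limits, \<open>c = a\<close> the closedness of sets of initial points.\<close>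

lemma sol_limit:
  assumes f: "\<And>n. sol {a..b} (f n)" "\<And>n t. t \<in> {a..b} \<Longrightarrow> norm (f n t) \<le> R"
    and c: "c = a \<or> c = b" and "a \<le> b" and conv: "(\<lambda>n. f n c) \<longlonglongrightarrow> x"
    and g: "\<And>t. t \<in> {a..b} \<Longrightarrow> g t = lim (\<lambda>n. f n t)"
  shows "sol {a..b} g" "\<And>t. t \<in> {a..b} \<Longrightarrow> (\<lambda>n. f n t) \<longlonglongrightarrow> g t"
proof -
  have cI: "c \<in> {a..b}" using c \<open>a \<le> b\<close> by auto
  have R: "0 \<le> R" using f(2)[OF cI, of 0] norm_ge_zero order_trans by blast
  have "uniformly_Cauchy_on {a..b} f"
    unfolding uniformly_Cauchy_on_def
  proof (intro allI impI)
    fix e :: real assume "0 < e"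
    let ?E = "exp (lipV R * (b - a))"
    have "Cauchy (\<lambda>n. f n c)" using conv by (rule LIMSEQ_imp_Cauchy)
    then obtain M where M: "\<And>m n. m \<ge> M \<Longrightarrow> n \<ge> M \<Longrightarrow> norm (f m c - f n c) < e / ?E"
      using \<open>0 < e\<close> unfolding Cauchy_iff by (metis divide_pos_pos exp_gt_zero)
    show "\<exists>M. \<forall>x\<in>{a..b}. \<forall>m\<ge>M. \<forall>n\<ge>M. dist (f m x) (f n x) < e"
    proof (intro exI[of _ M] ballI allI impI)
      fix t m n assume t: "t \<in> {a..b}" and "M \<le> m" "M \<le> n"
      have "norm (f m t - f n t) \<le> ?E * norm (f m c - f n c)"
        by (rule sol_dist) (use f c t in auto)
      also have "\<dots> < ?E * (e / ?E)"
        using M[OF \<open>M \<le> m\<close> \<open>M \<le> n\<close>] by (intro mult_strict_left_mono) auto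
      finally show "dist (f m t) (f n t) < e" by (simp add: dist_norm)
    qed
  qed
  then have "uniformly_convergent_on {a..b} f"
    by (rule Cauchy_uniformly_convergent)
  then obtain h where h: "uniform_limit {a..b} f h sequentially"
    by (auto simp: uniformly_convergent_on_def)
  have hg: "h t = g t" if "t \<in> {a..b}" for t
    using tendsto_uniform_limitI[OF h that] g[OF that] by (simp add: limI)
  have ul: "uniform_limit {a..b} f g sequentially"
    by (rule uniform_limit_cong'[THEN iffD1, OF _ _ h]) (auto simp: hg)
  show lim: "(\<lambda>n. f n t) \<longlonglongrightarrow> g t" if "t \<in> {a..b}" for t
    by (rule tendsto_uniform_limitI[OF ul that])
  have bd: "norm (g t) \<le> R" if "t \<in> {a..b}" for t
    by (rule LIMSEQ_le_const2[OF tendsto_norm[OF lim[OF that]]]) (use f(2) that in auto)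
  have L: "0 \<le> lipV R" using R Lam_gt_1 by (simp add: lipV_def)
  have ulV: "uniform_limit {a..b} (\<lambda>n t. V (f n t)) (\<lambda>t. V (g t)) sequentially"
    unfolding uniform_limit_sequentially_iff
  proof (intro allI impI)
    fix e :: real assume "0 < e"
    then have "0 < e / (lipV R + 1)" using L by auto
    then obtain N where N: "\<And>n x. n \<ge> N \<Longrightarrow> x \<in> {a..b} \<Longrightarrow> dist (f n x) (g x) < e / (lipV R + 1)"
      using ul unfolding uniform_limit_sequentially_iff by meson
    show "\<exists>N. \<forall>n\<ge>N. \<forall>x\<in>{a..b}. dist (V (f n x)) (V (g x)) < e"
    proof (intro exI[of _ N] allI ballI impI)
      fix n x assume n: "N \<le> n" and x: "x \<in> {a..b}"
      have "norm (V (f n x) - V (g x)) \<le> lipV R * norm (f n x - g x)"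
        by (rule lipschitz_V[OF f(2)[OF x] bd[OF x]])
      also have "\<dots> \<le> lipV R * (e / (lipV R + 1))"
        using N[OF n x] L by (intro mult_left_mono) (auto simp: dist_norm)
      also have "\<dots> < e" using L \<open>0 < e\<close> by (simp add: field_simps)
      finally show "dist (V (f n x)) (V (g x)) < e" by (simp add: dist_norm)
    qed
  qed
  show "sol {a..b} g"
    unfolding solution_on_def
  proof
    fix t assume "t \<in> {a..b}"
    show "(g has_vector_derivative V (g t)) (at t within {a..b})"
      by (rule has_vector_derivative_uniform_limit[OF _ _ ulV, where f = f])
        (use f lim \<open>t \<in> {a..b}\<close> in \<open>auto simp: solution_on_def\<close>)
  qed
qed

text \<open>Truncation makes the logarithmic field globally Lipschitz; as long as the coordinates stay
  below R it does not change the trajectory.\<close>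

definition trunc :: "real \<Rightarrow> real ^ 5 \<Rightarrow> real ^ 5" where
  "trunc R y = (\<chi> i. min (exp (y $ i)) R)"

definition log_sol :: "real \<Rightarrow> (real \<Rightarrow> real ^ 5) \<Rightarrow> bool" where
  "log_sol R y \<longleftrightarrow> (\<forall>t\<ge>0. \<forall>j.
     ((\<lambda>t. y t $ j) has_real_derivative rate (trunc R (y t)) j) (at t within {0..}))"

text \<open>Truncating the exponential at R is truncating its argument at \<open>ln R\<close>, and
  on arguments up to \<open>ln R\<close> its slope is at most R.\<close>

lemma min_exp_lipschitz:
  fixes a b R :: real
  assumes "0 < R"
  shows "\<bar>min (exp a) R - min (exp b) R\<bar> \<le> R * \<bar>a - b\<bar>"
proof -
  have m: "min (exp a) R = exp (min a (ln R))" for a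
    using assms by (auto simp: min_def ln_ge_iff)
  have *: "exp a - exp b \<le> R * (a - b)" if "b \<le> a" "a \<le> ln R" for a b :: real
  proof -
    have "exp a - exp b = exp a * (1 - exp (b - a))" by (simp add: algebra_simps flip: exp_add)
    also have "\<dots> \<le> R * (a - b)"
    proof (rule mult_mono)
      show "exp a \<le> R" using that assms by (simp add: ln_ge_iff)
      show "1 - exp (b - a) \<le> a - b" using exp_ge_add_one_self[of "b - a"] by linarith
    qed (use that assms in auto)
    finally show ?thesis .
  qed
  have "\<bar>exp a - exp b\<bar> \<le> R * \<bar>a - b\<bar>" if "a \<le> ln R" "b \<le> ln R" for a b :: real
    using *[of a b] *[of b a] that by (cases "a \<le> b") auto
  then have "\<bar>min (exp a) R - min (exp b) R\<bar> \<le> R * \<bar>min a (ln R) - min b (ln R)\<bar>"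
    unfolding m by simp
  also have "\<dots> \<le> R * \<bar>a - b\<bar>" using assms by (intro mult_left_mono) auto
  finally show ?thesis .
qed

lemma log_sol_exists:
  assumes "0 < R"
  shows "\<exists>y. y 0 = y0 \<and> log_sol R y"
proof -
  define F where "F y = (\<chi> j. rate (trunc R y) j)" for y
  have "norm (F y - F z) \<le> 25 * Lam * R * norm (y - z)" for y z
  proof -
    have "\<bar>(F y - F z) $ j\<bar> \<le> 5 * Lam * R * norm (y - z)" for j
    proof -
      have "\<bar>(F y - F z) $ j\<bar> \<le> Lam * (\<Sum>i\<in>UNIV. \<bar>trunc R y $ i - trunc R z $ i\<bar>)"
        unfolding F_def by (simp add: rate_diff)
      also have "\<dots> \<le> Lam * (\<Sum>i\<in>UNIV. R * \<bar>(y - z) $ i\<bar>)"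
        using Lam_gt_1 assms unfolding trunc_def
        by (intro mult_left_mono sum_mono) (auto simp: min_exp_lipschitz)
      also have "\<dots> \<le> Lam * (R * (5 * norm (y - z)))"
        using Lam_gt_1 assms unfolding sum_distrib_left[symmetric]
        by (intro mult_left_mono sum_abs_le_norm) auto
      finally show ?thesis by (simp add: mult_ac)
    qed
    then have "(\<Sum>j\<in>UNIV. \<bar>(F y - F z) $ j\<bar>) \<le> (\<Sum>j\<in>(UNIV::5 set). 5 * Lam * R * norm (y - z))"
      by (intro sum_mono)
    then show ?thesis
      using norm_le_l1_cart[of "F y - F z"] by simp
  qed
  moreover have "0 \<le> 25 * Lam * R" using Lam_gt_1 assms by auto
  ultimately obtain y where y: "y 0 = y0" "\<And>t. t \<ge> 0 \<Longrightarrow> (y has_vector_derivative F (y t)) (at t within {0..})"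
    using picard_lindeloef_global[of F "25 * Lam * R" y0] by blast
  have "log_sol R y"
    unfolding log_sol_def
  proof (intro allI impI)
    fix t :: real and j assume "0 \<le> t"
    from bounded_linear.has_vector_derivative[OF bounded_linear_vec_nth y(2)[OF this], of j]
    show "((\<lambda>t. y t $ j) has_real_derivative rate (trunc R (y t)) j) (at t within {0..})"
      by (simp add: has_real_derivative_iff_has_vector_derivative F_def)
  qed
  with y(1) show ?thesis by blast
qed

text \<open>Logarithmic solutions describe only points with positive coordinates, which suffices for
  an open set of initial conditions.\<close>

lemma log_sol_imp_sol:
  assumes y: "log_sol R y" and le: "\<And>t i. 0 \<le> t \<Longrightarrow> exp (y t $ i) \<le> R"
  shows "sol {0..} (\<lambda>t. \<chi> i. exp (y t $ i))"
  unfolding solution_on_def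
proof
  fix t :: real assume "t \<in> {0..}"
  then have t: "0 \<le> t" by simp
  let ?x = "\<lambda>t. \<chi> i. exp (y t $ i)"
  have tr: "trunc R (y t) = ?x t"
    using le[OF t] by (simp add: trunc_def vec_eq_iff min_def)
  show "(?x has_vector_derivative V (?x t)) (at t within {0..})"
    unfolding has_vector_derivative_def
  proof (subst has_derivative_componentwise_within, rule ballI)
    fix b :: "real ^ 5" assume "b \<in> Basis"
    then obtain i where b: "b = axis i 1" by (auto simp: Basis_vec_def)
    have "((\<lambda>t. y t $ i) has_real_derivative rate (trunc R (y t)) i) (at t within {0..})"
      using y t by (simp add: log_sol_def)
    then have "((\<lambda>t. exp (y t $ i)) has_real_derivative exp (y t $ i) * rate (?x t) i) (at t within {0..})"
      unfolding tr by (auto intro!: derivative_eq_intros)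
    then show "((\<lambda>t. ?x t \<bullet> b) has_derivative (\<lambda>h. (h *\<^sub>R V (?x t)) \<bullet> b)) (at t within {0..})"
      by (simp add: b inner_axis has_field_derivative_def mult_commute_abs vfield_nth)
  qed
qed

end

section \<open>Passage through the box of an equilibrium\<close>

lemma pos_deriv_within_imp_less:
  fixes u :: "real \<Rightarrow> real"
  assumes "a < b"
    and "\<And>t. t \<in> {a..b} \<Longrightarrow> (u has_real_derivative u' t) (at t within {a..b})"
    and "\<And>t. t \<in> {a..b} \<Longrightarrow> 0 < u' t"
  shows "u a < u b"
proof -
  obtain x where "x \<in> {a<..<b}" "u b - u a = u' x * (b - a)"
    using mvt_simple[of a b u "\<lambda>x. (*) (u' x)"] assms(1,2)
    by (auto simp: has_field_derivative_def)
  moreover have "0 < u' x * (b - a)"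
    using assms(1) assms(3)[of x] \<open>x \<in> {a<..<b}\<close> by auto
  ultimately show ?thesis by linarith
qed

lemma first_hit:
  fixes g :: "real \<Rightarrow> real"
  assumes "a \<le> b" and cont: "continuous_on {a..b} g" and "g a < 0" "0 \<le> g b"
  obtains s where "a < s" "s \<le> b" "g s = 0" "\<And>t. a \<le> t \<Longrightarrow> t < s \<Longrightarrow> g t < 0"
proof -
  let ?S = "{a..b} \<inter> g -` {0..}"
  have cl: "closed ?S" using continuous_closed_preimage[OF cont, of "{0..}"] by simp
  have ne: "?S \<noteq> {}" using assms by auto
  have bdd: "bdd_below ?S" by (auto intro!: bdd_belowI[of _ a])
  define s where "s = Inf ?S"
  have s: "s \<in> ?S" unfolding s_def by (rule closed_contains_Inf[OF ne bdd cl])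
  have less: "g t < 0" if "a \<le> t" "t < s" for t
  proof (rule ccontr)
    assume "\<not> g t < 0"
    then have "t \<in> ?S" using that s by auto
    then have "s \<le> t" unfolding s_def using bdd by (rule cInf_lower)
    with that show False by simp
  qed
  have "a < s" using s \<open>g a < 0\<close> by (cases "a = s") auto
  moreover have "g s = 0"
  proof (rule ccontr)
    assume "g s \<noteq> 0"
    with s have "0 < g s" by auto
    have "\<exists>t\<ge>a. t \<le> s \<and> g t = 0"
      by (rule IVT') (use \<open>g a < 0\<close> \<open>0 < g s\<close> s in \<open>auto intro: continuous_on_subset[OF cont]\<close>)
    then obtain t where "a \<le> t" "t \<le> s" "g t = 0" by auto
    with less[of t] \<open>0 < g s\<close> show False by (cases "t = s") auto
  qed
  ultimately show thesis using that s less by auto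
qed

context lotka_volterra
begin

text \<open>Near \<open>\<xi> k\<close> only \<open>x $ k\<close> is not small, so the rate is an
  explicit function of it up to a multiple of the remaining coordinates.\<close>

lemma rate_split:
  "\<bar>rate x j - (1 + (al (j - k) - 1) * x $ k)\<bar> \<le> Lam * (\<Sum>i\<in>UNIV - {k}. \<bar>x $ i\<bar>)"
proof -
  have "rate x j - (1 + (al (j - k) - 1) * x $ k) = (\<Sum>i\<in>UNIV - {k}. (al (j - i) - 1) * x $ i)"
    unfolding rate_def by (subst sum.remove[of UNIV k]) auto
  also have "\<bar>\<dots>\<bar> \<le> (\<Sum>i\<in>UNIV - {k}. Lam * \<bar>x $ i\<bar>)"
    by (rule order.trans[OF sum_abs]) (auto intro!: sum_mono mult_right_mono abs_al_minus simp: abs_mult)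
  finally show ?thesis by (simp add: sum_distrib_left)
qed

lemma rate_split2:
  assumes "k \<noteq> l"
  shows "\<bar>rate x j - (1 + (al (j - k) - 1) * x $ k + (al (j - l) - 1) * x $ l)\<bar>
    \<le> Lam * (\<Sum>i\<in>UNIV - {k, l}. \<bar>x $ i\<bar>)"
proof -
  have *: "UNIV - {k} - {l} = UNIV - {k, l}" by auto
  have "rate x j - (1 + (al (j - k) - 1) * x $ k + (al (j - l) - 1) * x $ l)
      = (\<Sum>i\<in>UNIV - {k, l}. (al (j - i) - 1) * x $ i)"
    unfolding rate_def
    by (subst sum.remove[of UNIV k], simp, simp, subst sum.remove[of "UNIV - {k}" l])
      (use assms in \<open>auto simp: *\<close>)
  also have "\<bar>\<dots>\<bar> \<le> (\<Sum>i\<in>UNIV - {k, l}. Lam * \<bar>x $ i\<bar>)"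
    by (rule order.trans[OF sum_abs]) (auto intro!: sum_mono mult_right_mono abs_al_minus simp: abs_mult)
  finally show ?thesis by (simp add: sum_distrib_left)
qed

text \<open>The radial tolerance is \<open>5 * Lam * h\<close> because the other four coordinates
  disturb the logistic rate \<open>1 - x $ k\<close> by at most \<open>4 * Lam * h\<close>: the
  field points inwards on the two radial faces.\<close>

definition inbox :: "real \<Rightarrow> 5 \<Rightarrow> real ^ 5 \<Rightarrow> bool" where
  "inbox h k x \<longleftrightarrow> (\<forall>j. 0 \<le> x $ j) \<and> (\<forall>j. j \<noteq> k \<longrightarrow> x $ j \<le> h) \<and> \<bar>x $ k - 1\<bar> \<le> 5 * Lam * h"

definition ex :: "real ^ 5 \<Rightarrow> real ^ 5" where
  "ex y = (\<chi> i. exp (y $ i))"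

text \<open>The number 36 is 4 times 9: in a box the rates differ from \<open>al (j - k)\<close> by
  at most \<open>5 * Lam\<^sup>2 * h + 4 * Lam * h\<close>, hence by at most
  \<open>9 * Lam\<^sup>2 * h\<close>, and keeping this below \<open>mu / 4\<close> preserves the
  signs of all eigenvalues.\<close>

definition small :: "real \<Rightarrow> bool" where
  "small h \<longleftrightarrow> 0 < h \<and> 36 * Lam\<^sup>2 * h \<le> mu"

lemma mu_less_Lam: "mu < Lam"
  using pos by (auto simp: mu_def Lam_def)

lemma Lam_sq: "Lam \<le> Lam\<^sup>2"
  using Lam_gt_1 by (simp add: power2_eq_square)

lemma smallD:
  assumes "small h"
  shows "0 < h" "36 * Lam\<^sup>2 * h \<le> mu" "36 * Lam * h \<le> 1" "36 * h \<le> 1" "36 * Lam * h \<le> mu"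
proof -
  show h: "0 < h" "36 * Lam\<^sup>2 * h \<le> mu" using assms by (auto simp: small_def)
  have "Lam * (36 * Lam * h) \<le> Lam * 1"
    using h(2) mu_less_Lam by (simp add: power2_eq_square mult_ac)
  then show 1: "36 * Lam * h \<le> 1" using Lam_gt_1 by (subst (asm) mult_le_cancel_left_pos) auto
  have "36 * h * 1 \<le> 36 * h * Lam" using Lam_gt_1 h by (intro mult_left_mono) auto
  with 1 show "36 * h \<le> 1" by (simp add: mult_ac)
  have "36 * h * Lam \<le> 36 * h * Lam\<^sup>2" using Lam_sq h by (intro mult_left_mono) auto
  with h(2) show "36 * Lam * h \<le> mu" by (simp add: mult_ac)
qed

lemma inbox_sum:
  assumes "inbox h k x"
  shows "(\<Sum>i\<in>UNIV - {k}. \<bar>x $ i\<bar>) \<le> 4 * h"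
proof -
  have "(\<Sum>i\<in>UNIV - {k}. \<bar>x $ i\<bar>) \<le> of_nat (card (UNIV - {k})) * h"
    by (rule sum_bounded_above) (use assms in \<open>auto simp: inbox_def\<close>)
  then show ?thesis by (simp add: card_Diff_singleton)
qed

lemma inbox_rate:
  assumes "small h" "inbox h k x"
  shows "\<bar>rate x j - al (j - k)\<bar> \<le> mu / 4"
    and "\<bar>rate x k - (1 - x $ k)\<bar> \<le> 4 * Lam * h"
proof -
  note s = smallD[OF \<open>small h\<close>]
  have b: "\<bar>rate x j - (1 + (al (j - k) - 1) * x $ k)\<bar> \<le> 4 * Lam * h" for j
  proof -
    have "Lam * (\<Sum>i\<in>UNIV - {k}. \<bar>x $ i\<bar>) \<le> Lam * (4 * h)"
      using inbox_sum[OF assms(2)] Lam_gt_1 by (intro mult_left_mono) auto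
    with rate_split[of x j k] show ?thesis by simp
  qed
  from b[of k] show "\<bar>rate x k - (1 - x $ k)\<bar> \<le> 4 * Lam * h" by (simp add: al_simps)
  have "\<bar>(al (j - k) - 1) * (x $ k - 1)\<bar> \<le> Lam * (5 * Lam * h)"
    unfolding abs_mult using assms(2) Lam_gt_1
    by (intro mult_mono abs_al_minus) (auto simp: inbox_def)
  then have "\<bar>(al (j - k) - 1) * (x $ k - 1)\<bar> \<le> 5 * (Lam\<^sup>2 * h)"
    by (simp add: power2_eq_square mult_ac)
  moreover have "Lam * h \<le> Lam\<^sup>2 * h"
    using Lam_sq s(1) by (intro mult_right_mono) auto
  ultimately have "\<bar>(al (j - k) - 1) * (x $ k - 1)\<bar> + 4 * Lam * h \<le> mu / 4"
    using s(2) by linarith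
  moreover have "rate x j - al (j - k)
      = (rate x j - (1 + (al (j - k) - 1) * x $ k)) + (al (j - k) - 1) * (x $ k - 1)"
    by (simp add: algebra_simps)
  ultimately show "\<bar>rate x j - al (j - k)\<bar> \<le> mu / 4" using b[of j] by linarith
qed

text \<open>An a priori bound for the transitions: the arriving coordinate has nonpositive rate once
  it reaches this value, given that the departing one is at most 3/2. It is also the truncation
  level of the logarithmic field.\<close>

definition bigR :: real where "bigR = 2 + 2 * (eA + eB)"

text \<open>Bounds the rates of the truncated field everywhere, and so is a Lipschitz constant in
  time for all logarithmic coordinates.\<close>

definition B :: real where "B = 1 + 5 * Lam * bigR"

definition lsol where "lsol = log_sol bigR"

lemma bigR_gt_2: "2 < bigR" and B_pos: "0 < B"
proof -
  show *: "2 < bigR" using pos by (simp add: bigR_def)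
  then have "0 < Lam * bigR" using Lam_gt_1 by auto
  then show "0 < B" by (simp add: B_def mult.assoc add_pos_pos)
qed

section \<open>Logarithmic solutions inside a box\<close>

lemma trunc_ex: "(\<And>i. ex y $ i \<le> bigR) \<Longrightarrow> trunc bigR y = ex y"
  by (simp add: trunc_def ex_def vec_eq_iff min_def)

lemma ex_nth [simp]: "ex y $ i = exp (y $ i)"
  by (simp add: ex_def)

lemma inbox_le:
  assumes "small h" "inbox h k x"
  shows "x $ i \<le> 3 / 2" "1 / 2 \<le> x $ k"
  using assms smallD[OF assms(1)] by (cases "i = k"; auto simp: inbox_def abs_le_iff)+

lemma inbox_trunc:
  assumes "small h" "inbox h k (ex y)"
  shows "trunc bigR y = ex y"
proof (rule trunc_ex)
  fix i
  show "ex y $ i \<le> bigR" using inbox_le(1)[OF assms, of i] bigR_gt_2 by linarith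
qed

lemma lsol_deriv:
  assumes "lsol y" "0 \<le> a" "t \<in> {a..b}"
  shows "((\<lambda>t. y t $ j) has_real_derivative rate (trunc bigR (y t)) j) (at t within {a..b})"
proof -
  have "((\<lambda>t. y t $ j) has_real_derivative rate (trunc bigR (y t)) j) (at t within {0..})"
    using assms by (simp add: lsol_def log_sol_def)
  then show ?thesis by (rule DERIV_subset) (use assms in auto)
qed

lemma lsol_continuous:
  assumes "lsol y" "0 \<le> a"
  shows "continuous_on {a..b} (\<lambda>t. y t $ j)"
  using lsol_deriv[OF assms] by (meson DERIV_continuous continuous_on_eq_continuous_within)

lemma abs_rate_trunc: "\<bar>rate (trunc bigR y) j\<bar> \<le> B"
  unfolding B_def using bigR_gt_2 by (intro abs_rate_box) (simp add: trunc_def)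

lemma lsol_lip:
  assumes "lsol y" "0 \<le> a" "a \<le> b"
  shows "\<bar>y b $ j - y a $ j\<bar> \<le> B * (b - a)"
proof -
  have lower: "0 \<le> B + rate (trunc bigR z) j" for z
    using abs_rate_trunc[of z j] by linarith
  have "B * a - y a $ j \<le> B * b - y b $ j"
    by (rule nonneg_deriv_within_imp_le[where u = "\<lambda>t. B * t - y t $ j"
          and u' = "\<lambda>t. B - rate (trunc bigR (y t)) j"])
      (use assms abs_rate_trunc[THEN abs_le_D1] in \<open>auto intro!: derivative_eq_intros lsol_deriv\<close>)
  moreover have "B * a + y a $ j \<le> B * b + y b $ j"
    by (rule nonneg_deriv_within_imp_le[where u = "\<lambda>t. B * t + y t $ j"
          and u' = "\<lambda>t. B + rate (trunc bigR (y t)) j"])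
      (use assms in \<open>auto intro!: derivative_eq_intros lsol_deriv simp: lower\<close>)
  ultimately show ?thesis by (simp add: abs_le_iff algebra_simps)
qed

text \<open>The coefficient of \<open>x $ k\<close> in the rate of \<open>Ef k l j\<close> vanishes; this is why it drifts only by a
  bounded amount while the trajectory stays near equilibrium k, however long that takes.\<close>

definition rho :: "5 \<Rightarrow> 5 \<Rightarrow> 5 \<Rightarrow> real" where
  "rho k l j = al (j - k) / al (l - k)"

definition Ef :: "5 \<Rightarrow> 5 \<Rightarrow> 5 \<Rightarrow> real ^ 5 \<Rightarrow> real" where
  "Ef k l j y = (y $ j - y $ k) - rho k l j * (y $ l - y $ k)"

text \<open>Bounds \<open>1 - rho k l j\<close> in modulus on the connections, as
  \<open>Lam / mu\<close> bounds the quotients of eigenvalues.\<close>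

definition G :: real where "G = 1 + Lam / mu"

definition Cbox :: real where "Cbox = 4 * Lam * G / mu"

lemma abs_rho: "l - k \<in> {1, 3} \<Longrightarrow> \<bar>rho k l j\<bar> \<le> G - 1"
proof -
  assume "l - k \<in> {1, 3}"
  then have "mu \<le> \<bar>al (l - k)\<bar>" using al_out by fastforce
  then have "\<bar>al (j - k)\<bar> / \<bar>al (l - k)\<bar> \<le> Lam / mu"
    using abs_al[of "j - k"] mu_pos by (intro frac_le) auto
  then show ?thesis by (simp add: rho_def G_def abs_divide)
qed

lemma G_gt_1: "1 < G" using Lam_gt_1 mu_pos by (simp add: G_def)

text \<open>The rate of \<open>Ef k l j\<close> is at most a multiple of the sum S of the small
  coordinates, so everything depends on the time integral of S. It is bounded independently of the
  residence time: weighting each small coordinate with the sign of its eigenvalue gives a bounded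
  function W with \<open>mu / 2 * S t \<le> W' t\<close>.\<close>

lemma Ef_drift_in_box:
  assumes y: "lsol y" and sm: "small h" and lk: "l - k \<in> {1, 3}" and "0 \<le> a" "a \<le> b"
    and bx: "\<And>t. t \<in> {a..b} \<Longrightarrow> inbox h k (ex (y t))"
  shows "\<bar>Ef k l j (y b) - Ef k l j (y a)\<bar> \<le> Cbox"
proof -
  define \<rho> where "\<rho> = rho k l j"
  define r where "r t i = rate (ex (y t)) i" for t i
  define S where "S t = (\<Sum>i\<in>UNIV - {k}. exp (y t $ i))" for t
  define W where "W t = (\<Sum>i\<in>UNIV - {k}. sgn (al (i - k)) * exp (y t $ i))" for t
  define W' where "W' t = (\<Sum>i\<in>UNIV - {k}. sgn (al (i - k)) * (exp (y t $ i) * r t i))" for t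
  define E' where "E' t = (r t j - r t k) - \<rho> * (r t l - r t k)" for t
  define C where "C = Cbox"
  have \<rho>: "\<bar>\<rho>\<bar> \<le> G - 1" unfolding \<rho>_def by (rule abs_rho[OF lk])
  have dy: "((\<lambda>t. y t $ i) has_real_derivative r t i) (at t within {a..b})" if "t \<in> {a..b}" for t i
    using lsol_deriv[OF y \<open>0 \<le> a\<close> that] inbox_trunc[OF sm bx[OF that]] by (simp add: r_def)
  have dE: "((\<lambda>t. Ef k l j (y t)) has_real_derivative E' t) (at t within {a..b})" if "t \<in> {a..b}" for t
    unfolding Ef_def E'_def \<rho>_def[symmetric] by (auto intro!: derivative_eq_intros dy that)
  have dW: "(W has_real_derivative W' t) (at t within {a..b})" if "t \<in> {a..b}" for t
    unfolding W_def W'_def by (auto intro!: derivative_eq_intros DERIV_sum dy that sum.cong)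
  have W': "mu / 2 * S t \<le> W' t" if "t \<in> {a..b}" for t
    unfolding S_def W'_def sum_distrib_left
  proof (rule sum_mono)
    fix i assume "i \<in> UNIV - {k}"
    then have ne: "i - k \<noteq> 0" by auto
    have "\<bar>r t i - al (i - k)\<bar> \<le> mu / 4"
      using inbox_rate(1)[OF sm bx[OF that], of i] by (simp add: r_def)
    then have "mu / 2 \<le> sgn (al (i - k)) * r t i"
      using al_nonneg_or[OF ne] mu_pos by (cases "0 < al (i - k)"; simp add: sgn_if; linarith)
    then have "exp (y t $ i) * (mu / 2) \<le> exp (y t $ i) * (sgn (al (i - k)) * r t i)"
      by (intro mult_left_mono) auto
    then show "mu / 2 * exp (y t $ i) \<le> sgn (al (i - k)) * (exp (y t $ i) * r t i)"
      by (simp add: mult_ac)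
  qed
  have E': "\<bar>E' t\<bar> \<le> C * W' t" if "t \<in> {a..b}" for t
  proof -
    define e where "e i = r t i - (1 + (al (i - k) - 1) * exp (y t $ k))" for i
    have e: "\<bar>e i\<bar> \<le> Lam * S t" for i
      using rate_split[of "ex (y t)" i k] by (simp add: e_def r_def S_def)
    have "al (l - k) \<noteq> 0" using al_out[OF lk] mu_pos by auto
    \<comment> \<open>The terms with \<open>exp (y t $ k)\<close> cancel since
      \<open>rho k l j * al (l - k) = al (j - k)\<close>; only the errors e of the rates
      survive.\<close>
    then have "E' t = (e j - e k) - \<rho> * (e l - e k)"
      unfolding E'_def e_def \<rho>_def rho_def by (simp add: al_simps field_simps)
    also have "\<bar>\<dots>\<bar> \<le> \<bar>e j - e k\<bar> + \<bar>\<rho>\<bar> * \<bar>e l - e k\<bar>"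
      by (metis abs_mult abs_triangle_ineq4)
    also have "\<dots> \<le> 2 * (Lam * S t) + (G - 1) * (2 * (Lam * S t))"
      using e[of j] e[of k] e[of l] \<rho> G_gt_1 by (intro add_mono mult_mono) auto
    also have "\<dots> = C * (mu / 2 * S t)"
      using mu_pos by (simp add: C_def Cbox_def field_simps)
    also have "\<dots> \<le> C * W' t"
      using W'[OF that] Lam_gt_1 G_gt_1 mu_pos by (intro mult_left_mono) (auto simp: C_def Cbox_def)
    finally show ?thesis .
  qed
  have bW: "\<bar>W t\<bar> \<le> 1 / 9" if "t \<in> {a..b}" for t
  proof -
    have "\<bar>W t\<bar> \<le> (\<Sum>i\<in>UNIV - {k}. \<bar>ex (y t) $ i\<bar>)"
      unfolding W_def by (rule order.trans[OF sum_abs], rule sum_mono) (simp add: abs_mult abs_sgn_eq)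
    also have "\<dots> \<le> 4 * h" by (rule inbox_sum[OF bx[OF that]])
    finally show ?thesis using smallD(4)[OF sm] by simp
  qed
  \<comment> \<open>Both \<open>C * W - Ef\<close> and \<open>C * W + Ef\<close> are non-decreasing,
    so the drift of \<open>Ef\<close> is at most C times the increase of W.\<close>
  have "C * W a - Ef k l j (y a) \<le> C * W b - Ef k l j (y b)"
  proof (rule nonneg_deriv_within_imp_le[where u = "\<lambda>t. C * W t - Ef k l j (y t)"
          and u' = "\<lambda>t. C * W' t - E' t"])
    fix t assume "t \<in> {a<..<b}"
    with E'[of t] show "0 \<le> C * W' t - E' t" by auto
  qed (use \<open>a \<le> b\<close> in \<open>auto intro!: derivative_eq_intros dW dE\<close>)
  moreover have "C * W a + Ef k l j (y a) \<le> C * W b + Ef k l j (y b)"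
  proof (rule nonneg_deriv_within_imp_le[where u = "\<lambda>t. C * W t + Ef k l j (y t)"
          and u' = "\<lambda>t. C * W' t + E' t"])
    fix t assume "t \<in> {a<..<b}"
    with E'[of t] show "0 \<le> C * W' t + E' t" by auto
  qed (use \<open>a \<le> b\<close> in \<open>auto intro!: derivative_eq_intros dW dE\<close>)
  moreover have "C * W b - C * W a \<le> C * 1"
    using bW[of a] bW[of b] \<open>a \<le> b\<close> Lam_gt_1 G_gt_1 mu_pos
    unfolding right_diff_distrib[symmetric] by (intro mult_left_mono) (auto simp: C_def Cbox_def)
  ultimately show ?thesis by (simp add: C_def abs_le_iff)
qed

lemma Ef_nth: "y $ j = Ef k l j y + (1 - rho k l j) * y $ k + rho k l j * y $ l"
  by (simp add: Ef_def algebra_simps)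

lemma inbox_log:
  assumes "small h" "inbox h k (ex y)"
  shows "\<bar>y $ k\<bar> \<le> 1" "j \<noteq> k \<Longrightarrow> y $ j \<le> ln h"
proof -
  note s = smallD[OF assms(1)]
  have "exp (y $ k) \<le> 3 / 2" "1 / 2 \<le> exp (y $ k)"
    using inbox_le[OF assms] by (auto simp del: )
  moreover have "3 / 2 \<le> exp (1::real)" using exp_ge_add_one_self[of 1] by simp
  moreover have "exp (- 1 :: real) \<le> 1 / 2"
    using exp_ge_add_one_self[of 1] by (simp add: exp_minus field_simps)
  ultimately have "exp (y $ k) \<le> exp 1" "exp (- 1) \<le> exp (y $ k)" by linarith+
  then show "\<bar>y $ k\<bar> \<le> 1" by (simp add: abs_le_iff)
  assume "j \<noteq> k"
  then have "exp (y $ j) \<le> h" using assms(2) by (simp add: inbox_def)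
  then show "y $ j \<le> ln h" using s(1) by (simp add: ln_ge_iff)
qed

text \<open>Coordinate l grows, so the box is left, and every other face is excluded: the radial
  ones by the logistic attraction, contracting coordinates because they decrease, and the other
  expanding coordinate because \<open>Ef\<close> ties it to \<open>y $ l\<close>. The hypothesis on
  \<open>Ef\<close> thus selects l among the two unstable directions.\<close>

lemma box_phase:
  assumes y: "lsol y" and sm: "small h" and lk: "l - k \<in> {1, 3}" and "0 \<le> t0"
    and start: "\<And>j. j \<noteq> k \<Longrightarrow> y t0 $ j < ln h" "\<bar>exp (y t0 $ k) - 1\<bar> < 5 * Lam * h"
    and E: "\<And>j. j \<notin> {k, l} \<Longrightarrow> Ef k l j (y t0) < ln h - Cbox - G"
  obtains s where "t0 \<le> s" "y s $ l = ln h" "\<And>t. t \<in> {t0..s} \<Longrightarrow> inbox h k (ex (y t))"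
proof -
  note s = smallD[OF sm]
  have kl: "l \<noteq> k" using lk by auto
  \<comment> \<open>The box is encoded by five constraint functions; the exit time is the first zero
    of their maximum g.\<close>
  define c where "c i t = (if i = k then \<bar>exp (y t $ k) - 1\<bar> - 5 * Lam * h else exp (y t $ i) - h)" for i t
  define g where "g t = max (c 0 t) (max (c 1 t) (max (c 2 t) (max (c 3 t) (c 4 t))))" for t
  have g_less: "g t < 0 \<longleftrightarrow> (\<forall>i. c i t < 0)" and g_le: "g t \<le> 0 \<longleftrightarrow> (\<forall>i. c i t \<le> 0)" for t
    unfolding g_def using exhaust_5 by (auto, metis+)
  have c_le: "(\<forall>i. c i t \<le> 0) \<longleftrightarrow> inbox h k (ex (y t))" for t
    unfolding c_def inbox_def by (auto split: if_splits)
  have contc: "continuous_on {t0..b} (c i)" for i b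
    unfolding c_def by (cases "i = k") (auto intro!: continuous_intros lsol_continuous[OF y \<open>0 \<le> t0\<close>])
  have contg: "continuous_on {t0..b} g" for b
    unfolding g_def by (intro continuous_on_max contc)
  have g0: "g t0 < 0"
    unfolding g_less
  proof
    fix i
    show "c i t0 < 0"
    proof (cases "i = k")
      case False
      then have "exp (y t0 $ i) < exp (ln h)" using start(1) by simp
      with False show ?thesis using s(1) by (simp add: c_def)
    qed (use start(2) in \<open>simp add: c_def\<close>)
  qed
  have drate: "((\<lambda>t. y t $ i) has_real_derivative rate (ex (y t)) i) (at t within {t0..b})"
    if "t \<in> {t0..b}" "inbox h k (ex (y t))" for t i b
    using lsol_deriv[OF y \<open>0 \<le> t0\<close> that(1)] inbox_trunc[OF sm that(2)] by simp
  \<comment> \<open>At speed \<open>mu / 2\<close> coordinate l passes \<open>ln h\<close> before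
    this time; the cap \<open>ln h + 1\<close> in the barrier below is merely some level beyond
    \<open>ln h\<close>.\<close>
  define T where "T = t0 + (ln h - y t0 $ l) * (2 / mu) + 1"
  have "t0 \<le> T" unfolding T_def using start(1)[OF kl] mu_pos by (simp add: add_nonneg_nonneg)
  have "\<exists>b\<in>{t0..T}. 0 \<le> g b"
  proof (rule ccontr)
    assume "\<not> ?thesis"
    then have "g t \<le> 0" if "t \<in> {t0..T}" for t
      using that by (meson linear)
    then have bx: "inbox h k (ex (y t))" if "t \<in> {t0..T}" for t
      using that unfolding c_le[symmetric] g_le[symmetric] by blast
    have "min (ln h + 1) (y t0 $ l + mu / 2 * (T - t0)) \<le> y T $ l"
    proof (rule growth_barrier[OF \<open>t0 \<le> T\<close> drate])
      fix t assume "t \<in> {t0..T}"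
      from inbox_rate(1)[OF sm bx[OF this], of l] al_out[OF lk] mu_pos
      show "mu / 2 \<le> rate (ex (y t)) l" by linarith
    qed (use bx mu_pos in auto)
    moreover have "ln h < y t0 $ l + mu / 2 * (T - t0)"
      using mu_pos by (simp add: T_def field_simps)
    moreover have "y T $ l \<le> ln h"
      using inbox_log(2)[OF sm bx kl] \<open>t0 \<le> T\<close> by auto
    ultimately show False by auto
  qed
  then obtain b where b: "t0 \<le> b" "0 \<le> g b" by auto
  obtain s where s': "t0 < s" "g s = 0" "\<And>t. t0 \<le> t \<Longrightarrow> t < s \<Longrightarrow> g t < 0"
    using first_hit[OF b(1) contg g0 b(2)] by metis
  have bx: "inbox h k (ex (y t))" if "t \<in> {t0..s}" for t
    using s'(2) s'(3)[of t] that by (cases "t = s") (auto simp flip: c_le g_le intro: less_imp_le)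
  have sb: "inbox h k (ex (y s))" using bx s'(1) by auto
  have kin: "\<bar>exp (y s $ k) - 1\<bar> < 5 * Lam * h"
  proof -
    have Lh: "0 < Lam * h" using Lam_gt_1 s(1) by auto
    have b1: "y t0 $ k < ln (1 + 5 * Lam * h)" "ln (1 - 5 * Lam * h) < y t0 $ k"
    proof -
      have "exp (y t0 $ k) < 1 + 5 * Lam * h" "1 - 5 * Lam * h < exp (y t0 $ k)"
        using start(2) by linarith+
      moreover have "0 < 1 - 5 * Lam * h" using s by linarith
      ultimately show "y t0 $ k < ln (1 + 5 * Lam * h)" "ln (1 - 5 * Lam * h) < y t0 $ k"
        by (metis exp_gt_zero ln_exp ln_less_cancel_iff order_less_trans)+
    qed
    have "y s $ k \<le> max (ln (1 + 4 * Lam * h)) (y t0 $ k - 0 * (s - t0))"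
    proof (rule decay_barrier[OF _ drate])
      fix t assume t: "t \<in> {t0..s}" "ln (1 + 4 * Lam * h) \<le> y t $ k"
      moreover have "0 < 1 + 4 * Lam * h" using Lh by (simp add: mult.assoc add_pos_pos)
      ultimately have "1 + 4 * Lam * h \<le> exp (y t $ k)" by (metis exp_le_cancel_iff exp_ln)
      moreover have "\<bar>rate (ex (y t)) k - (1 - exp (y t $ k))\<bar> \<le> 4 * Lam * h"
        using inbox_rate(2)[OF sm bx[OF t(1)]] by simp
      ultimately show "rate (ex (y t)) k \<le> - 0" by linarith
    qed (use bx s' in auto)
    have 1: "y s $ k < ln (1 + 5 * Lam * h)"
    proof -
      have "ln (1 + 4 * Lam * h) < ln (1 + 5 * Lam * h)"
        using Lh by (subst ln_less_cancel_iff) linarith+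
      then show ?thesis using b1(1) \<open>y s $ k \<le> _\<close> by linarith
    qed
    have "min (ln (1 - 4 * Lam * h)) (y t0 $ k + 0 * (s - t0)) \<le> y s $ k"
    proof (rule growth_barrier[OF _ drate])
      fix t assume t: "t \<in> {t0..s}" "y t $ k \<le> ln (1 - 4 * Lam * h)"
      moreover have "0 < 1 - 4 * Lam * h" using Lh s by linarith
      ultimately have "exp (y t $ k) \<le> 1 - 4 * Lam * h" by (metis exp_le_cancel_iff exp_ln)
      moreover have "\<bar>rate (ex (y t)) k - (1 - exp (y t $ k))\<bar> \<le> 4 * Lam * h"
        using inbox_rate(2)[OF sm bx[OF t(1)]] by simp
      ultimately show "0 \<le> rate (ex (y t)) k" by linarith
    qed (use bx s' in auto)
    have 2: "ln (1 - 5 * Lam * h) < y s $ k"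
    proof -
      have "ln (1 - 5 * Lam * h) < ln (1 - 4 * Lam * h)"
        using Lh s by (subst ln_less_cancel_iff) linarith+
      then show ?thesis using b1(2) \<open>_ \<le> y s $ k\<close> by linarith
    qed
    have "exp (y s $ k) < 1 + 5 * Lam * h" 
    proof -
      have "0 < 1 + 5 * Lam * h" using Lh by (simp add: mult.assoc add_pos_pos)
      then show ?thesis using 1 by (metis exp_less_cancel_iff exp_ln)
    qed
    moreover have "1 - 5 * Lam * h < exp (y s $ k)"
    proof -
      have "0 < 1 - 5 * Lam * h" using s by linarith
      then show ?thesis using 2 by (metis exp_less_cancel_iff exp_ln)
    qed
    ultimately show ?thesis by linarith
  qed
  \<comment> \<open>For an expanding j the coefficient \<open>rho k l j\<close> is positive and
    \<open>y s $ l\<close> is at most 0, so \<open>y s $ j\<close> is at most the initial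
    \<open>Ef\<close> plus the drift \<open>Cbox\<close> plus \<open>G\<close> for the radial term.
    This is the margin in the hypothesis.\<close>
  have jin: "y s $ j < ln h" if j: "j \<noteq> k" "j \<noteq> l" for j
  proof (cases "0 < al (j - k)")
    case True
    have r: "0 < rho k l j"
      unfolding rho_def using True al_out[OF lk] mu_pos by auto
    have "\<bar>Ef k l j (y s) - Ef k l j (y t0)\<bar> \<le> Cbox"
      by (rule Ef_drift_in_box[OF y sm lk \<open>0 \<le> t0\<close>]) (use s' bx in auto)
    moreover have "\<bar>(1 - rho k l j) * y s $ k\<bar> \<le> G * 1"
      unfolding abs_mult
    proof (rule mult_mono)
      show "\<bar>1 - rho k l j\<bar> \<le> G" using abs_rho[OF lk, of j] by linarith
    qed (use inbox_log(1)[OF sm sb] G_gt_1 in auto)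
    moreover have "rho k l j * y s $ l \<le> 0"
    proof (rule mult_nonneg_nonpos)
      have "ln h \<le> 0" using s by simp
      then show "y s $ l \<le> 0" using inbox_log(2)[OF sm sb kl] by linarith
    qed (use r in auto)
    ultimately show ?thesis
      using E[of j] j Ef_nth[of "y s" j k l] by (simp; linarith)
  next
    case False
    then have neg: "al (j - k) \<le> - mu" using al_nonneg_or[of "j - k"] j mu_pos by auto
    have "y s $ j \<le> max (y t0 $ j) (y t0 $ j - 0 * (s - t0))"
    proof (rule decay_barrier[OF _ drate])
      fix t assume t: "t \<in> {t0..s}"
      from inbox_rate(1)[OF sm bx[OF t], of j] neg mu_pos
      show "rate (ex (y t)) j \<le> - 0" by linarith
    qed (use bx s' in auto)
    with start(1)[OF j(1)] show ?thesis by simp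
  qed
  have "\<not> g s < 0" using s' by simp
  then obtain i where i: "0 \<le> c i s" unfolding g_less by (auto simp: not_less)
  have "i \<noteq> k" using i kin by (auto simp: c_def)
  moreover have "i = l"
  proof (rule ccontr)
    assume "i \<noteq> l"
    with jin[of i] \<open>i \<noteq> k\<close> have "exp (y s $ i) < h" using s(1) by (metis exp_less_cancel_iff exp_ln)
    with i \<open>i \<noteq> k\<close> show False by (simp add: c_def)
  qed
  ultimately have "h \<le> exp (y s $ l)" using i by (simp add: c_def)
  moreover have "exp (y s $ l) \<le> h" using sb kl by (simp add: inbox_def)
  ultimately have "y s $ l = ln h" by (metis antisym ln_exp)
  with that[of s] s' bx show thesis by auto
qed

end

section \<open>Transition to the next equilibrium\<close>

lemma ln_le_iff_exp: "0 < a \<Longrightarrow> ln a \<le> x \<longleftrightarrow> a \<le> exp x" for a x :: real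
  by (metis exp_le_cancel_iff exp_ln)

context lotka_volterra
begin

text \<open>A lower bound for the sum of departing and arriving coordinates on a transition: up to
  this level the crowding term in the rates is at most 1/2.\<close>

definition kap :: real where "kap = 1 / (2 * Lam)"

text \<open>Tolerance for the three remaining coordinates on a transition. The terms keep them
  inside the next box, make the error of a rate at most 1/4, and make the error of a difference of
  rates at most half of its lower bound \<open>mu * kap\<close>.\<close>

definition eps :: "real \<Rightarrow> real" where
  "eps h = min (h / 6) (min (1 / (12 * Lam)) (mu * kap / (12 * Lam)))"

text \<open>In this time \<open>y $ l - y $ k\<close>, growing at speed at least
  \<open>mu * kap / 2\<close>, gets from \<open>ln h - ln (3 / 2)\<close> to
  \<open>ln bigR - ln (h / 2)\<close>; then coordinate k is at most \<open>h / 2\<close>.\<close>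

definition T1 :: "real \<Rightarrow> real" where
  "T1 h = 2 / (mu * kap) * (ln bigR - ln h + ln (3 / 2) - ln (h / 2))"

text \<open>In this time the arriving coordinate, lying between \<open>kap / 2\<close> and
  \<open>bigR\<close>, is attracted to within \<open>2 * Lam * h\<close> of 1 at logarithmic speed
  at least \<open>Lam * h\<close>.\<close>

definition T2 :: "real \<Rightarrow> real" where
  "T2 h = (ln bigR + \<bar>ln (kap / 2)\<bar> + 1) / (Lam * h)"

definition T0 :: "real \<Rightarrow> real" where "T0 h = T1 h + T2 h"

text \<open>Size at the exit of the box that guarantees \<open>eps h\<close> for a further time
  \<open>T0 h\<close>, as logarithms grow at speed at most \<open>B\<close>.\<close>

definition eps0 :: "real \<Rightarrow> real" where "eps0 h = eps h * exp (- B * T0 h)"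

lemma kap_pos: "0 < kap" "kap \<le> 1 / 2"
  using Lam_gt_1 by (auto simp: kap_def field_simps)

lemma eps_bounds:
  assumes "small h"
  shows "0 < eps h" "eps h \<le> h / 6" "12 * Lam * eps h \<le> 1" "12 * Lam * eps h \<le> mu * kap"
proof -
  have L: "0 < Lam" using Lam_gt_1 by simp
  show "0 < eps h" using smallD(1)[OF assms] L mu_pos kap_pos by (simp add: eps_def)
  show "eps h \<le> h / 6" by (simp add: eps_def)
  have "eps h \<le> 1 / (12 * Lam)" "eps h \<le> mu * kap / (12 * Lam)" by (simp_all add: eps_def)
  then show "12 * Lam * eps h \<le> 1" "12 * Lam * eps h \<le> mu * kap"
    using L by (simp_all add: field_simps)
qed

lemma T_pos:
  assumes "small h"
  shows "0 \<le> T1 h" "0 < T2 h" "0 < T0 h"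
proof -
  note s = smallD[OF assms]
  have "ln h \<le> 0" "ln (h / 2) \<le> 0" using s by (simp_all add: ln_le_zero_iff)
  moreover have "0 < ln bigR" and ln32: "0 < ln (3 / 2 :: real)" using bigR_gt_2 by simp_all
  ultimately have "0 \<le> ln bigR - ln h + ln (3 / 2) - ln (h / 2)" by linarith
  then show 1: "0 \<le> T1 h"
    unfolding T1_def using mu_pos kap_pos by (intro mult_nonneg_nonneg) auto
  show 2: "0 < T2 h" unfolding T2_def using \<open>0 < ln bigR\<close> s Lam_gt_1
    by (intro divide_pos_pos) auto
  from 1 2 show "0 < T0 h" by (simp add: T0_def)
qed

lemma eps0_bounds:
  assumes "small h"
  shows "0 < eps0 h" "eps0 h < h"
proof -
  show "0 < eps0 h" using eps_bounds(1)[OF assms] by (simp add: eps0_def)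
  have "eps0 h \<le> eps h * 1"
    unfolding eps0_def using eps_bounds(1)[OF assms] B_pos T_pos(3)[OF assms]
    by (intro mult_left_mono) auto
  with eps_bounds(2)[OF assms] smallD(1)[OF assms] show "eps0 h < h" by simp
qed

text \<open>With three coordinates negligible this is a perturbed planar system, treated without
  constructing the connecting orbit: the sum of the two coordinates stays above \<open>kap\<close>,
  so the logarithm of their quotient grows at a definite speed, and then l obeys a perturbed
  logistic equation. The duration \<open>T0 h\<close> is fixed and not a hitting time, so all
  changes are at most \<open>B * T0 h\<close>.\<close>

lemma transit:
  assumes y: "lsol y" and sm: "small h" and lk: "l - k \<in> {1, 3}" and "0 \<le> s"
    and ls: "y s $ l = ln h" and ks: "\<bar>exp (y s $ k) - 1\<bar> \<le> 1 / 2"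
    and js: "\<And>j. j \<notin> {k, l} \<Longrightarrow> y s $ j \<le> ln (eps0 h)"
  shows "\<And>t i. t \<in> {s..s + T0 h} \<Longrightarrow> exp (y t $ i) \<le> bigR"
    and "\<And>t j. t \<in> {s..s + T0 h} \<Longrightarrow> j \<notin> {k, l} \<Longrightarrow> exp (y t $ j) \<le> h / 6"
    and "\<And>t. t \<in> {s..s + T0 h} \<Longrightarrow> rate (ex (y t)) k < rate (ex (y t)) l"
    and "\<bar>exp (y (s + T0 h) $ l) - 1\<bar> \<le> 2 * Lam * h"
    and "exp (y (s + T0 h) $ k) \<le> h / 2"
proof -
  note s = smallD[OF sm] and T = T_pos[OF sm] and ep = eps_bounds[OF sm]
  have kl: "k \<noteq> l" using lk by auto
  define e where "e = al (l - k)"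
  define c where "c = - al (k - l)"
  have ec: "mu \<le> e" "mu \<le> c" using al_out[OF lk] by (auto simp: e_def c_def)
  have cL: "1 + c \<le> Lam" using abs_al[of "k - l"] by (simp add: c_def)
  have eR: "2 + 2 * e \<le> bigR"
    using lk pos by (auto simp: e_def al_simps bigR_def)
  define p q where "p t = exp (y t $ k)" and "q t = exp (y t $ l)" for t
  have pq: "0 < p t" "0 < q t" for t by (auto simp: p_def q_def)
  let ?I = "{s..s + T0 h}"
  have sml: "exp (y t $ j) \<le> eps h" if "t \<in> ?I" "j \<notin> {k, l}" for t j
  proof -
    have "\<bar>y t $ j - y s $ j\<bar> \<le> B * (t - s)"
      using that \<open>0 \<le> s\<close> by (intro lsol_lip[OF y]) auto
    moreover have "B * (t - s) \<le> B * T0 h" using that B_pos by (intro mult_left_mono) auto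
    moreover have "ln (eps0 h) = ln (eps h) - B * T0 h"
      unfolding eps0_def using ep(1) by (simp add: ln_mult)
    ultimately have "y t $ j \<le> ln (eps h)" using js[OF that(2)] by linarith
    then show ?thesis using ep(1) by (metis exp_le_cancel_iff exp_ln)
  qed
  have err: "Lam * (\<Sum>i\<in>UNIV - {k, l}. \<bar>x $ i\<bar>) \<le> 3 * Lam * eps h"
    if "\<And>i. i \<notin> {k, l} \<Longrightarrow> \<bar>x $ i\<bar> \<le> eps h" for x :: "real ^ 5"
  proof -
    have "(\<Sum>i\<in>UNIV - {k, l}. \<bar>x $ i\<bar>) \<le> of_nat (card (UNIV - {k, l})) * eps h"
      by (rule sum_bounded_above) (use that in auto)
    also have "card (UNIV - {k, l}) = 3" using kl by (simp add: card_Diff_subset)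
    finally have "Lam * (\<Sum>i\<in>UNIV - {k, l}. \<bar>x $ i\<bar>) \<le> Lam * (of_nat 3 * eps h)"
      using Lam_gt_1 by (intro mult_left_mono) auto
    then show ?thesis by (simp add: mult_ac)
  qed
  \<comment> \<open>The bounds on p and q are not known yet, so the rates are first written with
    truncated values; \<open>Pp\<close> and \<open>Qq\<close> remove the truncation.\<close>
  define P Q where "P t = min (p t) bigR" and "Q t = min (q t) bigR" for t
  have PQ: "0 < P t" "0 < Q t" for t using pq bigR_gt_2 by (auto simp: P_def Q_def)
  have tr: "\<bar>rate (trunc bigR (y t)) j - (1 + (al (j - k) - 1) * P t + (al (j - l) - 1) * Q t)\<bar>
      \<le> 3 * Lam * eps h" if "t \<in> ?I" for t j
  proof -
    have "\<bar>trunc bigR (y t) $ i\<bar> \<le> eps h" if "i \<notin> {k, l}" for i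
      using sml[OF \<open>t \<in> ?I\<close> that] bigR_gt_2 by (simp add: trunc_def)
    then have "Lam * (\<Sum>i\<in>UNIV - {k, l}. \<bar>trunc bigR (y t) $ i\<bar>) \<le> 3 * Lam * eps h" by (rule err)
    with rate_split2[OF kl, of "trunc bigR (y t)" j] show ?thesis
      by (simp add: trunc_def P_def Q_def p_def q_def)
  qed
  have rk: "rate (trunc bigR (y t)) k \<le> 1 - P t - (1 + c) * Q t + 1 / 4"
      "rate (trunc bigR (y t)) k \<ge> 1 - P t - (1 + c) * Q t - 1 / 4"
      "rate (trunc bigR (y t)) l \<le> 1 - Q t + (e - 1) * P t + 1 / 4"
      "rate (trunc bigR (y t)) l \<ge> 1 - Q t + (e - 1) * P t - 1 / 4"
      "rate (trunc bigR (y t)) l - rate (trunc bigR (y t)) k \<ge> e * P t + c * Q t - 6 * Lam * eps h"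
    if "t \<in> ?I" for t
  proof -
    have ee: "12 * (Lam * eps h) \<le> 1" using ep(3) by (simp add: mult.assoc)
    have 1: "\<bar>rate (trunc bigR (y t)) k - (1 - P t - (1 + c) * Q t)\<bar> \<le> 3 * (Lam * eps h)"
      using tr[OF that, of k] by (simp add: c_def al_simps algebra_simps)
    have 2: "\<bar>rate (trunc bigR (y t)) l - (1 - Q t + (e - 1) * P t)\<bar> \<le> 3 * (Lam * eps h)"
      using tr[OF that, of l] by (simp add: e_def al_simps algebra_simps)
    show "rate (trunc bigR (y t)) k \<le> 1 - P t - (1 + c) * Q t + 1 / 4"
      "rate (trunc bigR (y t)) k \<ge> 1 - P t - (1 + c) * Q t - 1 / 4"
      "rate (trunc bigR (y t)) l \<le> 1 - Q t + (e - 1) * P t + 1 / 4"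
      "rate (trunc bigR (y t)) l \<ge> 1 - Q t + (e - 1) * P t - 1 / 4"
      using 1 2 ee by linarith+
    have "e * P t + c * Q t = (1 - Q t + (e - 1) * P t) - (1 - P t - (1 + c) * Q t)"
      by (simp add: algebra_simps)
    with 1 2 show "rate (trunc bigR (y t)) l - rate (trunc bigR (y t)) k
        \<ge> e * P t + c * Q t - 6 * Lam * eps h"
      unfolding mult.assoc[of 6] by linarith
  qed
  have der: "((\<lambda>t. y t $ i) has_real_derivative rate (trunc bigR (y t)) i) (at t within {a..b})"
    if "s \<le> a" "t \<in> {a..b}" for a b t i
    using that \<open>0 \<le> s\<close> by (intro lsol_deriv[OF y]) auto
  have sub: "u \<in> ?I" if "u \<in> {a..t}" "s \<le> a" "t \<in> ?I" for u a t using that by auto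
  have cQ: "0 \<le> (1 + c) * Q t" for t
    using ec mu_pos PQ(2)[of t] by simp
  have p_le: "p t \<le> 3 / 2" if t: "t \<in> ?I" for t
  proof -
    have "y t $ k \<le> max (ln (3 / 2)) (ln (3 / 2) - 0 * (t - s))"
    proof (rule decay_barrier[OF _ der])
      fix u assume u: "u \<in> {s..t}" "ln (3 / 2) \<le> y u $ k"
      then have "3 / 2 \<le> p u" unfolding p_def by (subst (asm) ln_le_iff_exp) auto
      then have "3 / 2 \<le> P u" using bigR_gt_2 by (simp add: P_def)
      with rk(1)[OF sub[OF u(1) _ t]] cQ[of u] show "rate (trunc bigR (y u)) k \<le> - 0" by simp
    next
      have "exp (y s $ k) \<le> 3 / 2" using ks by linarith
      then show "y s $ k \<le> ln (3 / 2)" by (simp add: ln_ge_iff)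
    qed (use t in auto)
    then show ?thesis by (simp add: p_def ln_ge_iff)
  qed
  have Pp: "P t = p t" if "t \<in> ?I" for t
    using p_le[OF that] bigR_gt_2 by (simp add: P_def)
  have q_le: "q t \<le> bigR" if t: "t \<in> ?I" for t
  proof -
    have "y t $ l \<le> max (ln bigR) (ln bigR - 0 * (t - s))"
    proof (rule decay_barrier[OF _ der])
      fix u assume u: "u \<in> {s..t}" "ln bigR \<le> y u $ l"
      then have "bigR \<le> q u" unfolding q_def using bigR_gt_2 by (subst (asm) ln_le_iff_exp) auto
      then have Q: "Q u = bigR" by (simp add: Q_def)
      have uI: "u \<in> ?I" by (rule sub[OF u(1) _ t]) simp
      have "e * P u \<le> e * (3 / 2)"
        using p_le[OF uI] Pp[OF uI] ec mu_pos by (intro mult_left_mono) auto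
      then have "(e - 1) * P u \<le> e * (3 / 2)"
        using PQ(1)[of u] by (simp add: left_diff_distrib)
      with rk(3)[OF uI] Q eR ec mu_pos show "rate (trunc bigR (y u)) l \<le> - 0" by linarith
    next
      show "y s $ l \<le> ln bigR" unfolding ls using s bigR_gt_2 by (subst ln_le_cancel_iff) auto
    qed (use t in auto)
    then show ?thesis using bigR_gt_2 by (simp add: q_def ln_ge_iff)
  qed
  have Qq: "Q t = q t" if "t \<in> ?I" for t
    using q_le[OF that] by (simp add: Q_def)
  show bd: "exp (y t $ i) \<le> bigR" if "t \<in> ?I" for t i
    using p_le[OF that] q_le[OF that] sml[OF that, of i] ep(2) s(4) bigR_gt_2
    by (cases "i = k"; cases "i = l") (auto simp: p_def q_def)
  then have tre: "trunc bigR (y t) = ex (y t)" if "t \<in> ?I" for t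
    using that by (intro trunc_ex) auto
  show "exp (y t $ j) \<le> h / 6" if "t \<in> ?I" "j \<notin> {k, l}" for t j
    using sml[OF that] ep(2) by linarith
  define S where "S t = p t + q t" for t
  have S_ge: "kap \<le> S t" if t: "t \<in> ?I" for t
  proof -
    define S' where "S' t = p t * rate (trunc bigR (y t)) k + q t * rate (trunc bigR (y t)) l" for t
    have "min kap (kap + 0 * (t - s)) \<le> S t"
    proof (rule growth_barrier[where u' = S'])
      fix u assume u: "u \<in> {s..t}"
      show "(S has_real_derivative S' u) (at u within {s..t})"
        unfolding S_def S'_def p_def q_def by (auto intro!: derivative_eq_intros der u)
      assume Su: "S u \<le> kap"
      have uI: "u \<in> ?I" by (rule sub[OF u(1) _ t]) simp
      have "p u * (1 - p u - (1 + c) * q u - 1 / 4) \<le> p u * rate (trunc bigR (y u)) k"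
        using rk(2)[OF uI] pq[of u] Pp[OF uI] Qq[OF uI] by (intro mult_left_mono) auto
      moreover have "q u * (1 - q u + (e - 1) * p u - 1 / 4) \<le> q u * rate (trunc bigR (y u)) l"
        using rk(4)[OF uI] pq[of u] Pp[OF uI] Qq[OF uI] by (intro mult_left_mono) auto
      \<comment> \<open>A logistic term with the coefficient \<open>1 + c\<close> is split off; the
        remainder consists of squares and products with nonnegative coefficients.\<close>
      moreover have "p u * (1 - p u - (1 + c) * q u - 1 / 4) + q u * (1 - q u + (e - 1) * p u - 1 / 4)
          = S u * (3 / 4 - (1 + c) * S u) + c * ((p u)\<^sup>2 + (q u)\<^sup>2) + (c + e) * (p u * q u)"
        by (simp add: S_def algebra_simps power2_eq_square)
      moreover have "0 \<le> S u * (3 / 4 - (1 + c) * S u)"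
      proof (rule mult_nonneg_nonneg)
        show "0 \<le> S u" using pq[of u] by (simp add: S_def)
        then have "(1 + c) * S u \<le> Lam * kap"
          using cL Su Lam_gt_1 by (intro mult_mono) auto
        also have "\<dots> = 1 / 2" using Lam_gt_1 by (simp add: kap_def)
        finally show "0 \<le> 3 / 4 - (1 + c) * S u" by simp
      qed
      moreover have "0 \<le> c * ((p u)\<^sup>2 + (q u)\<^sup>2)" "0 \<le> (c + e) * (p u * q u)"
        using ec mu_pos pq[of u] by auto
      ultimately show "0 \<le> S' u" unfolding S'_def by linarith
    next
      have "1 / 2 \<le> p s" using ks unfolding p_def by linarith
      then show "kap \<le> S s" using kap_pos pq(2)[of s] by (simp add: S_def)
    qed (use t in auto)
    then show ?thesis by simp
  qed
  \<comment> \<open>The difference of the rates is close to \<open>e * p t + c * q t\<close> with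
    both coefficients positive, so the transition never reverses.\<close>
  have gap: "mu * kap / 2 \<le> rate (trunc bigR (y t)) l - rate (trunc bigR (y t)) k"
    if t: "t \<in> ?I" for t
  proof -
    have "mu * kap \<le> mu * S t" using S_ge[OF t] mu_pos by (intro mult_left_mono) auto
    also have "\<dots> = mu * p t + mu * q t" by (simp add: S_def algebra_simps)
    also have "\<dots> \<le> e * p t + c * q t"
      using ec pq[of t] by (intro add_mono mult_right_mono) auto
    finally have "mu * kap \<le> e * P t + c * Q t" using Pp[OF t] Qq[OF t] by simp
    with rk(5)[OF t] ep(4) show ?thesis by linarith
  qed
  have mk: "0 < mu * kap" using mu_pos kap_pos by simp
  show "rate (ex (y t)) k < rate (ex (y t)) l" if "t \<in> ?I" for t
    using gap[OF that] mk unfolding tre[OF that] by linarith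
  have ln32: "y s $ k \<le> ln (3 / 2)"
    using p_le[of s] T by (simp add: p_def ln_ge_iff)
  have p_small: "p t \<le> h / 2" if t: "t \<in> ?I" "s + T1 h \<le> t" for t
  proof -
    have "s \<le> t" using t by auto
    have "y s $ l - y s $ k - mu * kap / 2 * s \<le> y t $ l - y t $ k - mu * kap / 2 * t"
    proof (rule nonneg_deriv_within_imp_le[OF \<open>s \<le> t\<close>,
          where u = "\<lambda>t. y t $ l - y t $ k - mu * kap / 2 * t"
          and u' = "\<lambda>t. rate (trunc bigR (y t)) l - rate (trunc bigR (y t)) k - mu * kap / 2"])
      fix u assume u: "u \<in> {s..t}"
      show "((\<lambda>t. y t $ l - y t $ k - mu * kap / 2 * t) has_real_derivative
          rate (trunc bigR (y u)) l - rate (trunc bigR (y u)) k - mu * kap / 2) (at u within {s..t})"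
        by (auto intro!: derivative_eq_intros der u)
    next
      fix u assume "u \<in> {s<..<t}"
      then have "u \<in> ?I" using t by auto
      from gap[OF this] show "0 \<le> rate (trunc bigR (y u)) l - rate (trunc bigR (y u)) k - mu * kap / 2"
        by simp
    qed
    moreover have "mu * kap / 2 * T1 h \<le> mu * kap / 2 * (t - s)"
      using t mk by (intro mult_left_mono) auto
    moreover have "mu * kap / 2 * T1 h = ln bigR - ln h + ln (3 / 2) - ln (h / 2)"
      using mu_pos kap_pos by (simp add: T1_def)
    moreover have "y t $ l \<le> ln bigR"
      using q_le[OF t(1)] bigR_gt_2 by (simp add: q_def ln_ge_iff)
    ultimately have "y t $ k \<le> ln (h / 2)"
      using ls ln32 unfolding right_diff_distrib by linarith
    then show ?thesis using s by (simp add: p_def ln_ge_iff)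
  qed
  have end_I: "s + T0 h \<in> ?I" "s + T1 h \<le> s + T0 h" using T by (auto simp: T0_def)
  show "exp (y (s + T0 h) $ k) \<le> h / 2" using p_small[OF end_I] by (simp add: p_def)
  define a where "a = s + T1 h"
  define b where "b = s + T0 h"
  have ab: "s \<le> a" "a \<le> b" using T by (auto simp: a_def b_def T0_def)
  have Lh: "0 < Lam * h" "36 * (Lam * h) \<le> 1" using s Lam_gt_1 by (simp_all add: mult.assoc)
  have rl: "\<bar>rate (trunc bigR (y t)) l - (1 - q t)\<bar> \<le> Lam * h" if "t \<in> {a..b}" for t
  proof -
    have tI: "t \<in> ?I" "s + T1 h \<le> t" using that ab by (auto simp: a_def b_def)
    have "\<bar>(al (l - k) - 1) * p t\<bar> \<le> Lam * (h / 2)"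
      unfolding abs_mult using p_small[OF tI] pq[of t] Lam_gt_1
      by (intro mult_mono abs_al_minus) auto
    moreover have "3 * (Lam * eps h) \<le> Lam * (h / 2)"
      using ep(2) mult_left_mono[OF ep(2), of "3 * Lam"] Lam_gt_1 by (simp add: mult_ac)
    moreover have "\<bar>rate (trunc bigR (y t)) l - (1 - q t + (al (l - k) - 1) * p t)\<bar> \<le> 3 * (Lam * eps h)"
      using tr[OF tI(1), of l] Pp[OF tI(1)] Qq[OF tI(1)] by (simp add: al_simps algebra_simps)
    ultimately show ?thesis by linarith
  qed
  have T2: "Lam * h * (b - a) = ln bigR + \<bar>ln (kap / 2)\<bar> + 1"
  proof -
    have "b - a = T2 h" by (simp add: a_def b_def T0_def)
    then show ?thesis using s(1) Lam_gt_1 by (simp add: T2_def)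
  qed
  have qb: "ln (1 - 2 * Lam * h) \<le> y b $ l" "y b $ l \<le> ln (1 + 2 * Lam * h)"
  proof -
    have aI: "a \<in> ?I" using ab by (auto simp: a_def b_def)
    have "y b $ l \<le> max (ln (1 + 2 * Lam * h)) (ln bigR - Lam * h * (b - a))"
    proof (rule decay_barrier[OF ab(2) der[OF ab(1)]])
      fix t assume t: "t \<in> {a..b}" "ln (1 + 2 * Lam * h) \<le> y t $ l"
      have "0 < 1 + 2 * Lam * h" using Lh by linarith
      with t(2) have "1 + 2 * Lam * h \<le> q t" unfolding q_def by (metis exp_le_cancel_iff exp_ln)
      with rl[OF t(1)] show "rate (trunc bigR (y t)) l \<le> - (Lam * h)" by linarith
    next
      show "y a $ l \<le> ln bigR"
        using q_le[OF aI] bigR_gt_2 by (simp add: q_def ln_ge_iff)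
    qed (use Lh in auto)
    moreover have "0 \<le> ln (1 + 2 * Lam * h)" using Lh by (simp add: mult.assoc)
    ultimately show "y b $ l \<le> ln (1 + 2 * Lam * h)" unfolding T2 by linarith
    have "min (ln (1 - 2 * Lam * h)) (ln (kap / 2) + Lam * h * (b - a)) \<le> y b $ l"
    proof (rule growth_barrier[OF ab(2) der[OF ab(1)]])
      fix t assume t: "t \<in> {a..b}" "y t $ l \<le> ln (1 - 2 * Lam * h)"
      have "0 < 1 - 2 * Lam * h" using Lh by linarith
      with t(2) have "q t \<le> 1 - 2 * Lam * h" unfolding q_def by (metis exp_le_cancel_iff exp_ln)
      with rl[OF t(1)] show "Lam * h \<le> rate (trunc bigR (y t)) l" by linarith
    next
      have "kap \<le> p a + q a" using S_ge[OF aI] by (simp add: S_def)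
      moreover have "p a \<le> h / 2" by (rule p_small[OF aI]) (simp add: a_def)
      moreover have "h \<le> kap"
        using s(3) Lam_gt_1 by (simp add: kap_def field_simps)
      ultimately have "kap / 2 \<le> q a" by linarith
      then have "ln (kap / 2) \<le> ln (q a)" using kap_pos by (subst ln_le_cancel_iff) (auto simp: pq)
      then show "ln (kap / 2) \<le> y a $ l" by (simp add: q_def)
    qed (use Lh in auto)
    moreover have "ln (1 - 2 * Lam * h) \<le> 0"
      using Lh by (subst ln_le_zero_iff) linarith+
    moreover have "0 < ln bigR" using bigR_gt_2 by simp
    ultimately show "ln (1 - 2 * Lam * h) \<le> y b $ l" unfolding T2 by linarith
  qed
  have p1: "0 < 1 + 2 * Lam * h" "0 < 1 - 2 * Lam * h" using Lh by linarith+
  have "q b \<le> 1 + 2 * Lam * h" "1 - 2 * Lam * h \<le> q b"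
    unfolding q_def using qb p1 by (metis exp_le_cancel_iff exp_ln)+
  then show "\<bar>exp (y (s + T0 h) $ l) - 1\<bar> \<le> 2 * Lam * h"
    unfolding q_def b_def by linarith
qed

text \<open>If \<open>Ef\<close> is at most \<open>- Lpass h\<close> on arrival, the coordinate is
  at most \<open>eps0 h\<close> at the exit: \<open>Cbox\<close> is the drift, and \<open>G\<close>
  and \<open>G * \<bar>ln h\<bar>\<close> bound the contributions of coordinates k and l.\<close>

definition Lpass :: "real \<Rightarrow> real" where
  "Lpass h = Cbox + G * (1 + \<bar>ln h\<bar>) - ln (eps0 h)"

text \<open>The summands are the drift in the box, the change of \<open>Ef\<close> on the
  transition, and the terms of \<open>Ef\<close> in the coordinates k and l at the end.\<close>

definition Cpass :: "real \<Rightarrow> real" where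
  "Cpass h = Cbox + 2 * G * (B * T0 h) + G * (1 + B * T0 h) + G"

lemma Ef_diff:
  assumes "l - k \<in> {1, 3}" "\<And>i. \<bar>y $ i - z $ i\<bar> \<le> d"
  shows "\<bar>Ef k l j y - Ef k l j z\<bar> \<le> 2 * G * d"
proof -
  have "Ef k l j y - Ef k l j z = (y $ j - z $ j) - (y $ k - z $ k)
      - rho k l j * ((y $ l - z $ l) - (y $ k - z $ k))"
    by (simp add: Ef_def algebra_simps)
  moreover have "\<bar>rho k l j * ((y $ l - z $ l) - (y $ k - z $ k))\<bar> \<le> (G - 1) * (2 * d)"
    unfolding abs_mult using abs_rho[OF assms(1), of j] assms(2)[of l] assms(2)[of k]
    by (intro mult_mono) auto
  moreover have "2 * d + (G - 1) * (2 * d) = 2 * G * d" by (simp add: algebra_simps)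
  ultimately show ?thesis using assms(2)[of j] assms(2)[of k] by linarith
qed

text \<open>Two conclusions carry the later argument: the new logarithms equal the old values of
  \<open>Ef\<close> up to \<open>Cpass h\<close>, which is the step of the linear recursion, and
  \<open>y $ l - y $ k\<close> increases over the entire passage, which yields the order of
  visits.\<close>

lemma passage:
  assumes y: "lsol y" and sm: "small h" and lk: "l - k \<in> {1, 3}" and t0: "0 \<le> t0"
    and start: "\<And>j. j \<noteq> k \<Longrightarrow> y t0 $ j < ln h" "\<bar>exp (y t0 $ k) - 1\<bar> < 5 * Lam * h"
    and E: "\<And>j. j \<notin> {k, l} \<Longrightarrow> Ef k l j (y t0) \<le> - Lpass h"
  obtains s where "t0 \<le> s"
    and "\<And>t. t \<in> {t0..s} \<Longrightarrow> inbox h k (ex (y t))"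
    and "ln h - y t0 $ l \<le> B * (s - t0)"
    and "\<And>t i. t \<in> {t0..s + T0 h} \<Longrightarrow> exp (y t $ i) \<le> bigR"
    and "\<And>t j. t \<in> {t0..s + T0 h} \<Longrightarrow> j \<notin> {k, l} \<Longrightarrow> exp (y t $ j) \<le> h"
    and "\<And>t t'. t0 \<le> t \<Longrightarrow> t < t' \<Longrightarrow> t' \<le> s + T0 h \<Longrightarrow> y t $ l - y t $ k < y t' $ l - y t' $ k"
    and "\<bar>exp (y (s + T0 h) $ l) - 1\<bar> < 5 * Lam * h"
    and "y (s + T0 h) $ k < ln h" "\<bar>y (s + T0 h) $ k\<bar> \<le> Cpass h"
    and "\<bar>y (s + T0 h) $ l\<bar> \<le> 1"
    and "\<And>j. j \<notin> {k, l} \<Longrightarrow> y (s + T0 h) $ j < ln h"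
    and "\<And>j. j \<notin> {k, l} \<Longrightarrow> \<bar>y (s + T0 h) $ j - Ef k l j (y t0)\<bar> \<le> Cpass h"
proof -
  note sh = smallD[OF sm] and T = T_pos[OF sm]
  have kl: "k \<noteq> l" using lk by auto
  have lnh: "ln h < 0" using sh by simp
  have ln_eps: "ln (eps0 h) < ln h"
    using eps0_bounds[OF sm] sh by (subst ln_less_cancel_iff) auto
  have G1: "0 \<le> G * \<bar>ln h\<bar>" using G_gt_1 by simp
  have Elt: "Ef k l j (y t0) < ln h - Cbox - G" if "j \<notin> {k, l}" for j
    using E[OF that] ln_eps G1 unfolding Lpass_def distrib_left by linarith
  obtain s where s: "t0 \<le> s" "y s $ l = ln h" "\<And>t. t \<in> {t0..s} \<Longrightarrow> inbox h k (ex (y t))"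
    using box_phase[OF y sm lk t0 start Elt] by blast
  have s0: "0 \<le> s" using t0 s by simp
  have sb: "inbox h k (ex (y s))" using s by auto
  have drift: "\<bar>Ef k l j (y s) - Ef k l j (y t0)\<bar> \<le> Cbox" for j
    by (rule Ef_drift_in_box[OF y sm lk t0 s(1)]) (rule s(3))
  have rk: "\<bar>1 - rho k l j\<bar> \<le> G" "\<bar>rho k l j\<bar> \<le> G" for j
    using abs_rho[OF lk, of j] by linarith+
  have js: "y s $ j \<le> ln (eps0 h)" if j: "j \<notin> {k, l}" for j
  proof -
    have "\<bar>(1 - rho k l j) * y s $ k\<bar> \<le> G * 1"
      unfolding abs_mult using rk[of j] inbox_log(1)[OF sm sb] G_gt_1 by (intro mult_mono) auto
    moreover have "\<bar>rho k l j * y s $ l\<bar> \<le> G * \<bar>ln h\<bar>"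
      unfolding abs_mult s(2) using rk(2)[of j] by (intro mult_right_mono) auto
    ultimately show ?thesis
      using E[OF j] drift[of j] Ef_nth[of "y s" j k l] unfolding Lpass_def distrib_left by linarith
  qed
  have ks: "\<bar>exp (y s $ k) - 1\<bar> \<le> 1 / 2"
  proof -
    have "\<bar>exp (y s $ k) - 1\<bar> \<le> 5 * Lam * h" using sb by (simp add: inbox_def)
    then show ?thesis using sh(3) by linarith
  qed
  note tr = transit[OF y sm lk s0 s(2) ks js]
  have bd: "exp (y t $ i) \<le> bigR" if "t \<in> {t0..s + T0 h}" for t i
  proof (cases "t \<le> s")
    case True
    then have "inbox h k (ex (y t))" using s(3) that by auto
    from inbox_le(1)[OF sm this, of i] bigR_gt_2 show ?thesis by simp
  qed (use tr(1) that in auto)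
  then have tre: "trunc bigR (y t) = ex (y t)" if "t \<in> {t0..s + T0 h}" for t
    using that by (intro trunc_ex) auto
  define t1 where "t1 = s + T0 h"
  have dist: "\<bar>y t1 $ i - y s $ i\<bar> \<le> B * T0 h" for i
    using lsol_lip[OF y s0, of t1 i] T by (simp add: t1_def)
  have yl: "\<bar>y t1 $ l\<bar> \<le> 1"
  proof (rule inbox_log(1)[OF sm])
    show "inbox h l (ex (y t1))"
      unfolding inbox_def
    proof (intro conjI allI impI)
      fix j assume "j \<noteq> l"
      show "ex (y t1) $ j \<le> h"
        using tr(2)[of t1 j] tr(5) T \<open>j \<noteq> l\<close> sh by (cases "j = k") (auto simp: t1_def)
    next
      have "0 < Lam * h" using Lam_gt_1 sh by auto
      then show "\<bar>ex (y t1) $ l - 1\<bar> \<le> 5 * Lam * h"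
        using tr(4) unfolding t1_def ex_nth by linarith
    qed auto
  qed
  have BT: "0 \<le> B * T0 h" using B_pos T by simp
  have yk: "\<bar>y t1 $ k\<bar> \<le> 1 + B * T0 h"
    using dist[of k] inbox_log(1)[OF sm sb] by linarith
  show thesis
  proof (rule that[OF s(1) s(3)])
    show "ln h - y t0 $ l \<le> B * (s - t0)"
      using lsol_lip[OF y t0 s(1), of l] s(2) by linarith
    show "exp (y t $ j) \<le> h" if "t \<in> {t0..s + T0 h}" "j \<notin> {k, l}" for t j
    proof (cases "t \<le> s")
      case True
      then have "inbox h k (ex (y t))" using s(3) that by auto
      then show ?thesis using that by (simp add: inbox_def)
    next
      case False
      then have "exp (y t $ j) \<le> h / 6" using tr(2) that by auto
      then show ?thesis using sh by linarith
    qed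
    show "y t $ l - y t $ k < y t' $ l - y t' $ k" if "t0 \<le> t" "t < t'" "t' \<le> s + T0 h" for t t'
    proof (rule pos_deriv_within_imp_less[OF \<open>t < t'\<close>,
          where u = "\<lambda>t. y t $ l - y t $ k" and u' = "\<lambda>t. rate (ex (y t)) l - rate (ex (y t)) k"])
      fix u assume u: "u \<in> {t..t'}"
      then have uI: "u \<in> {t0..s + T0 h}" using that by auto
      have "0 \<le> t" using t0 that by simp
      then show "((\<lambda>t. y t $ l - y t $ k) has_real_derivative
          rate (ex (y u)) l - rate (ex (y u)) k) (at u within {t..t'})"
        unfolding tre[OF uI, symmetric] by (intro DERIV_diff lsol_deriv[OF y _ u])
      show "0 < rate (ex (y u)) l - rate (ex (y u)) k"
      proof (cases "u \<le> s")
        case True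
        then have bx: "inbox h k (ex (y u))" using s(3) uI by auto
        \<comment> \<open>Rewriting \<open>k - k\<close> to 0 gives \<open>al 0 = 0\<close>:
          coordinate k has rate at most \<open>mu / 4\<close>, while that of l is at least
          \<open>3 * mu / 4\<close>.\<close>
        show ?thesis
          using inbox_rate(1)[OF sm bx, of l] inbox_rate(1)[OF sm bx, of k] al_out[OF lk] mu_pos
          unfolding right_minus_eq[THEN iffD2, OF refl] al_simps by linarith
      qed (use tr(3)[of u] uI in auto)
    qed
    have "0 < Lam * h" using Lam_gt_1 sh by auto
    then show "\<bar>exp (y (s + T0 h) $ l) - 1\<bar> < 5 * Lam * h" using tr(4) by linarith
    have "exp (y t1 $ k) < h" using tr(5) sh unfolding t1_def by linarith
    then show "y (s + T0 h) $ k < ln h" using sh unfolding t1_def by (metis exp_less_cancel_iff exp_ln)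
    have "1 * (1 + B * T0 h) \<le> G * (1 + B * T0 h)"
      using G_gt_1 BT by (intro mult_right_mono) auto
    then have "\<bar>y (s + T0 h) $ k\<bar> \<le> G * (1 + B * T0 h)" using yk by (simp add: t1_def)
    also have "\<dots> \<le> Cpass h"
    proof -
      have "0 < Cbox" using Lam_gt_1 G_gt_1 mu_pos by (simp add: Cbox_def)
      moreover have "0 \<le> 2 * G * (B * T0 h)" using G_gt_1 BT by simp
      ultimately show ?thesis using G_gt_1 by (simp add: Cpass_def)
    qed
    finally show "\<bar>y (s + T0 h) $ k\<bar> \<le> Cpass h" .
    show "\<bar>y (s + T0 h) $ l\<bar> \<le> 1" using yl unfolding t1_def .
    show "y (s + T0 h) $ j < ln h" if "j \<notin> {k, l}" for j
    proof -
      have "exp (y t1 $ j) < h" using tr(2)[of t1 j] that T sh unfolding t1_def by auto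
      then show ?thesis using sh unfolding t1_def by (metis exp_less_cancel_iff exp_ln)
    qed
    show "\<bar>y (s + T0 h) $ j - Ef k l j (y t0)\<bar> \<le> Cpass h" if j: "j \<notin> {k, l}" for j
    proof -
      have "\<bar>Ef k l j (y t1) - Ef k l j (y s)\<bar> \<le> 2 * G * (B * T0 h)"
        by (rule Ef_diff[OF lk dist])
      moreover have "\<bar>(1 - rho k l j) * y t1 $ k\<bar> \<le> G * (1 + B * T0 h)"
        unfolding abs_mult using rk[of j] yk G_gt_1 by (intro mult_mono) auto
      moreover have "\<bar>rho k l j * y t1 $ l\<bar> \<le> G * 1"
        unfolding abs_mult using rk[of j] yl G_gt_1 by (intro mult_mono) auto
      ultimately show ?thesis
        using drift[of j] Ef_nth[of "y t1" j k l] unfolding Cpass_def t1_def by linarith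
    qed
  qed (use bd in auto)
qed

end

section \<open>Distance to the network by compactness\<close>

context lotka_volterra
begin

lemma sol_nth:
  assumes "sol T f" "t \<in> T"
  shows "((\<lambda>t. f t $ j) has_real_derivative f t $ j * rate (f t) j) (at t within T)"
proof -
  have "(f has_vector_derivative V (f t)) (at t within T)"
    using assms by (simp add: solution_on_def)
  from bounded_linear.has_vector_derivative[OF bounded_linear_vec_nth this, of j] show ?thesis
    by (simp add: has_real_derivative_iff_has_vector_derivative vfield_nth)
qed

text \<open>Contracting coordinates have been decaying since arbitrarily early times, and an
  expanding coordinate that is not small early would outgrow the box before c. Once these are small,
  the radial coordinate obeys a nearly exact logistic equation, again with an arbitrarily long
  past.\<close>

lemma backward_box_tendsto:
  assumes g: "sol {..0} g" and sm: "small h" and "c \<le> 0"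
    and bx: "\<And>u. u \<le> c \<Longrightarrow> inbox h k (g u)"
  shows "(g \<longlongrightarrow> \<xi> k) at_bot"
proof -
  note sh = smallD[OF sm]
  have d: "((\<lambda>t. g t $ j) has_real_derivative g t $ j * rate (g t) j) (at t within {a..b})"
    if "t \<in> {a..b}" "b \<le> c" for t a b j
    by (rule DERIV_subset[OF sol_nth[OF g]]) (use that \<open>c \<le> 0\<close> in auto)
  have nn: "0 \<le> g u $ j" if "u \<le> c" for u j using bx[OF that] by (simp add: inbox_def)
  have contr: "g u $ j \<le> e" if u: "u \<le> c" and "0 < e" and neg: "al (j - k) \<le> - mu" for u j e
  proof -
    \<comment> \<open>A coordinate that is at most 3 at this time and decreases at speed
      \<open>mu / 2 * e\<close> while above e is down to e at time u.\<close>
    define v where "v = u - 3 / (mu / 2 * e)"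
    have vu: "v \<le> u" using mu_pos \<open>0 < e\<close> by (simp add: v_def)
    have "g u $ j \<le> max e (3 - mu / 2 * e * (u - v))"
    proof (rule decay_barrier[OF vu d[OF _ u]])
      fix t assume t: "t \<in> {v..u}" "e \<le> g t $ j"
      then have "\<bar>rate (g t) j - al (j - k)\<bar> \<le> mu / 4"
        using u by (intro inbox_rate(1)[OF sm bx]) auto
      then have "rate (g t) j \<le> - (mu / 2)" using neg mu_pos by linarith
      then have "g t $ j * rate (g t) j \<le> g t $ j * - (mu / 2)"
        using t \<open>0 < e\<close> by (intro mult_left_mono) auto
      also have "\<dots> \<le> - (mu / 2 * e)" using t mu_pos by simp
      finally show "g t $ j * rate (g t) j \<le> - (mu / 2 * e)" .
    next
      show "g v $ j \<le> 3" using inbox_le(1)[OF sm bx, of v j] vu u by simp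
    qed (use mu_pos \<open>0 < e\<close> in auto)
    also have "mu / 2 * e * (u - v) = 3" using mu_pos \<open>0 < e\<close> by (simp add: v_def)
    finally show ?thesis using \<open>0 < e\<close> by simp
  qed
  have expa: "g v $ j \<le> e" if "0 < e" and p: "mu \<le> al (j - k)" and v: "v \<le> c - 3 / (mu / 2 * e)" for v j e
  proof (rule ccontr)
    assume ge: "\<not> ?thesis"
    have vc: "v \<le> c" using v mu_pos \<open>0 < e\<close> by (smt (verit) divide_pos_pos mult_pos_pos zero_less_numeral)
    have r: "mu / 2 \<le> rate (g t) j" if "t \<le> c" for t
      using inbox_rate(1)[OF sm bx[OF that], of j] p mu_pos by linarith
    have mono: "g v $ j \<le> g t $ j" if "v \<le> t" "t \<le> c" for t
    proof (rule nonneg_deriv_within_imp_le[OF that(1) d[OF _ that(2)]])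
      fix s assume "s \<in> {v<..<t}"
      then have "s \<le> c" using that by auto
      then show "0 \<le> g s $ j * rate (g s) j"
        using nn[of s j] r[of s] mu_pos by (intro mult_nonneg_nonneg) auto
    qed
    have "min 3 (e + mu / 2 * e * (c - v)) \<le> g c $ j"
    proof (rule growth_barrier[OF vc d])
      fix t assume t: "t \<in> {v..c}"
      then have "e \<le> g t $ j" using mono[of t] ge by auto
      then have "e * (mu / 2) \<le> g t $ j * rate (g t) j"
        using r[of t] t mu_pos \<open>0 < e\<close> by (intro mult_mono) auto
      then show "mu / 2 * e \<le> g t $ j * rate (g t) j" by (simp add: mult.commute)
    qed (use ge mu_pos \<open>0 < e\<close> in auto)
    moreover have "mu / 2 * e * (3 / (mu / 2 * e)) \<le> mu / 2 * e * (c - v)"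
      using v mu_pos \<open>0 < e\<close> by (intro mult_left_mono) auto
    then have "3 \<le> mu / 2 * e * (c - v)" using mu_pos \<open>0 < e\<close> by simp
    moreover have "g c $ j \<le> 3 / 2" by (rule inbox_le(1)[OF sm bx]) simp
    ultimately show False using \<open>0 < e\<close> by linarith
  qed
  have small_ne: "g u $ j \<le> e" if "u \<le> c - 3 / (mu / 2 * e)" "0 < e" "j \<noteq> k" for u j e
  proof -
    have "u \<le> c" using that mu_pos by (smt (verit) divide_pos_pos mult_pos_pos zero_less_numeral)
    with that contr expa al_nonneg_or[of "j - k"] show ?thesis by auto
  qed
  have lim_ne: "((\<lambda>u. g u $ j) \<longlongrightarrow> 0) at_bot" if "j \<noteq> k" for j
  proof (rule tendstoI)
    fix e :: real assume "0 < e"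
    have *: "\<bar>g u $ j\<bar> < e" if "u \<le> min c (c - 3 / (mu / 2 * (e / 2)))" for u
      using small_ne[of u "e / 2" j] nn[of u j] that \<open>0 < e\<close> \<open>j \<noteq> k\<close> by auto
    show "\<forall>\<^sub>F u in at_bot. dist (g u $ j) 0 < e"
      unfolding eventually_at_bot_linorder dist_real_def using * by (metis diff_zero)
  qed
  have lim_k: "((\<lambda>u. g u $ k) \<longlongrightarrow> 1) at_bot"
  proof (rule tendstoI)
    fix e' :: real assume "0 < e'"
    define e where "e = min (e' / 2) 1"
    have e: "0 < e" "e \<le> 1" "e < e'" using \<open>0 < e'\<close> by (auto simp: e_def)
    \<comment> \<open>Four coordinates of size w disturb the rate of coordinate k by at most
      \<open>4 * Lam * w = e / 2\<close>, half of the deviation from 1 to be excluded.\<close>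
    define w where "w = e / (8 * Lam)"
    have w: "0 < w" "4 * Lam * w = e / 2" using e Lam_gt_1 by (auto simp: w_def)
    define b where "b = min c (c - 3 / (mu / 2 * w))"
    have rk: "\<bar>rate (g t) k - (1 - g t $ k)\<bar> \<le> e / 2" if "t \<le> b" for t
    proof -
      have "(\<Sum>i\<in>UNIV - {k}. \<bar>g t $ i\<bar>) \<le> of_nat (card (UNIV - {k})) * w"
        by (rule sum_bounded_above)
          (use that small_ne[of t w] nn[of t] w in \<open>auto simp: b_def\<close>)
      then have "Lam * (\<Sum>i\<in>UNIV - {k}. \<bar>g t $ i\<bar>) \<le> Lam * (4 * w)"
        using Lam_gt_1 by (intro mult_left_mono) (auto simp: card_Diff_singleton)
      with rate_split[of "g t" k k] w(2) show ?thesis by (simp add: al_simps)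
    qed
    have gk: "1 / 2 \<le> g t $ k" "g t $ k \<le> 3 / 2" if "t \<le> b" for t
      using inbox_le[OF sm bx, of t] that by (auto simp: b_def)
    have up: "g u $ k \<le> 1 + e" "1 - e \<le> g u $ k" if "u \<le> b" for u
    proof -
      define v where "v = u - 1 / (e / 4)"
      have vu: "v \<le> u" using e by (simp add: v_def)
      have uc: "u \<le> c" using that by (simp add: b_def)
      have len: "e / 4 * (u - v) = 1" using e by (simp add: v_def)
      have "g u $ k \<le> max (1 + e) (3 / 2 - e / 4 * (u - v))"
      proof (rule decay_barrier[OF vu d[OF _ uc]])
        fix t assume t: "t \<in> {v..u}" "1 + e \<le> g t $ k"
        then have tb: "t \<le> b" using that by auto
        have "rate (g t) k \<le> - (e / 2)" using rk[OF tb] t by linarith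
        then have "g t $ k * rate (g t) k \<le> g t $ k * - (e / 2)"
          using gk[OF tb] by (intro mult_left_mono) auto
        also have "\<dots> \<le> - (e / 4)" using gk[OF tb] e by simp
        finally show "g t $ k * rate (g t) k \<le> - (e / 4)" .
      qed (use gk[of v] vu that e in auto)
      then show "g u $ k \<le> 1 + e" using e unfolding len by simp
      have "min (1 - e) (1 / 2 + e / 4 * (u - v)) \<le> g u $ k"
      proof (rule growth_barrier[OF vu d[OF _ uc]])
        fix t assume t: "t \<in> {v..u}" "g t $ k \<le> 1 - e"
        then have tb: "t \<le> b" using that by auto
        have "e / 2 \<le> rate (g t) k" using rk[OF tb] t by linarith
        then have "1 / 2 * (e / 2) \<le> g t $ k * rate (g t) k"
          using gk[OF tb] e by (intro mult_mono) auto
        then show "e / 4 \<le> g t $ k * rate (g t) k" by simp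
      qed (use gk[of v] vu that e in auto)
      then show "1 - e \<le> g u $ k" using e unfolding len by simp
    qed
    have "\<bar>g u $ k - 1\<bar> < e'" if "u \<le> b" for u
      using up[OF that] e by linarith
    then show "\<forall>\<^sub>F u in at_bot. dist (g u $ k) 1 < e'"
      unfolding eventually_at_bot_linorder dist_real_def by blast
  qed
  show ?thesis
  proof (rule vec_tendstoI)
    fix j show "((\<lambda>u. g u $ j) \<longlongrightarrow> \<xi> k $ j) at_bot"
      using lim_k lim_ne[of j] by (cases "j = k") (auto simp: \<xi>_def axis_def)
  qed
qed

lemma tendsto_inbox:
  assumes "(\<lambda>n. f n) \<longlonglongrightarrow> x" and "\<forall>\<^sub>F n in sequentially. inbox h k (f n)"
  shows "inbox h k x"
proof -
  have c: "(\<lambda>n. f n $ j) \<longlonglongrightarrow> x $ j" for j using assms(1) by (rule tendsto_vec_nth)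
  show ?thesis
    unfolding inbox_def
  proof (intro conjI allI impI)
    fix j show "0 \<le> x $ j"
      by (rule tendsto_lowerbound[OF c]) (use assms(2) in \<open>auto elim!: eventually_mono simp: inbox_def\<close>)
    show "x $ j \<le> h" if "j \<noteq> k"
      by (rule tendsto_upperbound[OF c]) (use assms(2) that in \<open>auto elim!: eventually_mono simp: inbox_def\<close>)
  next
    have "(\<lambda>n. \<bar>f n $ k - 1\<bar>) \<longlonglongrightarrow> \<bar>x $ k - 1\<bar>" by (intro tendsto_intros c)
    then show "\<bar>x $ k - 1\<bar> \<le> 5 * Lam * h"
      by (rule tendsto_upperbound) (use assms(2) in \<open>auto elim!: eventually_mono simp: inbox_def\<close>)
  qed
qed

text \<open>The number c is the time elapsed since the controlled stay in the box ended.
  Counterexamples for growing N would have a convergent subsequence of final points. Backward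
  Gronwall extends this convergence to every past interval without a diagonal selection, and the
  limit solution lies in the unstable manifold.\<close>

lemma near_network:
  assumes sm: "small h" and "0 \<le> c" and "0 < \<delta>"
  obtains N :: nat where "\<And>f. sol {- real N - c..0} f \<Longrightarrow>
      (\<And>t. t \<in> {- real N - c..0} \<Longrightarrow> norm (f t) \<le> R \<and> (\<forall>i. 0 \<le> f t $ i)) \<Longrightarrow>
      (\<And>t. t \<in> {- real N - c..- c} \<Longrightarrow> inbox h k (f t)) \<Longrightarrow> infdist (f 0) \<Sigma> < \<delta>"
proof (rule ccontr)
  assume "\<not> thesis"
  then have "\<forall>N. \<exists>f. sol {- real N - c..0} f \<and>
      (\<forall>t\<in>{- real N - c..0}. norm (f t) \<le> R \<and> (\<forall>i. 0 \<le> f t $ i)) \<and>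
      (\<forall>t\<in>{- real N - c..- c}. inbox h k (f t)) \<and> \<not> infdist (f 0) \<Sigma> < \<delta>"
    using that by blast
  then obtain f where f: "\<And>N. sol {- real N - c..0} (f N)"
    "\<And>N t. t \<in> {- real N - c..0} \<Longrightarrow> norm (f N t) \<le> R \<and> (\<forall>i. 0 \<le> f N t $ i)"
    "\<And>N t. t \<in> {- real N - c..- c} \<Longrightarrow> inbox h k (f N t)"
    "\<And>N. \<not> infdist (f N 0) \<Sigma> < \<delta>"
    by metis
  have in_cball: "\<forall>n. f n 0 \<in> cball 0 R" using f(2)[of 0] \<open>0 \<le> c\<close> by auto
  have "seq_compact (cball (0 :: real ^ 5) R)" by (rule compact_imp_seq_compact[OF compact_cball])
  then obtain x r where r: "strict_mono r" and "((\<lambda>n. f n 0) \<circ> r) \<longlonglongrightarrow> x"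
    by (rule seq_compactE[OF _ in_cball])
  then have lx: "(\<lambda>n. f (r n) 0) \<longlonglongrightarrow> x" by (simp add: o_def)
  define g where "g t = lim (\<lambda>n. f (r n) t)" for t
  have shift: "sol {- real T..0} g \<and> (\<forall>t\<in>{- real T..0}. (\<lambda>n. f (r n) t) \<longlonglongrightarrow> g t)" for T :: nat
  proof -
    \<comment> \<open>Dropping the first T members leaves solutions that are all defined on
      \<open>{- real T..0}\<close>, as r is strictly increasing.\<close>
    define F where "F n = f (r (n + T))" for n
    have ge: "real T \<le> real (r (n + T))" for n
      using seq_suble[OF r, of "n + T"] by simp
    have sub: "{- real T..0} \<subseteq> {- real (r (n + T)) - c..0}" for n
      using ge[of n] \<open>0 \<le> c\<close> by auto
    define G where "G t = lim (\<lambda>n. F n t)" for t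
    have 1: "sol {- real T..0} (F n)" for n
      unfolding F_def by (rule solution_on_subset[OF f(1) sub])
    have 2: "norm (F n t) \<le> R" if "t \<in> {- real T..0}" for n t
      unfolding F_def using f(2)[of t "r (n + T)"] sub[of n] that by blast
    have 3: "(\<lambda>n. F n 0) \<longlonglongrightarrow> x" unfolding F_def by (rule LIMSEQ_ignore_initial_segment[OF lx])
    have G: "sol {- real T..0} G" "\<And>t. t \<in> {- real T..0} \<Longrightarrow> (\<lambda>n. F n t) \<longlonglongrightarrow> G t"
      using sol_limit[where a = "- real T" and b = 0 and c = 0 and f = F and R = R and x = x and g = G]
        1 2 3 by (auto simp: G_def)
    have G': "(\<lambda>n. f (r n) t) \<longlonglongrightarrow> G t" if "t \<in> {- real T..0}" for t
      using G(2)[OF that] unfolding F_def by (rule LIMSEQ_offset)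
    have eq: "G t = g t" if "t \<in> {- real T..0}" for t
      unfolding g_def using limI[OF G'[OF that]] by simp
    show ?thesis
      using solution_on_cong[OF G(1) eq] G' eq by auto
  qed
  have conv: "(\<lambda>n. f (r n) t) \<longlonglongrightarrow> g t" if "t \<le> 0" for t
  proof -
    obtain T :: nat where "- t \<le> real T" using real_arch_simple by blast
    with shift[of T] that show ?thesis by auto
  qed
  have solg: "sol {..0} g"
    unfolding solution_on_def
  proof
    fix t :: real assume "t \<in> {..0}"
    obtain T :: nat where T: "- t < real T" using reals_Archimedean2 by blast
    with shift[of T] \<open>t \<in> {..0}\<close> have "(g has_vector_derivative V (g t)) (at t within {- real T..0})"
      by (auto simp: solution_on_def)
    then show "(g has_vector_derivative V (g t)) (at t within {..0})"
      using at_within_Icc_atMost[of "- real T" t 0] T by simp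
  qed
  have bxg: "inbox h k (g u)" if "u \<le> - c" for u
  proof (rule tendsto_inbox[OF conv])
    show "u \<le> 0" using that \<open>0 \<le> c\<close> by simp
    obtain N :: nat where N: "- u \<le> real N" using real_arch_simple by blast
    show "\<forall>\<^sub>F n in sequentially. inbox h k (f (r n) u)"
      unfolding eventually_sequentially
    proof (intro exI[of _ N] allI impI)
      fix n assume "N \<le> n"
      then have "real N \<le> real (r n)" using seq_suble[OF r, of n] by simp
      then show "inbox h k (f (r n) u)" using N that \<open>0 \<le> c\<close> by (intro f(3)) auto
    qed
  qed
  have "(g \<longlongrightarrow> \<xi> k) at_bot"
    by (rule backward_box_tendsto[OF solg sm _ bxg, of "- c"]) (use \<open>0 \<le> c\<close> in auto)
  then have "g 0 \<in> unstable_manifold cA cB eA eB (\<xi> k)"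
    using solg unfolding unstable_manifold_def by blast
  moreover have "g 0 \<in> orthant"
    unfolding orthant_def
  proof (intro CollectI allI)
    fix i
    show "0 \<le> g 0 $ i"
      by (rule tendsto_lowerbound[OF tendsto_vec_nth[OF conv]])
        (use f(2)[of 0] \<open>0 \<le> c\<close> in auto)
  qed
  ultimately have mem: "g 0 \<in> \<Sigma>" unfolding network_def by auto
  have "g 0 = x" using LIMSEQ_unique[OF conv lx] by simp
  with lx \<open>0 < \<delta>\<close> have "\<forall>\<^sub>F n in sequentially. dist (f (r n) 0) (g 0) < \<delta>"
    by (simp add: tendstoD)
  then obtain n where "dist (f (r n) 0) (g 0) < \<delta>"
    using eventually_happens' sequentially_bot by blast
  with infdist_le[OF mem, of "f (r n) 0"] f(4)[of "r n"] show False by linarith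
qed

end

section \<open>Itineraries of continuous curves\<close>

lemma dist_\<xi>: "i \<noteq> j \<Longrightarrow> dist (\<xi> i) (\<xi> j) = sqrt 2"
proof -
  assume "i \<noteq> j"
  then have "(\<xi> i - \<xi> j) \<bullet> (\<xi> i - \<xi> j) = 2"
    by (simp add: \<xi>_def inner_diff_left inner_diff_right inner_axis_axis)
  then show ?thesis by (simp add: dist_norm norm_eq_sqrt_inner)
qed

lemma dist_via: "dist a b \<le> dist x a + dist x y + dist y b"
  using dist_triangle[of a b x] dist_triangle[of x b y] by (simp add: dist_commute)

definition visits :: "real \<Rightarrow> (real \<Rightarrow> real ^ 5) \<Rightarrow> real \<Rightarrow> real \<Rightarrow> 5 \<Rightarrow> bool" where
  "visits H f a b k \<longleftrightarrow> (\<exists>s\<in>{a..b}. dist (f s) (\<xi> k) \<le> H)"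

definition visits_only :: "real \<Rightarrow> (real \<Rightarrow> real ^ 5) \<Rightarrow> real \<Rightarrow> real \<Rightarrow> 5 \<Rightarrow> bool" where
  "visits_only H f a b k \<longleftrightarrow> (\<forall>j. j \<noteq> k \<longrightarrow> \<not> visits H f a b j)"

text \<open>A finite-stage itinerary that mentions no epochs: by time t the balls of
  \<open>m 0\<close>, ..., \<open>m n\<close> have been visited in this order, and no others. The
  times separating visits to consecutive balls can be taken rational, so only countable quantifiers
  remain.\<close>

primrec reached :: "real \<Rightarrow> (real \<Rightarrow> real ^ 5) \<Rightarrow> (nat \<Rightarrow> 5) \<Rightarrow> nat \<Rightarrow> real \<Rightarrow> bool" where
  "reached H f m 0 t \<longleftrightarrow> visits_only H f 0 t (m 0) \<and> visits H f 0 t (m 0)"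
| "reached H f m (Suc n) t \<longleftrightarrow> (\<exists>q\<in>\<rat> \<inter> {0..t}. reached H f m n q \<and>
     visits_only H f q t (m (Suc n)) \<and> visits H f q t (m (Suc n)))"

lemma visits_mono: "visits H f a b k \<Longrightarrow> a' \<le> a \<Longrightarrow> b \<le> b' \<Longrightarrow> visits H f a' b' k"
  unfolding visits_def by fastforce

lemma visits_only_mono: "visits_only H f a b k \<Longrightarrow> a \<le> a' \<Longrightarrow> b' \<le> b \<Longrightarrow> visits_only H f a' b' k"
  unfolding visits_only_def using visits_mono by blast

lemma visits_onlyD: "visits_only H f a b k \<Longrightarrow> a \<le> s \<Longrightarrow> s \<le> b \<Longrightarrow> dist (f s) (\<xi> j) \<le> H \<Longrightarrow> j = k"
  unfolding visits_only_def visits_def by auto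

lemma visits_onlyI:
  "(\<And>s j. a \<le> s \<Longrightarrow> s \<le> b \<Longrightarrow> dist (f s) (\<xi> j) \<le> H \<Longrightarrow> j = k) \<Longrightarrow> visits_only H f a b k"
  unfolding visits_only_def visits_def by auto

lemma reached_nonneg: "reached H f m n t \<Longrightarrow> 0 \<le> t"
  by (cases n) (auto simp: visits_def)

locale trajectory =
  fixes H :: real and f :: "real \<Rightarrow> real ^ 5"
  assumes H: "H < sqrt 2 / 2" and cont: "continuous_on {0..} f"
begin

lemma near_unique: "dist x (\<xi> i) \<le> H \<Longrightarrow> dist x (\<xi> j) \<le> H \<Longrightarrow> i = j"
  using dist_\<xi>[of i j] dist_triangle3[of "\<xi> i" "\<xi> j" x] H by (cases "i = j") auto

lemma near_eq_Some: "near_eq H x = Some k \<longleftrightarrow> dist x (\<xi> k) \<le> H"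
proof
  assume k: "dist x (\<xi> k) \<le> H"
  then have "(THE k. dist x (\<xi> k) \<le> H) = k" using near_unique by blast
  with k show "near_eq H x = Some k" by (auto simp: near_eq_def)
next
  assume *: "near_eq H x = Some k"
  then obtain j where j: "dist x (\<xi> j) \<le> H" by (auto simp: near_eq_def split: if_splits)
  then have "(THE k. dist x (\<xi> k) \<le> H) = j" using near_unique by blast
  with j * show "dist x (\<xi> k) \<le> H" by (auto simp: near_eq_def split: if_splits)
qed

definition vset where "vset t = {s. 0 \<le> s \<and> s \<le> t \<and> near_eq H (f s) \<noteq> None}"

lemma vset: "s \<in> vset t \<longleftrightarrow> 0 \<le> s \<and> s \<le> t \<and> (\<exists>k. dist (f s) (\<xi> k) \<le> H)"
  unfolding vset_def using near_eq_Some by auto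

lemma closed_vset: "closed (vset t)"
proof -
  have "vset t = (\<Union>k. {0..t} \<inter> f -` cball (\<xi> k) H)"
    by (auto simp: vset dist_commute)
  moreover have "closed ({0..t} \<inter> f -` cball (\<xi> k) H)" for k
    by (intro continuous_closed_preimage continuous_on_subset[OF cont]) auto
  then have "closed (\<Union>k. {0..t} \<inter> f -` cball (\<xi> k) H)" by (intro closed_UN) auto
  ultimately show ?thesis by (simp only:)
qed

lemma Sup_vset: "vset t \<noteq> {} \<Longrightarrow> Sup (vset t) \<in> vset t"
  by (intro closed_contains_Sup closed_vset bdd_aboveI[of _ t]) (auto simp: vset)

lemma Sup_vset_upper: "s \<in> vset t \<Longrightarrow> s \<le> Sup (vset t)"
  by (intro cSup_upper bdd_aboveI[of _ t]) (auto simp: vset)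

lemma last_eq_alt: "last_eq H f t = (if vset t = {} then None else near_eq H (f (Sup (vset t))))"
  by (simp only: last_eq_def vset_def Let_def)

lemma last_eq_None: "last_eq H f t = None \<longleftrightarrow> vset t = {}"
proof (cases "vset t = {}")
  case False
  then obtain k where "dist (f (Sup (vset t))) (\<xi> k) \<le> H"
    using Sup_vset[of t] by (auto simp only: vset)
  then have "near_eq H (f (Sup (vset t))) = Some k" by (simp only: near_eq_Some)
  with False show ?thesis by (simp add: last_eq_alt)
qed (simp add: last_eq_alt)

lemma last_eq_SomeD:
  assumes "last_eq H f t = Some k"
  obtains v where "0 \<le> v" "v \<le> t" "dist (f v) (\<xi> k) \<le> H"
    "\<And>s j. v < s \<Longrightarrow> s \<le> t \<Longrightarrow> \<not> dist (f s) (\<xi> j) \<le> H"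
proof (rule that)
  have ne: "vset t \<noteq> {}" and k: "near_eq H (f (Sup (vset t))) = Some k"
    using assms by (auto simp: last_eq_alt split: if_splits)
  show 0: "0 \<le> Sup (vset t)" "Sup (vset t) \<le> t" using Sup_vset[OF ne] by (auto simp: vset)
  show "dist (f (Sup (vset t))) (\<xi> k) \<le> H" using k by (simp add: near_eq_Some)
  show "\<not> dist (f s) (\<xi> j) \<le> H" if "Sup (vset t) < s" "s \<le> t" for s j
  proof
    assume "dist (f s) (\<xi> j) \<le> H"
    then have "s \<in> vset t" using that 0 by (auto simp: vset)
    from Sup_vset_upper[OF this] that show False by simp
  qed
qed

lemma last_eq_SomeI:
  assumes "0 \<le> v" "v \<le> t" "dist (f v) (\<xi> k) \<le> H"
    and "\<And>s j. v < s \<Longrightarrow> s \<le> t \<Longrightarrow> dist (f s) (\<xi> j) \<le> H \<Longrightarrow> j = k"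
  shows "last_eq H f t = Some k"
proof -
  have v: "v \<in> vset t" using assms by (auto simp: vset)
  then have ne: "vset t \<noteq> {}" by auto
  obtain j where j: "dist (f (Sup (vset t))) (\<xi> j) \<le> H" "Sup (vset t) \<le> t"
    using Sup_vset[OF ne] by (auto simp: vset)
  have "j = k"
  proof (cases "v = Sup (vset t)")
    case True
    then show ?thesis using j(1) assms(3) near_unique by blast
  next
    case False
    then have "v < Sup (vset t)" using Sup_vset_upper[OF v] by simp
    then show ?thesis using assms(4) j by blast
  qed
  then show ?thesis using j(1) ne by (simp add: last_eq_alt near_eq_Some)
qed

text \<open>The epoch \<open>\<tau> n\<close> is the first visit to the ball of \<open>m n\<close>
  after the previous separating time. First visits are forced by \<open>last_eq\<close>, which
  changes its value exactly on a visit.\<close>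

lemma itinerary_of_chain:
  assumes q0: "0 \<le> q 0" and q: "\<And>n. q n < q (Suc n)" and m: "\<And>n. m (Suc n) \<noteq> m n"
    and base: "visits_only H f 0 (q 0) (m 0)" "visits H f 0 (q 0) (m 0)"
    and step: "\<And>n. visits_only H f (q n) (q (Suc n)) (m (Suc n))"
      "\<And>n. visits H f (q n) (q (Suc n)) (m (Suc n))"
  shows "\<exists>\<tau>. itinerary H f m \<tau>"
proof -
  \<comment> \<open>The n-th visit is sought in \<open>{p n..q n}\<close>; for n = 0 the search
    starts at time 0.\<close>
  define p where "p n = (case n of 0 \<Rightarrow> 0 | Suc k \<Rightarrow> q k)" for n
  have pq: "visits_only H f (p n) (q n) (m n)" "visits H f (p n) (q n) (m n)" for n
    by (cases n; use base step in \<open>simp add: p_def\<close>)+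
  have qnn: "0 \<le> q n" for n
    using q0 q[THEN less_imp_le] by (induction n) (auto intro: order_trans)
  have pnn: "0 \<le> p n" for n using qnn by (cases n) (auto simp: p_def)
  define S where "S n = {p n..q n} \<inter> f -` cball (\<xi> (m n)) H" for n
  have clS: "closed (S n)" for n
    unfolding S_def using pnn[of n]
    by (intro continuous_closed_preimage continuous_on_subset[OF cont]) auto
  have neS: "S n \<noteq> {}" for n
    using pq(2)[of n] by (auto simp: S_def visits_def dist_commute)
  have bdS: "bdd_below (S n)" for n by (intro bdd_belowI[of _ "p n"]) (auto simp: S_def)
  define \<tau> where "\<tau> n = Inf (S n)" for n
  have \<tau>S: "\<tau> n \<in> S n" for n unfolding \<tau>_def by (rule closed_contains_Inf[OF neS bdS clS])
  then have \<tau>: "p n \<le> \<tau> n" "\<tau> n \<le> q n" "dist (f (\<tau> n)) (\<xi> (m n)) \<le> H" for n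
    by (auto simp: S_def dist_commute)
  have \<tau>_least: "\<tau> n \<le> s" if "p n \<le> s" "s \<le> q n" "dist (f s) (\<xi> (m n)) \<le> H" for n s
    unfolding \<tau>_def by (rule cInf_lower[OF _ bdS]) (use that in \<open>auto simp: S_def dist_commute\<close>)
  have \<tau>q: "q n \<le> \<tau> (Suc n)" for n using \<tau>(1)[of "Suc n"] by (simp add: p_def)
  have inc: "\<tau> n < \<tau> (Suc n)" for n
  proof -
    have "\<tau> n \<noteq> \<tau> (Suc n)"
      using near_unique[OF \<tau>(3)[of n], of "m (Suc n)"] \<tau>(3)[of "Suc n"] m[of n] by auto
    moreover have "\<tau> n \<le> \<tau> (Suc n)" using \<tau>(2)[of n] \<tau>q[of n] by simp
    ultimately show ?thesis by simp
  qed
  then have mono: "strict_mono \<tau>" by (simp add: strict_mono_Suc_iff)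
  have \<tau>nn: "0 \<le> \<tau> n" for n using \<tau>(1)[of n] pnn[of n] by simp
  have only: "j = m n" if s: "\<tau> n \<le> s" "s < \<tau> (Suc n)" "dist (f s) (\<xi> j) \<le> H" for n s j
  proof (cases "s \<le> q n")
    case True
    then show ?thesis using visits_onlyD[OF pq(1), of n s j] \<tau>(1)[of n] s by simp
  next
    case False
    then have sI: "q n \<le> s" "s \<le> q (Suc n)" using s \<tau>(2)[of "Suc n"] by auto
    then have "j = m (Suc n)" using visits_onlyD[OF step(1)] s(3) by blast
    with \<tau>_least[of "Suc n" s] s sI have False by (simp add: p_def)
    then show ?thesis ..
  qed
  have 1: "last_eq H f t = None" if "0 \<le> t" "t < \<tau> 0" for t
    unfolding last_eq_None
  proof (rule ccontr)
    assume "vset t \<noteq> {}"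
    then obtain s j where s: "0 \<le> s" "s \<le> t" "dist (f s) (\<xi> j) \<le> H" by (auto simp: vset)
    then have s': "s \<le> q 0" using \<tau>(2)[of 0] that by simp
    then have "j = m 0" using visits_onlyD[OF base(1)] s by blast
    then have "\<tau> 0 \<le> s" using \<tau>_least[of 0 s] s s' by (simp add: p_def)
    with s that show False by simp
  qed
  have 2: "last_eq H f t = Some (m n)" if "\<tau> n \<le> t" "t < \<tau> (Suc n)" for n t
  proof (rule last_eq_SomeI[OF \<tau>nn that(1) \<tau>(3)])
    fix s j assume "\<tau> n < s" "s \<le> t" "dist (f s) (\<xi> j) \<le> H"
    then show "j = m n" using that by (intro only[of n s j]) auto
  qed
  \<comment> \<open>Bounded epochs would converge to a time at which the curve is continuous, but
    positions at consecutive epochs keep the distance \<open>sqrt 2 - 2 * H\<close>.\<close>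
  have "filterlim \<tau> at_top sequentially"
  proof (rule ccontr)
    assume nl: "\<not> ?thesis"
    have "bdd_above (range \<tau>)"
    proof (rule ccontr)
      assume nb: "\<not> bdd_above (range \<tau>)"
      have "filterlim \<tau> at_top sequentially"
        unfolding filterlim_at_top
      proof
        fix Z
        obtain N where "Z < \<tau> N" using nb unfolding bdd_above_def by (auto simp: not_le)
        moreover have "\<tau> N \<le> \<tau> n" if "N \<le> n" for n
          using strict_mono_less_eq[OF mono] that by simp
        ultimately show "\<forall>\<^sub>F n in sequentially. Z \<le> \<tau> n"
          unfolding eventually_sequentially by (intro exI[of _ N] allI impI) (meson less_imp_le less_le_trans)
      qed
      with nl show False ..
    qed
    then have T: "\<tau> \<longlonglongrightarrow> Sup (range \<tau>)"
      by (rule LIMSEQ_incseq_SUP[OF _ strict_mono_mono[OF mono]])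
    define T where "T = Sup (range \<tau>)"
    note T = T[folded T_def]
    have "0 \<le> T" by (rule LIMSEQ_le_const[OF T]) (use \<tau>nn in auto)
    then have c: "continuous (at T within {0..}) f"
      using cont by (simp add: continuous_on_eq_continuous_within)
    have l: "(\<lambda>n. f (\<tau> n)) \<longlonglongrightarrow> f T"
      by (rule continuous_within_tendsto_compose'[OF c _ T]) (use \<tau>nn in auto)
    have "(\<lambda>n. dist (f (\<tau> n)) (f (\<tau> (Suc n)))) \<longlonglongrightarrow> dist (f T) (f T)"
      by (intro tendsto_dist l LIMSEQ_Suc)
    moreover have "sqrt 2 - 2 * H \<le> dist (f (\<tau> n)) (f (\<tau> (Suc n)))" for n
    proof -
      have "sqrt 2 = dist (\<xi> (m n)) (\<xi> (m (Suc n)))" using dist_\<xi> m[of n] by metis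
      also have "\<dots> \<le> dist (f (\<tau> n)) (\<xi> (m n)) + dist (f (\<tau> n)) (f (\<tau> (Suc n)))
          + dist (f (\<tau> (Suc n))) (\<xi> (m (Suc n)))"
        by (rule dist_via)
      finally show ?thesis using \<tau>(3)[of n] \<tau>(3)[of "Suc n"] by simp
    qed
    ultimately have "sqrt 2 - 2 * H \<le> dist (f T) (f T)"
      by (intro LIMSEQ_le_const) auto
    with H show False by simp
  qed
  with mono \<tau>nn 1 2 m have "itinerary H f m \<tau>"
    unfolding itinerary_def by auto
  then show ?thesis by blast
qed

text \<open>In \<open>reached\<close> the separating times for different n are chosen independently;
  this makes them compatible. The two claims need a joint induction: the order of stages n and n + 1
  follows from the first claim at n, and in turn gives the first claim at n + 1.\<close>

lemma reached_rigid:
  assumes m: "\<And>n. m (Suc n) \<noteq> m n"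
  shows "(\<forall>s t. reached H f m n s \<longrightarrow> reached H f m n t \<longrightarrow> s \<le> t \<longrightarrow> visits_only H f s t (m n)) \<and>
     (\<forall>t t'. reached H f m n t \<longrightarrow> reached H f m (Suc n) t' \<longrightarrow> t < t')"
proof -
  have C: "\<forall>t t'. reached H f m n t \<longrightarrow> reached H f m (Suc n) t' \<longrightarrow> t < t'"
    if D: "\<forall>s t. reached H f m n s \<longrightarrow> reached H f m n t \<longrightarrow> s \<le> t \<longrightarrow> visits_only H f s t (m n)" for n
  proof (intro allI impI)
    fix t t' assume t: "reached H f m n t" and t': "reached H f m (Suc n) t'"
    obtain q v where q: "q \<le> v" "v \<le> t'" "reached H f m n q" "dist (f v) (\<xi> (m (Suc n))) \<le> H"
      using t' by (auto simp: visits_def)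
    show "t < t'"
    proof (rule ccontr)
      assume "\<not> ?thesis"
      then have "v \<le> t" "q \<le> t" using q by auto
      with D t q have "visits_only H f q t (m n)" by blast
      from visits_onlyD[OF this q(1) \<open>v \<le> t\<close> q(4)] m[of n] show False by simp
    qed
  qed
  show ?thesis
  proof (induction n)
  case 0
  have "\<forall>s t. reached H f m 0 s \<longrightarrow> reached H f m 0 t \<longrightarrow> s \<le> t \<longrightarrow> visits_only H f s t (m 0)"
    using reached_nonneg visits_only_mono by (metis order_refl reached.simps(1))
  then show ?case using C[of 0] by blast
next
  case (Suc n)
  have "visits_only H f s t (m (Suc n))"
    if s: "reached H f m (Suc n) s" and t: "reached H f m (Suc n) t" and "s \<le> t" for s t
  proof -
    obtain q where q: "q \<le> t" "reached H f m n q" "visits_only H f q t (m (Suc n))"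
      using t by auto
    have "q < s" using Suc.IH q(2) s by blast
    then show ?thesis using visits_only_mono[OF q(3)] by simp
  qed
  then show ?case using C[of "Suc n"] by blast
  qed
qed

lemma itinerary_if_reached:
  assumes m: "\<And>n. m (Suc n) \<noteq> m n" and r: "\<And>n. \<exists>t. reached H f m n t"
  shows "\<exists>\<tau>. itinerary H f m \<tau>"
proof -
  have D: "visits_only H f s t (m n)" if "reached H f m n s" "reached H f m n t" "s \<le> t" for n s t
    using reached_rigid[of m n] m that by blast
  have C: "t < t'" if "reached H f m n t" "reached H f m (Suc n) t'" for n t t'
    using reached_rigid[of m n] m that by blast
  have "\<exists>q t. reached H f m n q \<and> reached H f m (Suc n) t \<and>
      visits_only H f q t (m (Suc n)) \<and> visits H f q t (m (Suc n))" for n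
    using r[of "Suc n"] by (metis IntE reached.simps(2))
  then obtain q t where qt: "\<And>n. reached H f m n (q n)" "\<And>n. reached H f m (Suc n) (t n)"
    "\<And>n. visits_only H f (q n) (t n) (m (Suc n))" "\<And>n. visits H f (q n) (t n) (m (Suc n))"
    by metis
  show ?thesis
  proof (rule itinerary_of_chain[where q = q])
    show "0 \<le> q 0" by (rule reached_nonneg[OF qt(1)])
    show "q n < q (Suc n)" for n by (rule C[OF qt(1) qt(1)])
    show "m (Suc n) \<noteq> m n" for n by (rule m)
    show "visits_only H f 0 (q 0) (m 0)" "visits H f 0 (q 0) (m 0)" using qt(1)[of 0] by auto
    fix n
    \<comment> \<open>Both \<open>t n\<close> and \<open>q (Suc n)\<close> are times of stage n + 1,
      in unknown order; rigidity covers the stretch between them.\<close>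
    show "visits_only H f (q n) (q (Suc n)) (m (Suc n))"
    proof (cases "q (Suc n) \<le> t n")
      case True
      then show ?thesis using visits_only_mono[OF qt(3)] by simp
    next
      case False
      have "visits_only H f (t n) (q (Suc n)) (m (Suc n))"
        by (rule D[OF qt(2) qt(1)]) (use False in auto)
      then show ?thesis
        using visits_onlyD[OF qt(3)] visits_onlyD[of H f "t n"]
        by (intro visits_onlyI) (metis linear)
    qed
    show "visits H f (q n) (q (Suc n)) (m (Suc n))"
    proof (cases "t n \<le> q (Suc n)")
      case True
      then show ?thesis using visits_mono[OF qt(4)] by simp
    next
      case False
      obtain q' v where q': "q' \<le> v" "v \<le> q (Suc n)" "reached H f m n q'" "dist (f v) (\<xi> (m (Suc n))) \<le> H"
        using qt(1)[of "Suc n"] by (auto simp: visits_def)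
      have "q n \<le> v"
      proof (rule ccontr)
        assume "\<not> q n \<le> v"
        then have "visits_only H f q' (q n) (m n)" using q' by (intro D qt(1)) auto
        from visits_onlyD[OF this q'(1) _ q'(4)] \<open>\<not> q n \<le> v\<close> m[of n] show False by simp
      qed
      with q' show ?thesis unfolding visits_def by auto
    qed
  qed
qed

text \<open>Just before an epoch u lies a short interval without visits, from which a rational
  separating time is taken: a visit there would be to the current ball, but by continuity the
  position is too close to the next ball.\<close>

lemma reached_if_itinerary:
  assumes it: "itinerary H f m \<tau>"
  shows "\<tau> n \<le> t \<Longrightarrow> t < \<tau> (Suc n) \<Longrightarrow> reached H f m n t"
proof (induction n arbitrary: t)
  have \<tau>0: "0 \<le> \<tau> 0" and mono: "strict_mono \<tau>" and m: "\<And>n. m (Suc n) \<noteq> m n"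
    and none: "\<And>t. 0 \<le> t \<Longrightarrow> t < \<tau> 0 \<Longrightarrow> last_eq H f t = None"
    and some: "\<And>n t. \<tau> n \<le> t \<Longrightarrow> t < \<tau> (Suc n) \<Longrightarrow> last_eq H f t = Some (m n)"
    using it unfolding itinerary_def by auto
  have \<tau>nn: "0 \<le> \<tau> n" for n
    using \<tau>0 mono strict_mono_less_eq[of \<tau> 0 n] by (meson le0 order_trans)
  have \<tau>inc: "\<tau> n < \<tau> (Suc n)" for n using mono by (simp add: strict_mono_Suc_iff)
  have visit: "j = m n" if "\<tau> n \<le> s" "s < \<tau> (Suc n)" "dist (f s) (\<xi> j) \<le> H" for n s j
  proof -
    have "0 \<le> s" using \<tau>nn[of n] that by simp
    then have "last_eq H f s = Some j" by (rule last_eq_SomeI[OF _ order_refl that(3)]) auto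
    with some[OF that(1,2)] show ?thesis by simp
  qed
  {
    case 0
    show ?case
      unfolding reached.simps
    proof
      show "visits_only H f 0 t (m 0)"
      proof (rule visits_onlyI)
        fix s j assume s: "0 \<le> s" "s \<le> t" "dist (f s) (\<xi> j) \<le> H"
        show "j = m 0"
        proof (cases "s < \<tau> 0")
          case True
          then have "vset s = {}" using none[of s] s by (simp add: last_eq_None)
          moreover have "s \<in> vset s" using s by (auto simp: vset)
          ultimately show ?thesis by simp
        qed (use visit[of 0 s j] s 0 in auto)
      qed
      obtain v where "0 \<le> v" "v \<le> t" "dist (f v) (\<xi> (m 0)) \<le> H"
        using last_eq_SomeD[OF some[OF 0]] by metis
      then show "visits H f 0 t (m 0)" unfolding visits_def by auto
    qed
  next
    case (Suc n)
    define u where "u = \<tau> (Suc n)"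
    have un: "\<tau> n < u" unfolding u_def by (rule \<tau>inc)
    obtain v where v: "0 \<le> v" "v \<le> u" "dist (f v) (\<xi> (m (Suc n))) \<le> H"
        "\<And>s j. v < s \<Longrightarrow> s \<le> u \<Longrightarrow> \<not> dist (f s) (\<xi> j) \<le> H"
      using last_eq_SomeD[OF some[of "Suc n" u]] \<tau>inc[of "Suc n"] unfolding u_def by blast
    \<comment> \<open>The epoch is itself a visiting time: a last visit before u would have switched
      \<open>last_eq\<close> earlier.\<close>
    have "v = u"
    proof (rule ccontr)
      assume "v \<noteq> u"
      then have lt: "max v (\<tau> n) < u" using v un by simp
      have "last_eq H f (max v (\<tau> n)) = Some (m (Suc n))"
        by (rule last_eq_SomeI[OF v(1) _ v(3)]) (use v(4) lt in force)+
      moreover have "last_eq H f (max v (\<tau> n)) = Some (m n)"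
        by (rule some) (use lt in \<open>auto simp: u_def\<close>)
      ultimately show False using m[of n] by simp
    qed
    with v(3) have du: "dist (f u) (\<xi> (m (Suc n))) \<le> H" by simp
    have u0: "0 \<le> u" unfolding u_def by (rule \<tau>nn)
    have "0 < sqrt 2 - 2 * H" using H by simp
    then obtain d where d: "0 < d" "\<And>s. 0 \<le> s \<Longrightarrow> dist s u < d \<Longrightarrow> dist (f s) (f u) < sqrt 2 - 2 * H"
      using cont u0 unfolding continuous_on_iff by (metis atLeast_iff)
    obtain q where q: "q \<in> \<rat>" "max (\<tau> n) (u - d) < q" "q < u"
      using Rats_dense_in_real[of "max (\<tau> n) (u - d)" u] un d(1) by auto
    have nov: "\<not> dist (f s) (\<xi> j) \<le> H" if s: "q \<le> s" "s < u" for s j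
    proof
      assume sj: "dist (f s) (\<xi> j) \<le> H"
      have "j = m n" by (rule visit[OF _ _ sj]) (use s q in \<open>auto simp: u_def\<close>)
      then have "sqrt 2 = dist (\<xi> j) (\<xi> (m (Suc n)))" using dist_\<xi> m[of n] by metis
      also have "\<dots> \<le> dist (f s) (\<xi> j) + dist (f s) (f u) + dist (f u) (\<xi> (m (Suc n)))"
        by (rule dist_via)
      also have "dist (f s) (f u) < sqrt 2 - 2 * H"
        using s q \<tau>nn[of n] by (intro d(2)) (auto simp: dist_real_def)
      finally show False using sj du by simp
    qed
    have ut: "u \<le> t" using Suc.prems by (simp add: u_def)
    have "reached H f m n q"
      by (rule Suc.IH) (use q in \<open>auto simp: u_def\<close>)
    moreover have "visits_only H f q t (m (Suc n))"
    proof (rule visits_onlyI)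
      fix s j assume s: "q \<le> s" "s \<le> t" "dist (f s) (\<xi> j) \<le> H"
      then have "u \<le> s" using nov by (meson not_le)
      then show "j = m (Suc n)"
        using visit[of "Suc n" s j] s Suc.prems by (simp add: u_def)
    qed
    moreover have "visits H f q t (m (Suc n))"
      unfolding visits_def using du q ut by auto
    moreover have "0 \<le> q" "q \<le> t" using q \<tau>nn[of n] ut by auto
    ultimately show ?case using q(1) by auto
  }
qed

lemma ex_itinerary_iff:
  assumes "\<And>n. m (Suc n) \<noteq> m n"
  shows "(\<exists>\<tau>. itinerary H f m \<tau>) \<longleftrightarrow> (\<forall>n. \<exists>t\<in>\<rat>. reached H f m n t)"
proof
  assume "\<exists>\<tau>. itinerary H f m \<tau>"
  then obtain \<tau> where it: "itinerary H f m \<tau>" ..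
  show "\<forall>n. \<exists>t\<in>\<rat>. reached H f m n t"
  proof
    fix n
    have "\<tau> n < \<tau> (Suc n)" using it by (simp add: itinerary_def strict_mono_Suc_iff)
    then obtain t where "t \<in> \<rat>" "\<tau> n < t" "t < \<tau> (Suc n)" using Rats_dense_in_real by blast
    then show "\<exists>t\<in>\<rat>. reached H f m n t" using reached_if_itinerary[OF it, of n t] by auto
  qed
next
  assume "\<forall>n. \<exists>t\<in>\<rat>. reached H f m n t"
  then show "\<exists>\<tau>. itinerary H f m \<tau>" using itinerary_if_reached assms by blast
qed

end

section \<open>Measurability of the local basin\<close>

lemma borel_UN:
  "countable I \<Longrightarrow> (\<And>i. i \<in> I \<Longrightarrow> A i \<in> sets borel) \<Longrightarrow> (\<Union>i\<in>I. A i) \<in> sets borel"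
  by (intro sets.countable_UN') auto

lemma borel_INT:
  "countable I \<Longrightarrow> (\<And>i. i \<in> I \<Longrightarrow> A i \<in> sets borel) \<Longrightarrow> (\<Inter>i\<in>I. A i) \<in> sets borel"
  by (intro sets.countable_INT'') auto

lemma reached_cong:
  assumes "\<And>t. 0 \<le> t \<Longrightarrow> f t = g t"
  shows "reached H f m n t \<longleftrightarrow> reached H g m n t"
proof -
  have v: "visits H f a b k \<longleftrightarrow> visits H g a b k" if "0 \<le> a" for a b k
    unfolding visits_def using that assms by (intro bex_cong) auto
  have vo: "visits_only H f a b k \<longleftrightarrow> visits_only H g a b k" if "0 \<le> a" for a b k
    unfolding visits_only_def using v[OF that] by simp
  show ?thesis by (induction n arbitrary: t) (auto simp: v vo)
qed

text \<open>Compactness turns approximate visits for every tolerance into a visit. Rationality of a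
  matters for the degenerate interval \<open>a = b\<close>, where a is the only candidate
  time.\<close>

lemma visits_rational:
  assumes cont: "continuous_on {0..} f" and a: "a \<in> \<rat>" "0 \<le> a"
  shows "visits H f a b k \<longleftrightarrow> (\<forall>i::nat. \<exists>s\<in>\<rat> \<inter> {a..b}. dist (f s) (\<xi> k) < H + 1 / real (Suc i))"
proof -
  have c: "continuous_on {a..b} (\<lambda>s. dist (f s) (\<xi> k))"
    by (intro continuous_intros continuous_on_subset[OF cont]) (use a in auto)
  show ?thesis
  proof
    assume "visits H f a b k"
    then obtain s where s: "a \<le> s" "s \<le> b" "dist (f s) (\<xi> k) \<le> H" by (auto simp: visits_def)
    show "\<forall>i::nat. \<exists>s\<in>\<rat> \<inter> {a..b}. dist (f s) (\<xi> k) < H + 1 / real (Suc i)"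
    proof
      fix i :: nat
      define e where "e = 1 / real (Suc i)"
      have e: "0 < e" by (simp add: e_def)
      show "\<exists>s\<in>\<rat> \<inter> {a..b}. dist (f s) (\<xi> k) < H + 1 / real (Suc i)"
      proof (cases "a = b")
        case True
        then have "s = a" using s by simp
        then have "dist (f a) (\<xi> k) < H + e" using s(3) e by simp
        then show ?thesis unfolding e_def[symmetric] using True a by auto
      next
        case False
        obtain d where d: "0 < d" "\<And>s'. s' \<in> {a..b} \<Longrightarrow> dist s' s < d \<Longrightarrow>
            dist (dist (f s') (\<xi> k)) (dist (f s) (\<xi> k)) < e"
          using c[unfolded continuous_on_iff, rule_format, of s e] s(1,2) e by auto
        have "max a (s - d) < min b (s + d)" using s False d(1) by auto
        then obtain q where q: "q \<in> \<rat>" "max a (s - d) < q" "q < min b (s + d)"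
          using Rats_dense_in_real by blast
        have "dist (dist (f q) (\<xi> k)) (dist (f s) (\<xi> k)) < e"
          using q by (intro d(2)) (auto simp: dist_real_def)
        then have "dist (f q) (\<xi> k) < H + e" using s(3) by (auto simp: dist_real_def)
        then show ?thesis unfolding e_def[symmetric] using q by (intro bexI[of _ q]) auto
      qed
    qed
  next
    assume R: "\<forall>i::nat. \<exists>s\<in>\<rat> \<inter> {a..b}. dist (f s) (\<xi> k) < H + 1 / real (Suc i)"
    then have "{a..b} \<noteq> {}" by blast
    then obtain s0 where s0: "s0 \<in> {a..b}" "\<And>s. s \<in> {a..b} \<Longrightarrow> dist (f s0) (\<xi> k) \<le> dist (f s) (\<xi> k)"
      using continuous_attains_inf[OF compact_Icc _ c] by blast
    have "dist (f s0) (\<xi> k) \<le> H + 1 / real (Suc i)" for i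
    proof -
      obtain s where "s \<in> {a..b}" "dist (f s) (\<xi> k) < H + 1 / real (Suc i)" using R by blast
      with s0(2)[of s] show ?thesis by linarith
    qed
    moreover have "(\<lambda>i. H + 1 / real (Suc i)) \<longlonglongrightarrow> H + 0"
      by (intro tendsto_intros LIMSEQ_Suc lim_1_over_n)
    ultimately have "dist (f s0) (\<xi> k) \<le> H"
      by (intro LIMSEQ_le_const[where X = "\<lambda>i. H + 1 / real (Suc i)"]) auto
    with s0(1) show "visits H f a b k" unfolding visits_def by blast
  qed
qed

lemma continuous_le_if_rational_le:
  fixes u :: "real \<Rightarrow> real"
  assumes cont: "continuous_on {0..} u" and "0 \<le> a" and le: "\<And>t. t \<in> \<rat> \<Longrightarrow> a \<le> t \<Longrightarrow> u t \<le> c"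
    and "a \<le> t"
  shows "u t \<le> c"
proof (rule ccontr)
  assume "\<not> ?thesis"
  then have "0 < u t - c" by simp
  then obtain d where d: "0 < d" "\<And>s. 0 \<le> s \<Longrightarrow> dist s t < d \<Longrightarrow> dist (u s) (u t) < u t - c"
    using cont \<open>0 \<le> a\<close> \<open>a \<le> t\<close> unfolding continuous_on_iff by (metis atLeast_iff order_trans)
  obtain q where q: "q \<in> \<rat>" "t < q" "q < t + d" using Rats_dense_in_real[of t "t + d"] d(1) by auto
  have "dist (u q) (u t) < u t - c" using q \<open>0 \<le> a\<close> \<open>a \<le> t\<close> by (intro d(2)) (auto simp: dist_real_def)
  with le[of q] q \<open>a \<le> t\<close> show False by (auto simp: dist_real_def)
qed

text \<open>A strict bound at rational times does not give a strict bound at all times. Together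
  with the limit 0, however, the supremum is below \<open>\<delta>\<close>, so a rational d fits in
  between, and \<open>u t \<le> d\<close> may be tested at rational times.\<close>

lemma uniform_below_and_tendsto_0_rational:
  fixes u :: "real \<Rightarrow> real"
  assumes cont: "continuous_on {0..} u" and nn: "\<And>t. 0 \<le> u t" and "0 < \<delta>"
  shows "(\<forall>t\<ge>0. u t < \<delta>) \<and> (u \<longlongrightarrow> 0) at_top \<longleftrightarrow>
    (\<exists>d\<in>\<rat>. d < \<delta> \<and> (\<forall>t\<in>\<rat> \<inter> {0..}. u t \<le> d)) \<and>
    (\<forall>k::nat. \<exists>N::nat. \<forall>t\<in>\<rat> \<inter> {real N..}. u t \<le> 1 / real (Suc k))" (is "?L \<longleftrightarrow> ?R")
proof
  assume L: ?L
  have ev: "\<exists>N::nat. \<forall>t\<ge>real N. u t < e" if "0 < e" for e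
  proof -
    have "\<forall>\<^sub>F t in at_top. u t < e" using L that nn by (auto simp: tendsto_iff dist_real_def)
    then obtain T where T: "\<And>t. T \<le> t \<Longrightarrow> u t < e" by (auto simp: eventually_at_top_linorder)
    obtain N :: nat where "T \<le> real N" using real_arch_simple by blast
    with T show ?thesis by (intro exI[of _ N]) auto
  qed
  obtain N where N: "\<And>t. real N \<le> t \<Longrightarrow> u t < \<delta> / 2" using ev[of "\<delta> / 2"] \<open>0 < \<delta>\<close> by auto
  have "continuous_on {0..real N} u" by (rule continuous_on_subset[OF cont]) auto
  then obtain s where s: "s \<in> {0..real N}" "\<And>t. t \<in> {0..real N} \<Longrightarrow> u t \<le> u s"
    using continuous_attains_sup[of "{0..real N}" u] by auto
  have "max (u s) (\<delta> / 2) < \<delta>" using L s(1) \<open>0 < \<delta>\<close> by auto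
  then obtain d where d: "d \<in> \<rat>" "max (u s) (\<delta> / 2) < d" "d < \<delta>"
    using Rats_dense_in_real by blast
  have "u t \<le> d" if "0 \<le> t" for t
    using s(2)[of t] N[of t] d that by (cases "t \<le> real N") auto
  with d have "\<exists>d\<in>\<rat>. d < \<delta> \<and> (\<forall>t\<in>\<rat> \<inter> {0..}. u t \<le> d)" by auto
  moreover have "\<exists>N::nat. \<forall>t\<in>\<rat> \<inter> {real N..}. u t \<le> 1 / real (Suc k)" for k
    using ev[of "1 / real (Suc k)"] by (auto intro: less_imp_le)
  ultimately show ?R by blast
next
  assume R: ?R
  then obtain d where d: "d < \<delta>" "\<And>t. t \<in> \<rat> \<Longrightarrow> 0 \<le> t \<Longrightarrow> u t \<le> d" by auto
  have 1: "u t < \<delta>" if "0 \<le> t" for t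
    using continuous_le_if_rational_le[OF cont order_refl d(2) that] d(1) by simp
  have "(u \<longlongrightarrow> 0) at_top"
  proof (rule tendstoI)
    fix e :: real assume "0 < e"
    then obtain k :: nat where k: "1 / real (Suc k) < e" using nat_approx_posE by blast
    obtain N :: nat where "\<forall>t\<in>\<rat> \<inter> {real N..}. u t \<le> 1 / real (Suc k)" using R by blast
    then have N: "\<And>t. t \<in> \<rat> \<Longrightarrow> real N \<le> t \<Longrightarrow> u t \<le> 1 / real (Suc k)" by blast
    have "u t < e" if "real N \<le> t" for t
      using continuous_le_if_rational_le[OF cont _ N that] k by simp
    then show "\<forall>\<^sub>F t in at_top. dist (u t) 0 < e"
      unfolding eventually_at_top_linorder using nn by (intro exI[of _ "real N"]) (auto simp: dist_real_def)
  qed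
  with 1 show ?L by blast
qed

definition itin_words :: "transition list \<Rightarrow> (nat \<Rightarrow> 5) set" where
  "itin_words r = {m. \<exists>w. word_of m w \<and> eventually_periodic w r}"

lemma word_of_step: "word_of m w \<Longrightarrow> m (Suc n) = m n + (case w n of Type_A \<Rightarrow> 1 | Type_B \<Rightarrow> 3)"
  unfolding word_of_def by (metis diff_eq_eq add.commute transition.simps(3,4))

lemma word_of_neq: "word_of m w \<Longrightarrow> m (Suc n) \<noteq> m n"
  using word_of_step[of m w n] by (auto split: transition.splits)

text \<open>An index sequence is determined by N and its first N + 2 entries, because beyond N the
  word is fixed by the root sequence. Nonemptiness of r makes the step back by one period possible;
  for an empty r every word would qualify.\<close>

lemma countable_itin_words:
  assumes "1 \<le> length r"
  shows "countable (itin_words r)"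
proof -
  define A where "A N = {m. \<exists>w. word_of m w \<and> (\<forall>n>N. w (n + length r) = w n) \<and>
      (\<forall>j\<in>{1..length r}. w (N + j) = r ! (j - 1))}" for N
  have "countable (A N)" for N
  proof (rule countable_image_inj_on)
    show "countable ((\<lambda>m. map m [0..<N + 2]) ` A N)" by simp
    show "inj_on (\<lambda>m. map m [0..<N + 2]) (A N)"
    proof (rule inj_onI)
      fix m m' assume "m \<in> A N" "m' \<in> A N" and eq: "map m [0..<N + 2] = map m' [0..<N + 2]"
      then obtain w w' where w: "word_of m w" "\<forall>n>N. w (n + length r) = w n"
          "\<forall>j\<in>{1..length r}. w (N + j) = r ! (j - 1)"
        and w': "word_of m' w'" "\<forall>n>N. w' (n + length r) = w' n"
          "\<forall>j\<in>{1..length r}. w' (N + j) = r ! (j - 1)"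
        unfolding A_def by blast
      have ww: "w n = w' n" if "N < n" for n
        using that
      proof (induction n rule: less_induct)
        case (less n)
        show ?case
        proof (cases "n \<le> N + length r")
          case True
          then have "n - N \<in> {1..length r}" using less.prems by auto
          then have "w (N + (n - N)) = w' (N + (n - N))" using w(3) w'(3) by metis
          then show ?thesis using less.prems by simp
        next
          case False
          then have "N < n - length r" "n - length r < n" "n - length r + length r = n"
            using assms by auto
          with less.IH w(2) w'(2) show ?thesis by metis
        qed
      qed
      have "m n = m' n" for n
      proof (induction n)
        case 0
        show ?case using arg_cong[OF eq, of "\<lambda>l. l ! 0"] by (simp del: upt_Suc)
      next
        case (Suc n)
        show ?case
        proof (cases "Suc n < N + 2")
          case True
          then show ?thesis using arg_cong[OF eq, of "\<lambda>l. l ! Suc n"] by (simp del: upt_Suc)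
        next
          case False
          then show ?thesis
            using word_of_step[OF w(1), of n] word_of_step[OF w'(1), of n] Suc ww[of n] by simp
        qed
      qed
      then show "m = m'" by auto
    qed
  qed
  then have "countable (\<Union>N. A N)" by simp
  moreover have "itin_words r \<subseteq> (\<Union>N. A N)"
    unfolding itin_words_def A_def eventually_periodic_def by blast
  ultimately show ?thesis by (rule countable_subset[rotated])
qed

context lotka_volterra
begin

section \<open>Uniqueness, domain and measurability of the flow\<close>

lemma sol_bounded:
  assumes "sol T f" "{a..b} \<subseteq> T"
  obtains R :: nat where "\<And>t. t \<in> {a..b} \<Longrightarrow> norm (f t) \<le> real R"
proof -
  have "compact (f ` {a..b})"
    by (intro compact_continuous_image continuous_on_subset[OF solution_on_continuous[OF assms(1)] assms(2)]) auto
  then obtain B where "\<And>x. x \<in> f ` {a..b} \<Longrightarrow> norm x \<le> B"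
    using compact_imp_bounded bounded_iff by metis
  moreover obtain R :: nat where "B \<le> real R" using real_arch_simple by blast
  ultimately show thesis using that[of R] by force
qed

lemma sol_unique:
  assumes "sol {0..T} f" "sol {0..T} g" "f 0 = g 0" "t \<in> {0..T}"
  shows "f t = g t"
proof -
  obtain R1 :: nat where R1: "\<And>t. t \<in> {0..T} \<Longrightarrow> norm (f t) \<le> real R1" using sol_bounded[OF assms(1) order_refl] by blast
  obtain R2 :: nat where R2: "\<And>t. t \<in> {0..T} \<Longrightarrow> norm (g t) \<le> real R2" using sol_bounded[OF assms(2) order_refl] by blast
  have "norm (f t - g t) \<le> exp (lipV (real (max R1 R2)) * (T - 0)) * norm (f 0 - g 0)"
    by (rule sol_dist[OF assms(1) order_trans[OF R1] assms(2) order_trans[OF R2]])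
      (use assms(4) in auto)
  with assms(3) show ?thesis by simp
qed

lemma sol_unique_infinite:
  assumes "sol {0..} f" "sol {0..} g" "f 0 = g 0" "0 \<le> t"
  shows "f t = g t"
  by (rule sol_unique[of t])
    (use assms in \<open>auto elim: solution_on_subset\<close>)

text \<open>Solutions may blow up, so the set of points with a global forward solution is assembled
  from these pieces. The bound R gives a uniform Lipschitz constant, hence closed pieces with
  continuous dependence.\<close>

definition Kset :: "nat \<Rightarrow> nat \<Rightarrow> (real ^ 5) set" where
  "Kset n R = {x. \<exists>f. sol {0..real n} f \<and> f 0 = x \<and> (\<forall>t\<in>{0..real n}. norm (f t) \<le> real R)}"

definition Dom :: "(real ^ 5) set" where
  "Dom = {x. \<exists>f. sol {0..} f \<and> f 0 = x}"

lemma closed_Kset: "closed (Kset n R)"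
  unfolding closed_sequential_limits
proof (intro allI impI)
  fix x l assume "(\<forall>i. x i \<in> Kset n R) \<and> x \<longlonglongrightarrow> l"
  then have l: "x \<longlonglongrightarrow> l" and "\<forall>i. x i \<in> Kset n R" by auto
  then obtain f where f: "\<And>i. sol {0..real n} (f i)" "\<And>i. f i 0 = x i"
    "\<And>i t. t \<in> {0..real n} \<Longrightarrow> norm (f i t) \<le> real R"
    unfolding Kset_def mem_Collect_eq by metis
  define g where "g t = lim (\<lambda>i. f i t)" for t
  have l0: "(\<lambda>i. f i 0) \<longlonglongrightarrow> l" using l f(2) by simp
  have g: "sol {0..real n} g" "\<And>t. t \<in> {0..real n} \<Longrightarrow> (\<lambda>i. f i t) \<longlonglongrightarrow> g t"
    using sol_limit[where a = 0 and b = "real n" and c = 0 and f = f and R = "real R" and x = l and g = g]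
      f(1,3) l0 by (auto simp: g_def)
  have "norm (g t) \<le> real R" if "t \<in> {0..real n}" for t
    by (rule LIMSEQ_le_const2[OF tendsto_norm[OF g(2)[OF that]]]) (use f(3) that in auto)
  moreover have "g 0 = l" using LIMSEQ_unique[OF g(2) l0] by simp
  ultimately show "l \<in> Kset n R" using g(1) unfolding Kset_def by auto
qed

text \<open>Solutions on all \<open>{0..real n}\<close> glue together by uniqueness; the converse is
  boundedness on compact intervals.\<close>

lemma Dom_eq: "Dom = (\<Inter>n. \<Union>R. Kset n R)"
proof
  show "Dom \<subseteq> (\<Inter>n. \<Union>R. Kset n R)"
  proof
    fix x assume "x \<in> Dom"
    then obtain f where f: "sol {0..} f" "f 0 = x" unfolding Dom_def by auto
    show "x \<in> (\<Inter>n. \<Union>R. Kset n R)"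
    proof
      fix n
      obtain R :: nat where "\<And>t. t \<in> {0..real n} \<Longrightarrow> norm (f t) \<le> real R"
        using sol_bounded[OF f(1)] by (metis atLeastatMost_subset_iff atLeast_iff order_refl subsetI atLeastAtMost_iff)
      moreover have "sol {0..real n} f" by (rule solution_on_subset[OF f(1)]) auto
      ultimately show "x \<in> (\<Union>R. Kset n R)" using f(2) unfolding Kset_def by blast
    qed
  qed
  show "(\<Inter>n. \<Union>R. Kset n R) \<subseteq> Dom"
  proof
    fix x assume "x \<in> (\<Inter>n. \<Union>R. Kset n R)"
    then have "\<forall>n. \<exists>f. sol {0..real n} f \<and> f 0 = x" unfolding Kset_def by blast
    then obtain f where f: "\<And>n. sol {0..real n} (f n)" "\<And>n. f n 0 = x" by metis
    have eq: "f n t = f k t" if "0 \<le> t" "t \<le> real n" "t \<le> real k" for n k t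
      by (rule sol_unique[OF solution_on_subset[OF f(1)] solution_on_subset[OF f(1)], of t])
        (use f(2) that in auto)
    define g where "g t = f (nat \<lceil>t\<rceil>) t" for t
    have g: "f n t = g t" if "t \<in> {0..real n}" for n t
      unfolding g_def using that by (intro eq) auto
    have gs: "sol {0..real n} g" for n
      by (rule solution_on_cong[OF f(1) g])
    have "sol {0..} g"
      unfolding solution_on_def
    proof
      fix t :: real assume "t \<in> {0..}"
      obtain n :: nat where n: "t < real n" using reals_Archimedean2 by blast
      with gs[of n] \<open>t \<in> {0..}\<close> have "(g has_vector_derivative V (g t)) (at t within {0..real n})"
        by (auto simp: solution_on_def)
      then show "(g has_vector_derivative V (g t)) (at t within {0..})"
        using at_within_Icc_atLeast[OF n] by simp
    qed
    moreover have "g 0 = x" unfolding g_def using f(2) by simp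
    ultimately show "x \<in> Dom" unfolding Dom_def by blast
  qed
qed

lemma Dom_borel [measurable]: "Dom \<in> sets borel"
  unfolding Dom_eq by (intro sets.countable_INT'' sets.countable_UN'' borel_closed closed_Kset) auto

text \<open>Choice is harmless by uniqueness of forward solutions; the value 0 outside
  \<open>Dom\<close> makes measurability on the whole space meaningful.\<close>

definition flow :: "real \<Rightarrow> real ^ 5 \<Rightarrow> real ^ 5" where
  "flow t x = (if x \<in> Dom then (SOME f. sol {0..} f \<and> f 0 = x) t else 0)"

lemma flow:
  assumes "x \<in> Dom"
  shows "sol {0..} (\<lambda>t. flow t x)" "flow 0 x = x"
proof -
  have "\<exists>f. sol {0..} f \<and> f 0 = x" using assms by (simp add: Dom_def)
  from someI_ex[OF this] show "sol {0..} (\<lambda>t. flow t x)" "flow 0 x = x"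
    using assms by (simp_all add: flow_def)
qed

lemma flow_eqI: "sol {0..} f \<Longrightarrow> f 0 = x \<Longrightarrow> 0 \<le> t \<Longrightarrow> f t = flow t x"
proof -
  assume f: "sol {0..} f" "f 0 = x" "0 \<le> t"
  then have "x \<in> Dom" unfolding Dom_def by blast
  from sol_unique_infinite[OF f(1) flow(1)[OF this]] flow(2)[OF this] f show ?thesis by simp
qed

lemma flow_bounded_on_Kset:
  assumes "x \<in> Dom" "x \<in> Kset n R" "t \<in> {0..real n}"
  shows "norm (flow t x) \<le> real R"
proof -
  obtain f where f: "sol {0..real n} f" "f 0 = x" "\<And>t. t \<in> {0..real n} \<Longrightarrow> norm (f t) \<le> real R"
    using assms(2) unfolding Kset_def by auto
  have "sol {0..real n} (\<lambda>t. flow t x)" by (rule solution_on_subset[OF flow(1)[OF assms(1)]]) auto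
  from sol_unique[OF this f(1) _ assms(3)] flow(2)[OF assms(1)] f show ?thesis using assms(3) by simp
qed

text \<open>The map is constant off \<open>Dom\<close> and Lipschitz on each of the countably many
  Borel pieces \<open>Dom \<inter> Kset n R\<close>.\<close>

lemma flow_measurable [measurable]:
  assumes "0 \<le> t"
  shows "flow t \<in> borel_measurable borel"
proof -
  obtain n :: nat where n: "t \<le> real n" using real_arch_simple by blast
  define C where "C = insert (- Dom) (range (\<lambda>R. Dom \<inter> Kset n R))"
  show ?thesis
  proof (rule measurable_piecewise_restrict[of C])
    show "countable C" unfolding C_def by simp
    show "\<Omega> \<inter> space borel \<in> sets borel" if "\<Omega> \<in> C" for \<Omega>
      using that closed_Kset[THEN borel_closed] unfolding C_def by auto
    show "space borel \<subseteq> \<Union> C" unfolding C_def using Dom_eq by auto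
    fix \<Omega> assume "\<Omega> \<in> C"
    then consider "\<Omega> = - Dom" | R where "\<Omega> = Dom \<inter> Kset n R" unfolding C_def by auto
    then show "flow t \<in> borel_measurable (restrict_space borel \<Omega>)"
    proof cases
      case 1
      then show ?thesis
        by (intro borel_measurable_continuous_on_restrict continuous_on_eq[OF continuous_on_const[of _ 0]])
          (auto simp: flow_def)
    next
      case 2
      have "continuous_on \<Omega> (flow t)"
      proof (rule lipschitz_on_continuous_on[of "exp (lipV (real R) * (real n - 0))"], rule lipschitz_onI)
        fix x y assume xy: "x \<in> \<Omega>" "y \<in> \<Omega>"
        then have D: "x \<in> Dom" "y \<in> Dom" using 2 by auto
        have "norm (flow t x - flow t y) \<le> exp (lipV (real R) * (real n - 0)) * norm (flow 0 x - flow 0 y)"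
        proof (rule sol_dist)
          show "sol {0..real n} (\<lambda>t. flow t x)" "sol {0..real n} (\<lambda>t. flow t y)"
            using flow(1)[OF D(1)] flow(1)[OF D(2)] by (auto elim!: solution_on_subset)
        qed (use xy 2 flow_bounded_on_Kset assms n in auto)
        then show "dist (flow t x) (flow t y) \<le> exp (lipV (real R) * (real n - 0)) * dist x y"
          using flow(2) D by (simp add: dist_norm)
      qed simp
      then show ?thesis by (rule borel_measurable_continuous_on_restrict)
    qed
  qed
qed

lemma visits_measurable:
  assumes "a \<in> \<rat>" "0 \<le> a"
  shows "{x \<in> Dom. visits H (\<lambda>t. flow t x) a b k} \<in> sets borel"
proof -
  have "{x \<in> Dom. visits H (\<lambda>t. flow t x) a b k} =
      Dom \<inter> (\<Inter>i. \<Union>s\<in>\<rat> \<inter> {a..b}. {x. dist (flow s x) (\<xi> k) < H + 1 / real (Suc i)})"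
    using visits_rational[OF solution_on_continuous[OF flow(1)] assms, of _ H b k] by auto
  also have "\<dots> \<in> sets borel"
  proof -
    have S: "{x. dist (flow s x) (\<xi> k) < H + 1 / real (Suc i)} \<in> sets borel" if "s \<in> \<rat> \<inter> {a..b}" for i s
    proof -
      have "0 \<le> s" using assms that by auto
      note [measurable] = flow_measurable[OF this]
      have "{x \<in> space borel. dist (flow s x) (\<xi> k) < H + 1 / real (Suc i)} \<in> sets borel"
        by measurable
      then show ?thesis by simp
    qed
    have "(\<Union>s\<in>\<rat> \<inter> {a..b}. {x. dist (flow s x) (\<xi> k) < H + 1 / real (Suc i)}) \<in> sets borel" for i
      using S by (intro borel_UN countable_Int1 countable_rat)
    then show ?thesis by (intro sets.Int Dom_borel borel_INT) auto
  qed
  finally show ?thesis .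
qed

lemma visits_only_measurable:
  assumes "a \<in> \<rat>" "0 \<le> a"
  shows "{x \<in> Dom. visits_only H (\<lambda>t. flow t x) a b k} \<in> sets borel"
proof -
  have "{x \<in> Dom. visits_only H (\<lambda>t. flow t x) a b k} =
      Dom - (\<Union>j\<in>- {k}. {x \<in> Dom. visits H (\<lambda>t. flow t x) a b j})"
    unfolding visits_only_def by auto
  also have "\<dots> \<in> sets borel"
    by (intro sets.Diff Dom_borel sets.finite_UN visits_measurable assms) auto
  finally show ?thesis .
qed

lemma reached_measurable:
  "t \<in> \<rat> \<Longrightarrow> {x \<in> Dom. reached H (\<lambda>t. flow t x) m n t} \<in> sets borel"
proof (induction n arbitrary: t)
  case 0
  have "{x \<in> Dom. reached H (\<lambda>t. flow t x) m 0 t} =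
      {x \<in> Dom. visits_only H (\<lambda>t. flow t x) 0 t (m 0)} \<inter> {x \<in> Dom. visits H (\<lambda>t. flow t x) 0 t (m 0)}"
    by auto
  also have "\<dots> \<in> sets borel" by (intro sets.Int visits_only_measurable visits_measurable) auto
  finally show ?case .
next
  case (Suc n)
  have "{x \<in> Dom. reached H (\<lambda>t. flow t x) m (Suc n) t} =
      (\<Union>q\<in>\<rat> \<inter> {0..t}. {x \<in> Dom. reached H (\<lambda>t. flow t x) m n q} \<inter>
        {x \<in> Dom. visits_only H (\<lambda>t. flow t x) q t (m (Suc n))} \<inter>
        {x \<in> Dom. visits H (\<lambda>t. flow t x) q t (m (Suc n))})"
    by auto
  also have "\<dots> \<in> sets borel"
  proof (rule borel_UN)
    show "countable (\<rat> \<inter> {0..t})" by (intro countable_Int1 countable_rat)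
    fix q assume "q \<in> \<rat> \<inter> {0..t}"
    then have "q \<in> \<rat>" "0 \<le> q" by auto
    then show "{x \<in> Dom. reached H (\<lambda>t. flow t x) m n q} \<inter>
        {x \<in> Dom. visits_only H (\<lambda>t. flow t x) q t (m (Suc n))} \<inter>
        {x \<in> Dom. visits H (\<lambda>t. flow t x) q t (m (Suc n))} \<in> sets borel"
      by (intro sets.Int visits_only_measurable visits_measurable Suc.IH)
  qed
  finally show ?case .
qed

text \<open>Every uncountable quantifier disappears: the solution becomes \<open>flow\<close>, index
  sequences range over the countable set \<open>itin_words r\<close>, epochs are encoded by
  \<open>reached\<close>, and conditions for all times are tested at rational ones.\<close>

lemma local_basin_iff:
  assumes H: "H < sqrt 2 / 2" and "0 < \<delta>"
  shows "x \<in> local_basin cA cB eA eB H \<delta> r \<longleftrightarrow> x \<in> orthant \<and> x \<in> Dom \<and>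
    (\<exists>m\<in>itin_words r. \<forall>n. \<exists>t\<in>\<rat>. reached H (\<lambda>t. flow t x) m n t) \<and>
    (\<exists>d\<in>\<rat>. d < \<delta> \<and> (\<forall>t\<in>\<rat> \<inter> {0..}. infdist (flow t x) \<Sigma> \<le> d)) \<and>
    (\<forall>k::nat. \<exists>N::nat. \<forall>t\<in>\<rat> \<inter> {real N..}. infdist (flow t x) \<Sigma> \<le> 1 / real (Suc k))"
proof -
  define P where "P f \<longleftrightarrow> (\<exists>m \<tau> w. itinerary H f m \<tau> \<and> word_of m w \<and> eventually_periodic w r) \<and>
        (\<forall>t\<ge>0. infdist (f t) \<Sigma> < \<delta>) \<and> ((\<lambda>t. infdist (f t) \<Sigma>) \<longlongrightarrow> 0) at_top" for f
  define Q where "Q f \<longleftrightarrow> (\<exists>m\<in>itin_words r. \<forall>n. \<exists>t\<in>\<rat>. reached H f m n t) \<and>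
    (\<exists>d\<in>\<rat>. d < \<delta> \<and> (\<forall>t\<in>\<rat> \<inter> {0..}. infdist (f t) \<Sigma> \<le> d)) \<and>
    (\<forall>k::nat. \<exists>N::nat. \<forall>t\<in>\<rat> \<inter> {real N..}. infdist (f t) \<Sigma> \<le> 1 / real (Suc k))" for f
  have PQ: "P f \<longleftrightarrow> Q f" if f: "sol {0..} f" for f
  proof -
    have cont: "continuous_on {0..} f" by (rule solution_on_continuous[OF f])
    interpret trajectory H f by unfold_locales (use H cont in auto)
    have "(\<exists>m \<tau> w. itinerary H f m \<tau> \<and> word_of m w \<and> eventually_periodic w r)
        \<longleftrightarrow> (\<exists>m\<in>itin_words r. \<exists>\<tau>. itinerary H f m \<tau>)"
      unfolding itin_words_def by blast
    also have "\<dots> \<longleftrightarrow> (\<exists>m\<in>itin_words r. \<forall>n. \<exists>t\<in>\<rat>. reached H f m n t)"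
      by (intro bex_cong refl ex_itinerary_iff) (auto simp: itin_words_def word_of_neq)
    finally show ?thesis
      unfolding P_def Q_def
      using uniform_below_and_tendsto_0_rational[OF continuous_on_infdist[OF cont] infdist_nonneg \<open>0 < \<delta>\<close>]
      by (simp only: conj_assoc)
  qed
  have Qc: "Q f \<longleftrightarrow> Q g" if "\<And>t. 0 \<le> t \<Longrightarrow> f t = g t" for f g
  proof -
    have "(\<exists>m\<in>itin_words r. \<forall>n. \<exists>t\<in>\<rat>. reached H f m n t) \<longleftrightarrow> (\<exists>m\<in>itin_words r. \<forall>n. \<exists>t\<in>\<rat>. reached H g m n t)"
      using reached_cong[OF that] by simp
    moreover have "(\<forall>t\<in>\<rat> \<inter> {0..}. infdist (f t) \<Sigma> \<le> d) \<longleftrightarrow> (\<forall>t\<in>\<rat> \<inter> {0..}. infdist (g t) \<Sigma> \<le> d)" for d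
      using that by auto
    moreover have "(\<forall>t\<in>\<rat> \<inter> {real N..}. infdist (f t) \<Sigma> \<le> d) \<longleftrightarrow> (\<forall>t\<in>\<rat> \<inter> {real N..}. infdist (g t) \<Sigma> \<le> d)" for d and N :: nat
    proof (rule ball_cong[OF refl])
      fix t assume "t \<in> \<rat> \<inter> {real N..}"
      then have "0 \<le> t" using of_nat_0_le_iff[of N] by (auto intro: order_trans)
      then show "(infdist (f t) \<Sigma> \<le> d) = (infdist (g t) \<Sigma> \<le> d)" using that by simp
    qed
    ultimately show ?thesis unfolding Q_def by simp
  qed
  have "x \<in> local_basin cA cB eA eB H \<delta> r \<longleftrightarrow> x \<in> orthant \<and> (\<exists>f. sol {0..} f \<and> f 0 = x \<and> P f)"
    unfolding local_basin_def P_def by blast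
  also have "\<dots> \<longleftrightarrow> x \<in> orthant \<and> x \<in> Dom \<and> Q (\<lambda>t. flow t x)"
  proof safe
    fix f assume f: "sol {0..} f" "P f" "x = f 0"
    show "f 0 \<in> Dom" using f(1) unfolding Dom_def by blast
    have "Q f" using PQ f by simp
    moreover have "Q f \<longleftrightarrow> Q (\<lambda>t. flow t (f 0))"
      by (rule Qc) (rule flow_eqI[OF f(1) refl])
    ultimately show "Q (\<lambda>t. flow t (f 0))" by blast
  next
    assume "x \<in> Dom" "Q (\<lambda>t. flow t x)"
    then show "\<exists>f. sol {0..} f \<and> f 0 = x \<and> P f"
      using flow[of x] PQ[of "\<lambda>t. flow t x"] by blast
  qed
  finally show ?thesis unfolding Q_def .
qed

lemma local_basin_borel:
  assumes "H < sqrt 2 / 2" "0 < \<delta>" "1 \<le> length r"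
  shows "local_basin cA cB eA eB H \<delta> r \<in> sets borel"
proof -
  have O: "orthant \<in> sets borel"
  proof -
    have "orthant = (\<Inter>j. {x :: real ^ 5. 0 \<le> x $ j})" by (auto simp: orthant_def)
    moreover have "closed \<dots>"
      by (intro closed_INT ballI closed_Collect_le continuous_intros)
    ultimately show ?thesis by (metis borel_closed)
  qed
  have I: "{x. infdist (flow t x) \<Sigma> \<le> d} \<in> sets borel" if "0 \<le> t" for t d
  proof -
    note [measurable] = flow_measurable[OF that]
    have [measurable]: "(\<lambda>y. infdist y \<Sigma>) \<in> borel_measurable borel"
      by (intro borel_measurable_continuous_onI continuous_intros)
    have "{x \<in> space borel. infdist (flow t x) \<Sigma> \<le> d} \<in> sets borel" by measurable
    then show ?thesis by simp
  qed
  have J: "(\<Inter>t\<in>\<rat> \<inter> {a..}. {x. infdist (flow t x) \<Sigma> \<le> d}) \<in> sets borel" if "0 \<le> a" for a d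
    using that by (intro borel_INT I countable_Int1 countable_rat) auto
  have "local_basin cA cB eA eB H \<delta> r = orthant \<inter> Dom \<inter>
      (\<Union>m\<in>itin_words r. \<Inter>n. \<Union>t\<in>\<rat>. {x \<in> Dom. reached H (\<lambda>t. flow t x) m n t}) \<inter>
      (\<Union>d\<in>\<rat> \<inter> {..<\<delta>}. \<Inter>t\<in>\<rat> \<inter> {0..}. {x. infdist (flow t x) \<Sigma> \<le> d}) \<inter>
      (\<Inter>k. \<Union>N::nat. \<Inter>t\<in>\<rat> \<inter> {real N..}. {x. infdist (flow t x) \<Sigma> \<le> 1 / real (Suc k)})"
    (is "_ = ?A \<inter> ?B \<inter> ?C \<inter> ?D \<inter> ?E")
  proof (rule Set.set_eqI)
    fix x
    show "x \<in> local_basin cA cB eA eB H \<delta> r \<longleftrightarrow> x \<in> ?A \<inter> ?B \<inter> ?C \<inter> ?D \<inter> ?E"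
      unfolding local_basin_iff[OF assms(1,2)] by auto
  qed
  also have "\<dots> \<in> sets borel"
  proof (intro sets.Int O Dom_borel)
    show "?C \<in> sets borel"
      by (intro borel_UN borel_INT countable_itin_words[OF assms(3)] countable_rat reached_measurable) auto
    show "?D \<in> sets borel"
      by (intro borel_UN J countable_Int1 countable_rat) auto
    show "?E \<in> sets borel"
      by (intro borel_UN borel_INT J) auto
  qed
  finally show ?thesis .
qed

end

section \<open>Powers of a matrix with a dominant eigenvalue\<close>

text \<open>A rate strictly below 1, and not mere convergence to 0, lets such sequences be summed
  with a remainder of the same kind.\<close>

definition geo :: "(nat \<Rightarrow> complex) \<Rightarrow> bool" where
  "geo z \<longleftrightarrow> (\<exists>C r. 0 \<le> C \<and> 0 \<le> r \<and> r < 1 \<and> (\<forall>n. cmod (z n) \<le> C * r ^ n))"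

lemma geo_add:
  assumes "geo x" "geo y"
  shows "geo (\<lambda>n. x n + y n)"
proof -
  obtain C r D s where x: "0 \<le> C" "0 \<le> r" "r < 1" "\<And>n. cmod (x n) \<le> C * r ^ n"
    and y: "0 \<le> D" "0 \<le> s" "s < 1" "\<And>n. cmod (y n) \<le> D * s ^ n"
    using assms unfolding geo_def by blast
  have "cmod (x n + y n) \<le> (C + D) * (max r s) ^ n" for n
  proof -
    have "cmod (x n + y n) \<le> C * r ^ n + D * s ^ n"
      using norm_triangle_ineq[of "x n" "y n"] x(4)[of n] y(4)[of n] by linarith
    also have "\<dots> \<le> C * (max r s) ^ n + D * (max r s) ^ n"
      using x y by (intro add_mono mult_left_mono power_mono) auto
    finally show ?thesis by (simp add: algebra_simps)
  qed
  moreover have "0 \<le> C + D" "0 \<le> max r s" "max r s < 1" using x y by auto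
  ultimately show ?thesis unfolding geo_def by blast
qed

lemma geo_cmult:
  assumes "geo x"
  shows "geo (\<lambda>n. c * x n)"
proof -
  obtain C r where x: "0 \<le> C" "0 \<le> r" "r < 1" "\<And>n. cmod (x n) \<le> C * r ^ n"
    using assms unfolding geo_def by blast
  have "cmod (c * x n) \<le> (cmod c * C) * r ^ n" for n
    unfolding norm_mult using mult_left_mono[OF x(4)[of n], of "cmod c"] by (simp add: mult.assoc)
  moreover have "0 \<le> cmod c * C" using x by simp
  ultimately show ?thesis unfolding geo_def using x by blast
qed

lemma geo_0: "geo (\<lambda>_. 0)"
  unfolding geo_def by (intro exI[of _ 0]) auto

lemma geo_tendsto_0: "geo x \<Longrightarrow> x \<longlonglongrightarrow> 0"
  unfolding geo_def
proof (elim exE conjE)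
  fix C r :: real assume "0 \<le> C" "0 \<le> r" "r < 1" and le: "\<forall>n. cmod (x n) \<le> C * r ^ n"
  have "(\<lambda>n. C * r ^ n) \<longlonglongrightarrow> C * 0"
    using \<open>0 \<le> r\<close> \<open>r < 1\<close> by (intro tendsto_intros LIMSEQ_power_zero) auto
  then have "(\<lambda>n. C * r ^ n) \<longlonglongrightarrow> 0" by simp
  then show "x \<longlonglongrightarrow> 0" by (rule Lim_null_comparison[rotated]) (use le in auto)
qed

lemma geo_step:
  assumes rec: "\<And>n. x (Suc n) = \<mu> * x n + z n" and \<mu>: "cmod \<mu> < 1" and "geo z"
  shows "geo x"
proof -
  obtain C r where z: "0 \<le> C" "0 \<le> r" "r < 1" "\<And>n. cmod (z n) \<le> C * r ^ n"
    using \<open>geo z\<close> unfolding geo_def by blast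
  define q where "q = max r (cmod \<mu>)"
  \<comment> \<open>A rate strictly above q leaves room for the factor n that appears when r and
    \<open>cmod \<mu>\<close> coincide.\<close>
  obtain s where s: "q < s" "s < 1" using dense[of q 1] z \<mu> unfolding q_def by auto
  have q: "0 \<le> q" "r \<le> q" "cmod \<mu> \<le> q" using z by (auto simp: q_def)
  define D where "D = cmod (x 0) + C / (s - q)"
  have "D * (s - q) = cmod (x 0) * (s - q) + C" using s by (simp add: D_def distrib_right)
  then have D: "0 \<le> D" "C \<le> D * (s - q)" using z s by (auto simp: D_def)
  have "cmod (x n) \<le> D * s ^ n" for n
  proof (induction n)
    case 0
    show ?case using z s by (simp add: D_def)
  next
    case (Suc n)
    have "cmod (x (Suc n)) \<le> cmod \<mu> * cmod (x n) + cmod (z n)"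
      unfolding rec by (metis norm_mult norm_triangle_ineq)
    also have "\<dots> \<le> q * (D * s ^ n) + C * s ^ n"
    proof (rule add_mono)
      show "cmod \<mu> * cmod (x n) \<le> q * (D * s ^ n)" using Suc q by (intro mult_mono) auto
      have "C * r ^ n \<le> C * s ^ n" using z q s by (intro mult_left_mono power_mono) auto
      with z(4)[of n] show "cmod (z n) \<le> C * s ^ n" by linarith
    qed
    also have "\<dots> \<le> q * (D * s ^ n) + D * (s - q) * s ^ n"
      using D q s by (intro add_left_mono mult_right_mono) auto
    also have "\<dots> = D * s ^ Suc n" by (simp add: algebra_simps)
    finally show ?case .
  qed
  moreover have "0 \<le> s" using q s by linarith
  ultimately show ?thesis unfolding geo_def using D(1) s(2) by blast
qed

lemma geo_sum:
  assumes rec: "\<And>n. x (Suc n) = x n + z n" and "geo z"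
  shows "\<exists>a. geo (\<lambda>n. x n - a)"
proof -
  obtain C r where z: "0 \<le> C" "0 \<le> r" "r < 1" "\<And>n. cmod (z n) \<le> C * r ^ n"
    using \<open>geo z\<close> unfolding geo_def by blast
  have sm: "summable (\<lambda>n. C * r ^ n)"
    using z by (intro summable_mult summable_geometric) auto
  then have sz: "summable z" by (rule summable_comparison_test'[where N = 0]) (use z in auto)
  have x: "x n = x 0 + (\<Sum>i<n. z i)" for n by (induction n) (auto simp: rec)
  have "cmod (x n - (x 0 + suminf z)) \<le> (C / (1 - r)) * r ^ n" for n
  proof -
    have "x n - (x 0 + suminf z) = - (\<Sum>i. z (i + n))"
      using suminf_minus_initial_segment[OF sz, of n] by (simp add: x[of n])
    then have "cmod (x n - (x 0 + suminf z)) = cmod (\<Sum>i. z (i + n))" by simp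
    also have "\<dots> \<le> (\<Sum>i. C * r ^ n * r ^ i)"
    proof (rule norm_suminf_le)
      show "cmod (z (i + n)) \<le> C * r ^ n * r ^ i" for i
        using z(4)[of "i + n"] by (simp add: power_add mult_ac)
      show "summable (\<lambda>i. C * r ^ n * r ^ i)"
        using z by (intro summable_mult summable_geometric) auto
    qed
    also have "\<dots> = C * r ^ n * (1 / (1 - r))"
      using z by (subst suminf_mult) (auto simp: suminf_geometric intro!: summable_geometric)
    finally show ?thesis by simp
  qed
  moreover have "0 \<le> C / (1 - r)" using z by simp
  ultimately have "geo (\<lambda>n. x n - (x 0 + suminf z))" unfolding geo_def using z by blast
  then show ?thesis by blast
qed

text \<open>A quadratic polynomial in the index plus a geometrically decaying error: the form of
  a normalised matrix power when the dominant eigenvalue has algebraic multiplicity at most 3.\<close>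

definition quad :: "complex \<Rightarrow> complex \<Rightarrow> complex \<Rightarrow> (nat \<Rightarrow> complex) \<Rightarrow> bool" where
  "quad a b c x \<longleftrightarrow> geo (\<lambda>n. x n - (a + b * of_nat n + c * (of_nat n)\<^sup>2))"

lemma geo_imp_quad: "geo x \<Longrightarrow> quad 0 0 0 x"
  by (simp add: quad_def)

lemma quad_add: "quad a b c x \<Longrightarrow> quad a' b' c' y \<Longrightarrow> quad (a + a') (b + b') (c + c') (\<lambda>n. x n + y n)"
  unfolding quad_def by (drule (1) geo_add) (simp add: algebra_simps)

lemma quad_cmult: "quad a b c x \<Longrightarrow> quad (k * a) (k * b) (k * c) (\<lambda>n. k * x n)"
  unfolding quad_def by (drule geo_cmult[of _ k]) (simp add: algebra_simps)

text \<open>Summing \<open>a + b * i\<close> over i < n gives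
  \<open>(a - b / 2) * n + b / 2 * n ^ 2\<close>; the summed geometric error converges geometrically
  and contributes the constant e.\<close>

lemma quad_sum:
  assumes rec: "\<And>n. x (Suc n) = x n + y n" and y: "quad a b 0 y"
  shows "\<exists>e. quad e (a - b / 2) (b / 2) x"
proof -
  define x' where "x' n = x n - ((a - b / 2) * of_nat n + b / 2 * (of_nat n)\<^sup>2)" for n
  have "x' (Suc n) = x' n + (y n - (a + b * of_nat n + 0 * (of_nat n)\<^sup>2))" for n
    by (simp add: x'_def rec field_simps power2_eq_square)
  with y obtain e where "geo (\<lambda>n. x' n - e)"
    unfolding quad_def using geo_sum[of x' "\<lambda>n. y n - (a + b * of_nat n + 0 * (of_nat n)\<^sup>2)"] by blast
  moreover have "(\<lambda>n. x' n - e) = (\<lambda>n. x n - (e + (a - b / 2) * of_nat n + b / 2 * (of_nat n)\<^sup>2))"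
    by (simp add: x'_def fun_eq_iff algebra_simps)
  ultimately show ?thesis unfolding quad_def by auto
qed

text \<open>The recurrences of a row of normalised powers of an upper triangular matrix. With
  eigenvalue 1 placed last, contracting components receive only decaying input, while components
  with eigenvalue 1 sum theirs and raise the degree by at most one.\<close>

lemma triangular_recurrence_quad:
  fixes x1 x2 x3 :: "nat \<Rightarrow> complex"
  assumes r1: "\<And>n. x1 (Suc n) = \<mu>1 * x1 n" and r2: "\<And>n. x2 (Suc n) = \<mu>2 * x2 n + p * x1 n"
    and r3: "\<And>n. x3 (Suc n) = \<mu>3 * x3 n + (q * x1 n + s * x2 n)"
    and m: "\<mu>3 = 1" "cmod \<mu>2 < 1 \<or> \<mu>2 = 1" "cmod \<mu>1 < 1 \<or> \<mu>1 = 1" "\<mu>1 = 1 \<Longrightarrow> \<mu>2 = 1"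
  shows "\<exists>a b c. quad a b c x1" "\<exists>a b c. quad a b c x2" "\<exists>a b c. quad a b c x3"
proof -
  have r3': "x3 (Suc n) = x3 n + (q * x1 n + s * x2 n)" for n using r3 m(1) by simp
  have *: "\<exists>a1. quad a1 0 0 x1 \<and> (\<exists>a2 b2. quad a2 b2 0 x2)"
  proof (cases "\<mu>1 = 1")
    case True
    define c where "c = x1 0"
    have "x1 n = c" for n by (induction n) (use True in \<open>auto simp: r1 c_def\<close>)
    then have 1: "quad c 0 0 x1" unfolding quad_def using geo_0 by simp
    have "x2 (Suc n) = x2 n + p * x1 n" for n using r2 m(4)[OF True] by simp
    moreover have "quad (p * c) 0 0 (\<lambda>n. p * x1 n)" using quad_cmult[OF 1, of p] by simp
    ultimately obtain e where "quad e (p * c) 0 x2"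
      using quad_sum[of x2 "\<lambda>n. p * x1 n" "p * c" 0] by auto
    with 1 show ?thesis by blast
  next
    case False
    then have g1: "geo x1" using geo_step[of x1 \<mu>1 "\<lambda>_. 0"] r1 geo_0 m(3) by auto
    note gp = geo_cmult[OF g1, of p]
    have "\<exists>a2 b2. quad a2 b2 0 x2"
    proof (cases "\<mu>2 = 1")
      case True
      have "x2 (Suc n) = x2 n + p * x1 n" for n using r2 True by simp
      from quad_sum[OF this geo_imp_quad[OF gp]] show ?thesis by auto
    next
      case False
      then have "geo x2" using geo_step[of x2 \<mu>2 "\<lambda>n. p * x1 n"] r2 gp m(2) by auto
      from geo_imp_quad[OF this] show ?thesis by blast
    qed
    with geo_imp_quad[OF g1] show ?thesis by blast
  qed
  then obtain a1 a2 b2 where q: "quad a1 0 0 x1" "quad a2 b2 0 x2" by blast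
  then show "\<exists>a b c. quad a b c x1" "\<exists>a b c. quad a b c x2" by blast+
  have "quad (q * a1 + s * a2) (s * b2) 0 (\<lambda>n. q * x1 n + s * x2 n)"
    using quad_add[OF quad_cmult[OF q(1), of q] quad_cmult[OF q(2), of s]] by simp
  from quad_sum[OF r3' this] show "\<exists>a b c. quad a b c x3" by blast
qed

section \<open>Normalised powers of 3 by 3 matrices\<close>

lemma mat3_mult_entry:
  fixes A B :: "'a :: semiring_0 mat"
  assumes "A \<in> carrier_mat 3 3" "B \<in> carrier_mat 3 3" "i < 3" "j < 3"
  shows "(A * B) $$ (i, j) = (\<Sum>k<3. A $$ (i, k) * B $$ (k, j))"
proof -
  have "(A * B) $$ (i, j) = (\<Sum>k\<in>{0..<3}. vec_index (Matrix.row A i) k * vec_index (col B j) k)"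
    using assms by (simp add: scalar_prod_def)
  also have "\<dots> = (\<Sum>k<3. A $$ (i, k) * B $$ (k, j))"
    unfolding lessThan_atLeast0 using assms by (intro sum.cong) auto
  finally show ?thesis .
qed

lemma less_3_cases: "(i :: nat) < 3 \<longleftrightarrow> i = 0 \<or> i = 1 \<or> i = 2"
  by auto

lemma sum_less_3: "(\<Sum>k<3::nat. f k) = f 0 + f 1 + f 2"
  by (simp add: numeral_3_eq_3 numeral_2_eq_2)

text \<open>The Schur form can list the eigenvalues in any order; here all copies of l are put
  last.\<close>

lemma dominant_char_poly3:
  fixes M :: "complex mat"
  assumes M: "M \<in> carrier_mat 3 3" and ev: "eigenvalue M l"
    and dom: "\<And>\<mu>. eigenvalue M \<mu> \<Longrightarrow> \<mu> \<noteq> l \<Longrightarrow> cmod \<mu> < cmod l"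
  obtains e1 e2 where "char_poly M = (\<Prod>e\<leftarrow>[e1, e2, l]. [:- e, 1:])"
    "cmod e1 < cmod l \<or> e1 = l" "cmod e2 < cmod l \<or> e2 = l" "e1 = l \<Longrightarrow> e2 = l"
proof -
  obtain as where as: "char_poly M = (\<Prod>e\<leftarrow>as. [:- e, 1:])" "length as = 3"
    using char_poly_factorized[OF M] by blast
  then obtain x y z where xyz: "as = [x, y, z]"
    by (auto simp: length_Suc_conv numeral_3_eq_3)
  have cp: "char_poly M = [:- x, 1:] * [:- y, 1:] * [:- z, 1:]" 
    unfolding as(1) xyz by (simp only: list.map prod_list.Cons prod_list.Nil mult_1_right mult.assoc)
  have root: "eigenvalue M e \<longleftrightarrow> e = x \<or> e = y \<or> e = z" for e
    unfolding eigenvalue_root_char_poly[OF M] cp poly_mult mult_eq_0_iff by auto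
  have c: "cmod e < cmod l \<or> e = l" if "e \<in> {x, y, z}" for e
    using dom[of e] root[of e] that by auto
  have l: "l = x \<or> l = y \<or> l = z" using ev root by simp
  have ex: "\<exists>e1 e2. [:- x, 1:] * [:- y, 1:] * [:- z, 1:] = [:- e1, 1:] * [:- e2, 1:] * [:- l, 1:] \<and>
      e1 \<in> {x, y, z} \<and> e2 \<in> {x, y, z} \<and> (e1 = l \<longrightarrow> e2 = l)"
  proof -
    consider "l = z" "x = l \<longrightarrow> y = l" | "l = z" "y = l \<longrightarrow> x = l" | "l = y" "x = l \<longrightarrow> z = l"
      | "l = y" "z = l \<longrightarrow> x = l" | "l = x" "y = l \<longrightarrow> z = l" | "l = x" "z = l \<longrightarrow> y = l"
      using l by blast
    then show ?thesis
    proof cases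
      case 1
      have "[:- x, 1:] * [:- y, 1:] * [:- z, 1:] = [:- x, 1:] * [:- y, 1:] * [:- l, 1:]"
        unfolding \<open>l = _\<close> by (simp only: mult_ac)
      then show ?thesis using 1(2) by blast
    next
      case 2
      have "[:- x, 1:] * [:- y, 1:] * [:- z, 1:] = [:- y, 1:] * [:- x, 1:] * [:- l, 1:]"
        unfolding \<open>l = _\<close> by (simp only: mult_ac)
      then show ?thesis using 2(2) by blast
    next
      case 3
      have "[:- x, 1:] * [:- y, 1:] * [:- z, 1:] = [:- x, 1:] * [:- z, 1:] * [:- l, 1:]"
        unfolding \<open>l = _\<close> by (simp only: mult_ac)
      then show ?thesis using 3(2) by blast
    next
      case 4
      have "[:- x, 1:] * [:- y, 1:] * [:- z, 1:] = [:- z, 1:] * [:- x, 1:] * [:- l, 1:]"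
        unfolding \<open>l = _\<close> by (simp only: mult_ac)
      then show ?thesis using 4(2) by blast
    next
      case 5
      have "[:- x, 1:] * [:- y, 1:] * [:- z, 1:] = [:- y, 1:] * [:- z, 1:] * [:- l, 1:]"
        unfolding \<open>l = _\<close> by (simp only: mult_ac)
      then show ?thesis using 5(2) by blast
    next
      case 6
      have "[:- x, 1:] * [:- y, 1:] * [:- z, 1:] = [:- z, 1:] * [:- y, 1:] * [:- l, 1:]"
        unfolding \<open>l = _\<close> by (simp only: mult_ac)
      then show ?thesis using 6(2) by blast
    qed
  qed
  then obtain e1 e2 where eq: "[:- x, 1:] * [:- y, 1:] * [:- z, 1:] = [:- e1, 1:] * [:- e2, 1:] * [:- l, 1:]"
      and e: "e1 \<in> {x, y, z}" "e2 \<in> {x, y, z}" "e1 = l \<longrightarrow> e2 = l" by blast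
  show thesis
  proof (rule that[of e1 e2])
    show "char_poly M = (\<Prod>e\<leftarrow>[e1, e2, l]. [:- e, 1:])"
      unfolding cp eq by (simp only: list.map prod_list.Cons prod_list.Nil mult_1_right mult.assoc)
    show "cmod e1 < cmod l \<or> e1 = l" "cmod e2 < cmod l \<or> e2 = l" by (rule c, fact e)+
    show "e2 = l" if "e1 = l" using e(3) that by blast
  qed
qed

text \<open>After Schur decomposition a row of \<open>B ^\<^sub>m n\<close> is multiplied by the
  upper triangular B from the right in each step, so its first entry evolves autonomously and each
  later one is driven by its predecessors.\<close>

lemma normalised_power_quad:
  fixes M :: "complex mat"
  assumes M: "M \<in> carrier_mat 3 3" and ev: "eigenvalue M l" and l0: "l \<noteq> 0"
    and dom: "\<And>\<mu>. eigenvalue M \<mu> \<Longrightarrow> \<mu> \<noteq> l \<Longrightarrow> cmod \<mu> < cmod l"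
    and ij: "i < 3" "j < 3"
  shows "\<exists>a b c. quad a b c (\<lambda>n. (M ^\<^sub>m n) $$ (i, j) / l ^ n)"
proof -
  obtain e1 e2 where e: "char_poly M = (\<Prod>e\<leftarrow>[e1, e2, l]. [:- e, 1:])"
    "cmod e1 < cmod l \<or> e1 = l" "cmod e2 < cmod l \<or> e2 = l" "e1 = l \<Longrightarrow> e2 = l"
    using dominant_char_poly3[OF M ev dom] by blast
  obtain B P Q where "schur_decomposition M [e1, e2, l] = (B, P, Q)" by (metis prod_cases3)
  from schur_decomposition[OF M e(1) this] have sim: "similar_mat_wit M B P Q"
    and ut: "upper_triangular B" and dg: "diag_mat B = [e1, e2, l]" by auto
  have dM: "3 = dim_row M" using M by simp
  note car = similar_mat_witD(5-7)[OF dM sim]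
  have Bn: "B ^\<^sub>m n \<in> carrier_mat 3 3" for n using car by simp
  have pw: "M ^\<^sub>m n = P * B ^\<^sub>m n * Q" for n by (rule similar_mat_wit_pow_id[OF sim])
  have z: "B $$ (1, 0) = 0" "B $$ (2, 0) = 0" "B $$ (2, 1) = 0"
    using ut car unfolding upper_triangular_def by auto
  have d: "B $$ (0, 0) = e1" "B $$ (1, 1) = e2" "B $$ (2, 2) = l"
    using dg car by (auto simp: diag_mat_def eval_nat_numeral)
  define y where "y k m n = (B ^\<^sub>m n) $$ (k, m) / l ^ n" for k m n
  have rec: "y k m (Suc n) = y k 0 n * B $$ (0, m) / l + y k 1 n * B $$ (1, m) / l + y k 2 n * B $$ (2, m) / l"
    if "k < 3" "m < 3" for k m n
    unfolding y_def using mat3_mult_entry[OF Bn[of n] car(1) that] l0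
    by (simp add: sum_less_3 field_simps)
  have q: "\<exists>a b c. quad a b c (y k m)" if "k < 3" "m < 3" for k m
  proof -
    have m: "cmod (e1 / l) < 1 \<or> e1 / l = 1" "cmod (e2 / l) < 1 \<or> e2 / l = 1"
      "e1 / l = 1 \<Longrightarrow> e2 / l = 1"
      using e(2-4) l0 by (auto simp: norm_divide)
    have "y k 0 (Suc n) = e1 / l * y k 0 n"
      "y k 1 (Suc n) = e2 / l * y k 1 n + B $$ (0, 1) / l * y k 0 n"
      "y k 2 (Suc n) = 1 * y k 2 n + (B $$ (0, 2) / l * y k 0 n + B $$ (1, 2) / l * y k 1 n)" for n
      using rec[OF that(1), of _ n] z d l0 by (simp_all add: mult.commute)
    note * = triangular_recurrence_quad[of "y k 0" "e1 / l" "y k 1" "e2 / l" _ "y k 2" 1,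
        OF this refl m(2,1,3)]
    show ?thesis using * that(2) unfolding less_3_cases by auto
  qed
  have ent: "(M ^\<^sub>m n) $$ (i, j) / l ^ n = (\<Sum>m<3. \<Sum>k<3. P $$ (i, k) * Q $$ (m, j) * y k m n)" for n
  proof -
    have PB: "P * B ^\<^sub>m n \<in> carrier_mat 3 3" using car Bn by simp
    have "(M ^\<^sub>m n) $$ (i, j) = (\<Sum>m<3. (\<Sum>k<3. P $$ (i, k) * (B ^\<^sub>m n) $$ (k, m)) * Q $$ (m, j))"
      unfolding pw mat3_mult_entry[OF PB car(3) ij]
      using mat3_mult_entry[OF car(2) Bn ij(1)] by (intro sum.cong) auto
    then show ?thesis
      unfolding y_def by (simp add: sum_less_3 add_divide_distrib distrib_left distrib_right mult_ac)
  qed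
  have add: "\<exists>a b c. quad a b c (\<lambda>n. f n + g n)"
    if "\<exists>a b c. quad a b c f" "\<exists>a b c. quad a b c g" for f g
    using that quad_add by blast
  have qq: "\<exists>a b c. quad a b c (\<lambda>n. P $$ (i, k) * Q $$ (m, j) * y k m n)" if "k < 3" "m < 3" for k m
    using q[OF that] quad_cmult by blast
  show ?thesis
    unfolding ent sum_less_3 by (intro add; rule qq; simp)
qed

lemma quad_tendsto:
  defines "e \<equiv> \<lambda>n. 1 / of_nat (Suc n) :: complex"
  shows "quad a b c x \<Longrightarrow> (\<lambda>n. x n * e n ^ 2) \<longlonglongrightarrow> c"
    and "quad a b 0 x \<Longrightarrow> (\<lambda>n. x n * e n ^ 1) \<longlonglongrightarrow> b"
    and "quad a 0 0 x \<Longrightarrow> (\<lambda>n. x n * e n ^ 0) \<longlonglongrightarrow> a"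
proof -
  have e: "e \<longlonglongrightarrow> 0" unfolding e_def by (rule LIMSEQ_Suc[OF lim_1_over_n])
  have ne: "of_nat n * e n = 1 - e n" for n
  proof -
    have "(1 + of_nat n :: complex) \<noteq> 0" by (metis of_nat_Suc of_nat_neq_0)
    then show ?thesis by (simp add: e_def field_simps)
  qed
  have z: "(\<lambda>n. x n - (a + b * of_nat n + c * (of_nat n)\<^sup>2)) \<longlonglongrightarrow> 0" if "quad a b c x" for a b c
    using geo_tendsto_0 that unfolding quad_def by blast
  have eq2: "x n * e n ^ 2 = (x n - (a + b * of_nat n + c * (of_nat n)\<^sup>2)) * e n ^ 2
      + a * e n ^ 2 + b * (of_nat n * e n) * e n + c * (of_nat n * e n)\<^sup>2" for n a b c
    by (simp add: algebra_simps power2_eq_square)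
  show "(\<lambda>n. x n * e n ^ 2) \<longlonglongrightarrow> c" if "quad a b c x"
  proof -
    have "(\<lambda>n. (x n - (a + b * of_nat n + c * (of_nat n)\<^sup>2)) * e n ^ 2
        + a * e n ^ 2 + b * (1 - e n) * e n + c * (1 - e n)\<^sup>2)
      \<longlonglongrightarrow> 0 * 0 ^ 2 + a * 0 ^ 2 + b * (1 - 0) * 0 + c * (1 - 0)\<^sup>2"
      by (intro tendsto_intros z[OF that] e)
    then show ?thesis unfolding eq2[of _ a b c] ne by simp
  qed
  have eq1: "x n * e n ^ 1 = (x n - (a + b * of_nat n + 0 * (of_nat n)\<^sup>2)) * e n
      + a * e n + b * (of_nat n * e n)" for n a b
    by (simp add: algebra_simps)
  show "(\<lambda>n. x n * e n ^ 1) \<longlonglongrightarrow> b" if "quad a b 0 x"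
  proof -
    have "(\<lambda>n. (x n - (a + b * of_nat n + 0 * (of_nat n)\<^sup>2)) * e n + a * e n + b * (1 - e n))
      \<longlonglongrightarrow> 0 * 0 + a * 0 + b * (1 - 0)"
      by (intro tendsto_intros z[OF that] e)
    then show ?thesis unfolding eq1[of _ a b] ne by simp
  qed
  show "(\<lambda>n. x n * e n ^ 0) \<longlonglongrightarrow> a" if "quad a 0 0 x"
    using tendsto_add[OF z[OF that] tendsto_const[of a]] by simp
qed

lemma mult_mat_vec3_entry:
  assumes "A \<in> carrier_mat 3 3" "v \<in> carrier_vec 3" "i < 3"
  shows "vec_index (A *\<^sub>v v) i = (\<Sum>k<3. A $$ (i, k) * vec_index v k)"
  using assms by (simp add: scalar_prod_def lessThan_atLeast0)

lemma pow_mat_Suc_left: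
  assumes "A \<in> carrier_mat k k"
  shows "A ^\<^sub>m Suc n = A * A ^\<^sub>m n"
  using assms
proof (induction n)
  case (Suc n)
  have "A ^\<^sub>m Suc (Suc n) = (A * A ^\<^sub>m n) * A" using Suc by simp
  also have "\<dots> = A * (A ^\<^sub>m n * A)" using Suc.prems by (intro assoc_mult_mat[of _ k k _ k _ k]) auto
  finally show ?case by simp
qed simp

lemma eigenvector_pow_entry:
  assumes M: "M \<in> carrier_mat 3 3" and z: "eigenvector M z l" and "i < 3"
  shows "(\<Sum>k<3. (M ^\<^sub>m n) $$ (i, k) * vec_index z k) = l ^ n * vec_index z i"
proof -
  have zc: "z \<in> carrier_vec 3" using z M by (simp add: eigenvector_def)
  have "M ^\<^sub>m n *\<^sub>v z = l ^ n \<cdot>\<^sub>v z" using eigenvector_pow[OF M z] .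
  then have "vec_index (M ^\<^sub>m n *\<^sub>v z) i = vec_index (l ^ n \<cdot>\<^sub>v z) i" by simp
  then show ?thesis
    using mult_mat_vec3_entry[of "M ^\<^sub>m n" z i] M zc \<open>i < 3\<close> by simp
qed

lemma map_mat_of_real_pow_entry:
  assumes M: "M \<in> carrier_mat 3 3" and ij: "i < 3" "j < 3"
  shows "(map_mat complex_of_real M ^\<^sub>m n) $$ (i, j) = complex_of_real ((M ^\<^sub>m n) $$ (i, j))"
  using ij
proof (induction n arbitrary: i j)
  case 0
  then show ?case using M by simp
next
  case (Suc n)
  then show ?case
    using mat3_mult_entry[of "map_mat complex_of_real M ^\<^sub>m n" "map_mat complex_of_real M" i j]
      mat3_mult_entry[of "M ^\<^sub>m n" M i j] M
    by simp
qed

text \<open>The dominant eigenvalue may be defective; then the powers pick up a polynomial factor, but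
  they still align with the eigenline because the limit of the rescaled powers is a nonzero
  matrix whose columns are eigenvectors.\<close>

lemma rescaled_power_limit:
  fixes M :: "real mat"
  assumes M: "M \<in> carrier_mat 3 3" and dom: "dominant_eigenvalue M (complex_of_real l)" and l: "0 < l"
  obtains d :: nat and L :: "nat \<Rightarrow> nat \<Rightarrow> real" where
    "\<And>i j. i < 3 \<Longrightarrow> j < 3 \<Longrightarrow> (\<lambda>n. (M ^\<^sub>m n) $$ (i, j) / (l ^ n * real (Suc n) ^ d)) \<longlonglongrightarrow> L i j"
    "\<exists>i<3. \<exists>j<3. L i j \<noteq> 0"
proof -
  define C where "C = map_mat complex_of_real M"
  have C: "C \<in> carrier_mat 3 3" using M by (simp add: C_def)
  have ev: "eigenvalue C (complex_of_real l)"
    and dm: "\<And>\<mu>. eigenvalue C \<mu> \<Longrightarrow> \<mu> \<noteq> complex_of_real l \<Longrightarrow> cmod \<mu> < cmod (complex_of_real l)"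
    using dom by (auto simp: dominant_eigenvalue_def C_def)
  define x where "x i j n = (C ^\<^sub>m n) $$ (i, j) / complex_of_real l ^ n" for i j n
  have "\<forall>i j. \<exists>a b c. i < 3 \<longrightarrow> j < 3 \<longrightarrow> quad a b c (x i j)"
    using normalised_power_quad[OF C ev _ dm] l unfolding x_def by auto
  then obtain a b c where q: "\<And>i j. i < 3 \<Longrightarrow> j < 3 \<Longrightarrow> quad (a i j) (b i j) (c i j) (x i j)"
    by metis
  define e where "e n = (1 / of_nat (Suc n) :: complex)" for n
  obtain d :: nat and K where K: "\<And>i j. i < 3 \<Longrightarrow> j < 3 \<Longrightarrow> (\<lambda>n. x i j n * e n ^ d) \<longlonglongrightarrow> K i j"
    "\<exists>i<3. \<exists>j<3. K i j \<noteq> 0"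
  proof (cases "\<exists>i<3. \<exists>j<3. c i j \<noteq> 0")
    case True
    show thesis
      by (rule that[of 2 c]) (use True quad_tendsto(1)[OF q] in \<open>auto simp: e_def\<close>)
  next
    case c0: False
    then have q1: "quad (a i j) (b i j) 0 (x i j)" if "i < 3" "j < 3" for i j using q[of i j] that by auto
    show thesis
    proof (cases "\<exists>i<3. \<exists>j<3. b i j \<noteq> 0")
      case True
      show thesis
        by (rule that[of 1 b]) (use True quad_tendsto(2)[OF q1] in \<open>auto simp: e_def\<close>)
    next
      case False
      then have q0: "quad (a i j) 0 0 (x i j)" if "i < 3" "j < 3" for i j using q1[of i j] that by auto
      have lim: "(\<lambda>n. x i j n) \<longlonglongrightarrow> a i j" if "i < 3" "j < 3" for i j
        using quad_tendsto(3)[OF q0[OF that]] by simp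
      \<comment> \<open>The normalised powers fix an eigenvector z for l, so they cannot tend to 0;
        degree 0 is therefore the last possible case.\<close>
      have "\<exists>i<3. \<exists>j<3. a i j \<noteq> 0"
      proof (rule ccontr)
        assume no: "\<not> ?thesis"
        obtain z where z: "eigenvector C z (complex_of_real l)" using ev by (auto simp: eigenvalue_def)
        have "vec_index z i = 0" if i: "i < 3" for i
        proof -
          have "(\<Sum>k<3. x i k n * vec_index z k) = vec_index z i" for n
          proof -
            have "(\<Sum>k<3. x i k n * vec_index z k)
                = (\<Sum>k<3. (C ^\<^sub>m n) $$ (i, k) * vec_index z k) / complex_of_real l ^ n"
              unfolding x_def sum_divide_distrib by (intro sum.cong) auto
            then show ?thesis using eigenvector_pow_entry[OF C z i, of n] l by simp
          qed
          moreover have "(\<lambda>n. \<Sum>k<3. x i k n * vec_index z k) \<longlonglongrightarrow> (\<Sum>k<3. a i k * vec_index z k)"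
            by (intro tendsto_intros lim i) auto
          moreover have "(\<Sum>k<3. a i k * vec_index z k) = 0" using no i by (intro sum.neutral) auto
          ultimately show ?thesis by (simp add: LIMSEQ_const_iff)
        qed
        moreover have "z \<in> carrier_vec 3" "z \<noteq> 0\<^sub>v 3" using z C by (auto simp: eigenvector_def)
        ultimately show False by (metis (no_types) carrier_vecD eq_vecI index_zero_vec)
      qed
      then show thesis using that[of 0 a] lim by simp
    qed
  qed
  have eq: "x i j n * e n ^ d = complex_of_real ((M ^\<^sub>m n) $$ (i, j) / (l ^ n * real (Suc n) ^ d))"
    if "i < 3" "j < 3" for i j n
    using map_mat_of_real_pow_entry[OF M that, of n]
    by (simp add: x_def e_def C_def power_one_over divide_inverse power_inverse)
  have lim: "(\<lambda>n. (M ^\<^sub>m n) $$ (i, j) / (l ^ n * real (Suc n) ^ d)) \<longlonglongrightarrow> Re (K i j)"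
    and im: "Im (K i j) = 0" if "i < 3" "j < 3" for i j
  proof -
    have *: "(\<lambda>n. complex_of_real ((M ^\<^sub>m n) $$ (i, j) / (l ^ n * real (Suc n) ^ d))) \<longlonglongrightarrow> K i j"
      using K(1)[OF that] unfolding eq[OF that] .
    from tendsto_Re[OF this] show "(\<lambda>n. (M ^\<^sub>m n) $$ (i, j) / (l ^ n * real (Suc n) ^ d)) \<longlonglongrightarrow> Re (K i j)"
      by (simp only: Re_complex_of_real)
    from tendsto_Im[OF *] have "(\<lambda>n. 0) \<longlonglongrightarrow> Im (K i j)" by (simp only: Im_complex_of_real)
    then show "Im (K i j) = 0" by (simp add: LIMSEQ_const_iff)
  qed
  show thesis
  proof (rule that[of d "\<lambda>i j. Re (K i j)"])
    show "\<exists>i<3. \<exists>j<3. Re (K i j) \<noteq> 0" using K(2) im by (metis complex_eq_iff zero_complex.simps)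
  qed (rule lim)
qed

text \<open>One more factor M changes the normalisation by l and by
  \<open>(1 + 1 / real (Suc n)) ^ d\<close>, which tends to 1, so M maps the limit matrix L to l
  times L. A nonzero column of L is thus an eigenvector, of one sign by assumption; v is the unit
  vector of that column, with this sign.\<close>

lemma positive_power_direction:
  fixes M :: "real mat"
  assumes M: "M \<in> carrier_mat 3 3" and dom: "dominant_eigenvalue M (complex_of_real l)" and l: "0 < l"
    and sgn: "\<And>w i q. eigenvector M w l \<Longrightarrow> i < 3 \<Longrightarrow> q < 3 \<Longrightarrow> vec_index w i * vec_index w q > 0"
  obtains d :: nat and K :: real and u v :: "nat \<Rightarrow> real" where
    "\<And>n i j. i < 3 \<Longrightarrow> j < 3 \<Longrightarrow> \<bar>(M ^\<^sub>m n) $$ (i, j)\<bar> \<le> K * (l ^ n * real (Suc n) ^ d)"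
    "\<And>i. i < 3 \<Longrightarrow> (\<lambda>n. (\<Sum>j<3. (M ^\<^sub>m n) $$ (i, j) * v j) / (l ^ n * real (Suc n) ^ d)) \<longlonglongrightarrow> u i"
    "\<And>i. i < 3 \<Longrightarrow> 0 < u i" "\<And>i. i < 3 \<Longrightarrow> (\<Sum>j<3. M $$ (i, j) * u j) = l * u i"
proof -
  obtain d L where L: "\<And>i j. i < 3 \<Longrightarrow> j < 3 \<Longrightarrow>
      (\<lambda>n. (M ^\<^sub>m n) $$ (i, j) / (l ^ n * real (Suc n) ^ d)) \<longlonglongrightarrow> L i j"
    "\<exists>i<3. \<exists>j<3. L i j \<noteq> 0"
    using rescaled_power_limit[OF M dom l] by blast
  define r where "r i j n = (M ^\<^sub>m n) $$ (i, j) / (l ^ n * real (Suc n) ^ d)" for i j n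
  note Lr = L(1)[folded r_def]
  have gpos: "0 < l ^ n * real (Suc n) ^ d" for n using l by simp
  have "\<forall>i j. \<exists>k. i < 3 \<longrightarrow> j < 3 \<longrightarrow> (\<forall>n. \<bar>r i j n\<bar> \<le> k)"
    using convergent_imp_Bseq[OF convergentI[OF Lr]] unfolding Bseq_def by (auto, metis)
  then obtain k where k: "\<And>i j n. i < 3 \<Longrightarrow> j < 3 \<Longrightarrow> \<bar>r i j n\<bar> \<le> k i j" by metis
  define K where "K = (\<Sum>i<3. \<Sum>j<3. \<bar>k i j\<bar>)"
  have kK: "k i j \<le> K" if "i < 3" "j < 3" for i j
  proof -
    have "\<bar>k i j\<bar> \<le> (\<Sum>j<3. \<bar>k i j\<bar>)" using that by (intro member_le_sum) auto
    also have "\<dots> \<le> K" unfolding K_def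
      using that by (intro member_le_sum[of i "{..<3}" "\<lambda>i. \<Sum>j<3. \<bar>k i j\<bar>"]) (auto intro: sum_nonneg)
    finally show ?thesis by simp
  qed
  have bound: "\<bar>(M ^\<^sub>m n) $$ (i, j)\<bar> \<le> K * (l ^ n * real (Suc n) ^ d)" if "i < 3" "j < 3" for n i j
  proof -
    have "\<bar>r i j n\<bar> \<le> K" using k[OF that, of n] kK[OF that] by linarith
    then show ?thesis
      unfolding r_def abs_divide using gpos[of n] by (simp add: pos_divide_le_eq)
  qed
  have eig: "(\<Sum>k<3. M $$ (i, k) * L k j) = l * L i j" if ij: "i < 3" "j < 3" for i j
  proof -
    have step: "(\<Sum>k<3. M $$ (i, k) * r k j n)
        = l * r i j (Suc n) * (1 + 1 / real (Suc n)) ^ d" for n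
    proof -
      have "(M ^\<^sub>m Suc n) $$ (i, j) = (\<Sum>k<3. M $$ (i, k) * (M ^\<^sub>m n) $$ (k, j))"
        unfolding pow_mat_Suc_left[OF M] using M ij by (intro mat3_mult_entry) auto
      then have "(\<Sum>k<3. M $$ (i, k) * r k j n) = (M ^\<^sub>m Suc n) $$ (i, j) / (l ^ n * real (Suc n) ^ d)"
        unfolding r_def by (simp add: sum_divide_distrib)
      also have "\<dots> = l * r i j (Suc n) * (real (Suc (Suc n)) ^ d / real (Suc n) ^ d)"
        unfolding r_def using l by (simp add: field_simps del: pow_mat.simps of_nat_Suc)
      also have "real (Suc (Suc n)) ^ d / real (Suc n) ^ d = (1 + 1 / real (Suc n)) ^ d"
        unfolding power_divide[symmetric] by (simp add: add_divide_distrib[symmetric] field_simps)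
      finally show ?thesis .
    qed
    have "(\<lambda>n. l * r i j (Suc n) * (1 + 1 / real (Suc n)) ^ d) \<longlonglongrightarrow> l * L i j * (1 + 0) ^ d"
      by (intro tendsto_intros LIMSEQ_Suc[OF Lr[OF ij]] LIMSEQ_Suc[OF lim_1_over_n])
    moreover have "(\<lambda>n. \<Sum>k<3. M $$ (i, k) * r k j n) \<longlonglongrightarrow> (\<Sum>k<3. M $$ (i, k) * L k j)"
      by (intro tendsto_intros Lr) (use ij in auto)
    ultimately show ?thesis unfolding step using LIMSEQ_unique by fastforce
  qed
  obtain i0 j where ij: "i0 < 3" "j < 3" "L i0 j \<noteq> 0" using L(2) by blast
  define w where "w = vec 3 (\<lambda>i. L i j)"
  have "eigenvector M w l"
    unfolding eigenvector_def
  proof (intro conjI)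
    show "w \<in> carrier_vec (dim_row M)" using M by (simp add: w_def)
    show "w \<noteq> 0\<^sub>v (dim_row M)"
    proof
      assume "w = 0\<^sub>v (dim_row M)"
      then have "vec_index w i0 = 0" using M ij by simp
      with ij show False by (simp add: w_def)
    qed
    show "M *\<^sub>v w = l \<cdot>\<^sub>v w"
    proof (rule eq_vecI)
      fix i assume "i < dim_vec (l \<cdot>\<^sub>v w)"
      then have i: "i < 3" by (simp add: w_def)
      have "vec_index (M *\<^sub>v w) i = (\<Sum>k<3. M $$ (i, k) * vec_index w k)"
        by (rule mult_mat_vec3_entry[OF M _ i]) (simp add: w_def)
      also have "\<dots> = (\<Sum>k<3. M $$ (i, k) * L k j)" by (intro sum.cong) (auto simp: w_def)
      finally show "vec_index (M *\<^sub>v w) i = vec_index (l \<cdot>\<^sub>v w) i"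
        using eig[OF i ij(2)] i by (simp add: w_def)
    qed (use M in \<open>simp add: w_def\<close>)
  qed
  then have same: "L i j * L q j > 0" if "i < 3" "q < 3" for i q
    using sgn[of w i q] that by (simp add: w_def)
  define s where "s = sgn (L 0 j)"
  show thesis
  proof (rule that[of K d "\<lambda>k. if k = j then s else 0" "\<lambda>i. s * L i j"])
    show "\<bar>(M ^\<^sub>m n) $$ (i, j)\<bar> \<le> K * (l ^ n * real (Suc n) ^ d)" if "i < 3" "j < 3" for n i j
      by (rule bound[OF that])
    fix i :: nat assume i: "i < 3"
    have "(\<Sum>k<3. (M ^\<^sub>m n) $$ (i, k) * (if k = j then s else 0)) = s * (M ^\<^sub>m n) $$ (i, j)" for n
      using ij(2) by (simp add: if_distrib[of "\<lambda>x. _ * x"] cong: if_cong)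
    moreover have "(\<lambda>n. s * r i j n) \<longlonglongrightarrow> s * L i j" by (intro tendsto_intros Lr i ij(2))
    ultimately show "(\<lambda>n. (\<Sum>k<3. (M ^\<^sub>m n) $$ (i, k) * (if k = j then s else 0)) / (l ^ n * real (Suc n) ^ d))
        \<longlonglongrightarrow> s * L i j"
      by (simp add: r_def)
    show "0 < s * L i j"
      using same[of 0 i] i unfolding s_def by (auto simp: sgn_if zero_less_mult_iff)
    show "(\<Sum>k<3. M $$ (i, k) * (s * L k j)) = l * (s * L i j)"
      using eig[OF i ij(2)] by (simp add: mult.left_commute[of _ s] flip: sum_distrib_left)
  qed
qed

section \<open>Perturbed orbits of periodic matrix products\<close>

primrec mprod :: "(nat \<Rightarrow> real mat) \<Rightarrow> nat \<Rightarrow> nat \<Rightarrow> real mat" where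
  "mprod F a 0 = 1\<^sub>m 3"
| "mprod F a (Suc n) = F (a + n) * mprod F a n"

lemma eigenvalue_mult_commute:
  fixes A C :: "complex mat"
  assumes A: "A \<in> carrier_mat n n" and C: "C \<in> carrier_mat n n"
    and ev: "eigenvalue (A * C) x" and "x \<noteq> 0"
  shows "eigenvalue (C * A) x"
proof -
  obtain v where v: "v \<in> carrier_vec n" "v \<noteq> 0\<^sub>v n" "(A * C) *\<^sub>v v = x \<cdot>\<^sub>v v"
    using ev A by (auto simp: eigenvalue_def eigenvector_def)
  define w where "w = C *\<^sub>v v"
  have w: "w \<in> carrier_vec n" using C v by (simp add: w_def)
  have Aw: "A *\<^sub>v w = x \<cdot>\<^sub>v v" unfolding w_def using v(3) A C v(1) by simp
  have "w \<noteq> 0\<^sub>v n"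
  proof
    assume "w = 0\<^sub>v n"
    then have z: "x \<cdot>\<^sub>v v = 0\<^sub>v n" unfolding Aw[symmetric] using A by (intro eq_vecI) auto
    have "v = 0\<^sub>v n"
    proof (rule eq_vecI)
      fix i assume "i < dim_vec (0\<^sub>v n :: complex vec)"
      then have "x * vec_index v i = 0"
        using arg_cong[OF z, of "\<lambda>w. vec_index w i"] v(1) by simp
      then show "vec_index v i = vec_index (0\<^sub>v n) i"
        using \<open>x \<noteq> 0\<close> \<open>i < _\<close> by simp
    qed (use v(1) in simp)
    with v(2) show False ..
  qed
  moreover have "(C * A) *\<^sub>v w = x \<cdot>\<^sub>v w"
  proof -
    have "(C * A) *\<^sub>v w = C *\<^sub>v (A *\<^sub>v w)" using A C w by simp
    also have "\<dots> = x \<cdot>\<^sub>v w" unfolding Aw unfolding w_def using C v by (simp add: mult_mat_vec)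
    finally show ?thesis .
  qed
  ultimately have "eigenvector (C * A) w x" using w C unfolding eigenvector_def by auto
  then show ?thesis unfolding eigenvalue_def by blast
qed

text \<open>\<open>A * C\<close> and \<open>C * A\<close> have the same nonzero eigenvalues, and
  strict dominance leaves only one candidate. Hence all cyclic shifts of a period share one growth
  rate.\<close>

lemma dominant_eigenvalue_cyclic:
  assumes A: "A \<in> carrier_mat 3 3" and C: "C \<in> carrier_mat 3 3"
    and l: "dominant_eigenvalue (A * C) l" "l \<noteq> 0" and l': "dominant_eigenvalue (C * A) l'" "l' \<noteq> 0"
  shows "l = l'"
proof -
  let ?c = "map_mat complex_of_real"
  have AC: "?c (A * C) = ?c A * ?c C" "?c (C * A) = ?c C * ?c A"
    using A C by (auto simp: of_real_hom.mat_hom_mult)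
  have c: "?c A \<in> carrier_mat 3 3" "?c C \<in> carrier_mat 3 3" using A C by auto
  have "eigenvalue (?c (C * A)) l"
    using eigenvalue_mult_commute[OF c] l unfolding dominant_eigenvalue_def AC by blast
  moreover have "eigenvalue (?c (A * C)) l'"
    using eigenvalue_mult_commute[OF c(2,1)] l' unfolding dominant_eigenvalue_def AC by blast
  ultimately show ?thesis
    using l(1) l'(1) unfolding dominant_eigenvalue_def by (metis less_asym)
qed

text \<open>Assumption \<open>row\<close> fixes signs: the stability type only says that the entries
  of an eigenvector agree in sign, and a nonnegative nonzero row gives the image of a positive
  vector a positive entry.\<close>

locale periodic_product =
  fixes F :: "nat \<Rightarrow> real mat" and m :: nat
  assumes car: "\<And>n. F n \<in> carrier_mat 3 3" and m: "1 \<le> m" and per: "\<And>n. F (n + m) = F n"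
    and frag: "\<And>i. i < m \<Longrightarrow> frag_asymp_stability_type (mprod F i m)"
    and row: "\<And>n. \<exists>i<3. (\<forall>j<3. 0 \<le> F n $$ (i, j)) \<and> (\<exists>j<3. 0 < F n $$ (i, j))"
begin

lemma mprod_carrier [simp]: "mprod F a n \<in> carrier_mat 3 3"
  by (induction n) (auto intro: mult_carrier_mat[OF car])

lemma mprod_add: "mprod F a (n + k) = mprod F (a + n) k * mprod F a n"
proof (induction k)
  case 0
  show ?case using left_mult_one_mat[OF mprod_carrier[of a n]] by simp
next
  case (Suc k)
  have "mprod F a (n + Suc k) = F (a + n + k) * (mprod F (a + n) k * mprod F a n)"
    using Suc by (simp add: add.assoc)
  also have "\<dots> = (F (a + n + k) * mprod F (a + n) k) * mprod F a n"
    by (rule assoc_mult_mat[symmetric, OF car mprod_carrier mprod_carrier])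
  finally show ?case by simp
qed

lemma F_periodic: "F (n + q * m) = F n"
  by (induction q) (auto simp: per add.assoc[symmetric] add.commute[of m])

lemma mprod_periodic: "mprod F (a + q * m) n = mprod F a n"
proof (induction n)
  case (Suc n)
  have "a + q * m + n = a + n + q * m" by simp
  then have "F (a + q * m + n) = F (a + n)" by (simp only: F_periodic)
  with Suc show ?case by simp
qed simp

lemma mprod_period_pow: "mprod F 0 (q * m) = mprod F 0 m ^\<^sub>m q"
proof (induction q)
  case 0
  show ?case using carrier_matD(1)[OF mprod_carrier[of 0 m]] by simp
next
  case (Suc q)
  have "mprod F 0 (Suc q * m) = mprod F 0 (q * m + m)" by (simp add: add.commute)
  also have "\<dots> = mprod F (0 + q * m) m * mprod F 0 (q * m)" by (rule mprod_add)
  also have "\<dots> = mprod F 0 m * mprod F 0 m ^\<^sub>m q" using mprod_periodic[of 0 q m] Suc by simp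
  finally show ?case using pow_mat_Suc_left[OF mprod_carrier] by simp
qed

lemma mprod_entry_add:
  assumes "i < 3" "j < 3"
  shows "mprod F a (n + k) $$ (i, j) = (\<Sum>l<3. mprod F (a + n) k $$ (i, l) * mprod F a n $$ (l, j))"
  unfolding mprod_add by (rule mat3_mult_entry) (use assms in auto)

definition act :: "nat \<Rightarrow> nat \<Rightarrow> (nat \<Rightarrow> real) \<Rightarrow> nat \<Rightarrow> real" where
  "act a n v i = (\<Sum>j<3. mprod F a n $$ (i, j) * v j)"

lemma act_0: "i < 3 \<Longrightarrow> act a 0 v i = v i"
  by (simp add: act_def if_distrib[of "\<lambda>x. x * _"] cong: if_cong)

lemma act_cong: "(\<And>j. j < 3 \<Longrightarrow> v j = w j) \<Longrightarrow> act a n v i = act a n w i"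
  unfolding act_def by (intro sum.cong) auto

lemma act_add: "i < 3 \<Longrightarrow> act a (n + k) v i = act (a + n) k (act a n v) i"
proof -
  assume i: "i < 3"
  have "act a (n + k) v i
      = (\<Sum>j<3. (\<Sum>l<3. mprod F (a + n) k $$ (i, l) * mprod F a n $$ (l, j)) * v j)"
    unfolding act_def by (intro sum.cong refl) (simp only: mprod_entry_add[OF i] lessThan_iff)
  also have "\<dots> = act (a + n) k (act a n v) i"
    unfolding act_def by (simp add: sum_less_3 algebra_simps)
  finally show ?thesis .
qed

lemma act_Suc: "i < 3 \<Longrightarrow> act a (Suc n) v i = (\<Sum>j<3. F (a + n) $$ (i, j) * act a n v j)"
proof -
  assume i: "i < 3"
  have F1: "mprod F (a + n) 1 = F (a + n)"
    using right_mult_one_mat[OF car[of "a + n"]] by simp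
  show ?thesis
    unfolding Suc_eq_plus1 act_add[OF i] act_def[of "a + n" 1] F1 ..
qed

lemma act_linear: "act a n (\<lambda>i. s * v i + w i) i = s * act a n v i + act a n w i"
  unfolding act_def by (simp add: algebra_simps sum.distrib sum_distrib_left)

lemma fragD:
  assumes "i < m"
  obtains l where "dominant_eigenvalue (mprod F i m) (complex_of_real l)" "1 < l"
    "\<And>w p q. eigenvector (mprod F i m) w l \<Longrightarrow> p < 3 \<Longrightarrow> q < 3 \<Longrightarrow> vec_index w p * vec_index w q > 0"
proof -
  obtain z where z: "dominant_eigenvalue (mprod F i m) z" "z \<in> \<real>" "Re z > 1"
    "\<And>w. eigenvector (mprod F i m) w (Re z) \<Longrightarrow> \<forall>i<dim_vec w. \<forall>q<dim_vec w. vec_index w i * vec_index w q > 0"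
    using frag[OF assms] unfolding frag_asymp_stability_type_def by blast
  have "complex_of_real (Re z) = z" using z(2) by (metis Re_complex_of_real Reals_cases)
  moreover have "dim_vec w = 3" if "eigenvector (mprod F i m) w (Re z)" for w
    using that mprod_carrier[of i m] by (auto simp: eigenvector_def)
  ultimately show thesis using that[of "Re z"] z by metis
qed

lemma growth_over_period:
  obtains l d K u v where "1 < l" "0 \<le> K"
    "\<And>n i j. i < 3 \<Longrightarrow> j < 3 \<Longrightarrow> \<bar>(mprod F 0 m ^\<^sub>m n) $$ (i, j)\<bar> \<le> K * (l ^ n * real (Suc n) ^ d)"
    "\<And>i. i < 3 \<Longrightarrow> (\<lambda>q. act 0 (q * m) v i / (l ^ q * real (Suc q) ^ d)) \<longlonglongrightarrow> u i"
    "\<And>r i. r < m \<Longrightarrow> i < 3 \<Longrightarrow> 0 < act 0 r u i"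
proof -
  have m0: "0 < m" using m by simp
  obtain l where l: "dominant_eigenvalue (mprod F 0 m) (complex_of_real l)" "1 < l"
    "\<And>w p q. eigenvector (mprod F 0 m) w l \<Longrightarrow> p < 3 \<Longrightarrow> q < 3 \<Longrightarrow> vec_index w p * vec_index w q > 0"
    using fragD[OF m0] by blast
  have l0: "0 < l" using l(2) by simp
  obtain d K u v where K: "\<And>n i j. i < 3 \<Longrightarrow> j < 3 \<Longrightarrow>
      \<bar>(mprod F 0 m ^\<^sub>m n) $$ (i, j)\<bar> \<le> K * (l ^ n * real (Suc n) ^ d)"
    and v: "\<And>i. i < 3 \<Longrightarrow> (\<lambda>n. (\<Sum>j<3. (mprod F 0 m ^\<^sub>m n) $$ (i, j) * v j) / (l ^ n * real (Suc n) ^ d)) \<longlonglongrightarrow> u i"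
    and u: "\<And>i. i < 3 \<Longrightarrow> 0 < u i" "\<And>i. i < 3 \<Longrightarrow> (\<Sum>j<3. mprod F 0 m $$ (i, j) * u j) = l * u i"
  proof (rule positive_power_direction[OF mprod_carrier l(1) l0 l(3)], goal_cases)
    case (4 d K u v)
    show ?case by (rule 4(1)[OF 4(2-)])
  qed
  have same_l: "dominant_eigenvalue (mprod F i m) (complex_of_real l')  \<Longrightarrow> 1 < l' \<Longrightarrow> l' = l"
    if i: "i < m" for i l'
  proof -
    assume l': "dominant_eigenvalue (mprod F i m) (complex_of_real l')" "1 < l'"
    have "mprod F i m = mprod F i ((m - i) + i)" using i by simp
    also have "\<dots> = mprod F (i + (m - i)) i * mprod F i (m - i)" by (rule mprod_add)
    also have "mprod F (i + (m - i)) i = mprod F 0 i" using mprod_periodic[of 0 1 i] i by simp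
    finally have 1: "mprod F i m = mprod F 0 i * mprod F i (m - i)" .
    have "mprod F 0 m = mprod F 0 (i + (m - i))" using i by simp
    also have "\<dots> = mprod F (0 + i) (m - i) * mprod F 0 i" by (rule mprod_add)
    finally have 2: "mprod F 0 m = mprod F i (m - i) * mprod F 0 i" by simp
    have "complex_of_real l' = complex_of_real l"
      using dominant_eigenvalue_cyclic[OF mprod_carrier mprod_carrier l'(1)[unfolded 1] _ l(1)[unfolded 2]]
        l' l0 by simp
    then show "l' = l" by simp
  qed
  \<comment> \<open>The images of u are eigenvectors of the shifted period products for the same l,
    hence of one sign at every phase; the positive entry supplied by \<open>row\<close> decides
    which.\<close>
  have pos: "\<forall>k<3. 0 < act 0 r u k" if "r < m" for r
    using that
  proof (induction r)
    case 0
    then show ?case using u(1) by (simp add: act_0)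
  next
    case (Suc r)
    define w where "w = vec 3 (act 0 (Suc r) u)"
    have IH: "0 < act 0 r u k" if "k < 3" for k using Suc that by simp
    obtain p where p: "p < 3" "\<forall>j<3. 0 \<le> F r $$ (p, j)" "\<exists>j<3. 0 < F r $$ (p, j)" using row by blast
    have pp: "0 < act 0 (Suc r) u p"
    proof -
      obtain j where j: "j < 3" "0 < F r $$ (p, j)" using p(3) by blast
      have "0 < (\<Sum>j<3. F (0 + r) $$ (p, j) * act 0 r u j)"
        by (rule sum_pos2[of _ j]) (use j p(2) IH in \<open>auto intro!: mult_nonneg_nonneg less_imp_le[OF IH]\<close>)
      then show ?thesis using act_Suc[OF p(1), of 0 r u] by simp
    qed
    have "eigenvector (mprod F (Suc r) m) w l"
      unfolding eigenvector_def
    proof (intro conjI)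
      have dr: "dim_row (mprod F (Suc r) m) = 3" by (rule carrier_matD(1)[OF mprod_carrier])
      show "w \<in> carrier_vec (dim_row (mprod F (Suc r) m))" by (simp only: dr w_def vec_carrier)
      show "w \<noteq> 0\<^sub>v (dim_row (mprod F (Suc r) m))"
      proof
        assume "w = 0\<^sub>v (dim_row (mprod F (Suc r) m))"
        then have "vec_index w p = 0" using p(1) dr by simp
        with pp p(1) show False by (simp add: w_def)
      qed
      show "mprod F (Suc r) m *\<^sub>v w = l \<cdot>\<^sub>v w"
      proof (rule eq_vecI)
        fix i assume "i < dim_vec (l \<cdot>\<^sub>v w)"
        then have i: "i < 3" by (simp add: w_def)
        have "vec_index (mprod F (Suc r) m *\<^sub>v w) i = (\<Sum>k<3. mprod F (Suc r) m $$ (i, k) * vec_index w k)"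
          by (rule mult_mat_vec3_entry[OF mprod_carrier _ i]) (simp add: w_def)
        also have "\<dots> = act (0 + Suc r) m (act 0 (Suc r) u) i"
          unfolding act_def[of _ m] by (intro sum.cong) (auto simp: w_def)
        also have "\<dots> = act 0 (Suc r + m) u i" by (rule act_add[OF i, symmetric])
        also have "\<dots> = act 0 (m + Suc r) u i" by (simp only: add.commute)
        also have "\<dots> = act (0 + m) (Suc r) (act 0 m u) i" by (rule act_add[OF i])
        also have "\<dots> = act 0 (Suc r) (act 0 m u) i"
          unfolding act_def[of _ "Suc r"] using mprod_periodic[of 0 1 "Suc r"] by simp
        also have "\<dots> = act 0 (Suc r) (\<lambda>j. l * u j + 0) i"
          by (rule act_cong) (use u(2) in \<open>simp add: act_def\<close>)
        also have "\<dots> = l * act 0 (Suc r) u i"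
          unfolding act_linear by (simp add: act_def)
        finally show "vec_index (mprod F (Suc r) m *\<^sub>v w) i = vec_index (l \<cdot>\<^sub>v w) i"
          using i by (simp add: w_def)
      qed (simp add: w_def dr)
    qed
    then have same: "vec_index w a * vec_index w b > 0" if "a < 3" "b < 3" for a b
      using fragD[OF Suc.prems] same_l[OF Suc.prems] that by metis
    show ?case
    proof (intro allI impI)
      fix k :: nat assume k: "k < 3"
      have "act 0 (Suc r) u p * act 0 (Suc r) u k > 0" using same[OF p(1) k] p(1) k by (simp add: w_def)
      with pp show "0 < act 0 (Suc r) u k" by (simp add: zero_less_mult_iff)
    qed
  qed
  show thesis
  proof (rule that[of l "\<bar>K\<bar>" d v u])
    show "\<bar>(mprod F 0 m ^\<^sub>m n) $$ (i, j)\<bar> \<le> \<bar>K\<bar> * (l ^ n * real (Suc n) ^ d)" if "i < 3" "j < 3" for n i j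
    proof -
      have "K * (l ^ n * real (Suc n) ^ d) \<le> \<bar>K\<bar> * (l ^ n * real (Suc n) ^ d)"
        using l0 by (intro mult_right_mono) auto
      with K[OF that, of n] show ?thesis by linarith
    qed
    show "(\<lambda>q. act 0 (q * m) v i / (l ^ q * real (Suc q) ^ d)) \<longlonglongrightarrow> u i" if "i < 3" for i
      using v[OF that] unfolding act_def mprod_period_pow .
  qed (use l(2) pos in auto)
qed

text \<open>Both bounds have the same rate, including the polynomial factor, and the upper one is
  uniform in the phase a. This match lets a large multiple of v outweigh accumulated errors.\<close>

lemma product_growth:
  obtains \<beta> :: real and d :: nat and K c :: real and v where "1 < \<beta>" "0 \<le> K" "0 < c"
    "\<And>a n i j. i < 3 \<Longrightarrow> j < 3 \<Longrightarrow> \<bar>mprod F a n $$ (i, j)\<bar> \<le> K * (\<beta> ^ n * real (Suc n) ^ d)"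
    "\<And>n i. i < 3 \<Longrightarrow> c * (\<beta> ^ n * real (Suc n) ^ d) \<le> act 0 n v i"
proof -
  obtain l d K1 u v where l: "1 < l" and K1: "0 \<le> K1"
    "\<And>n i j. i < 3 \<Longrightarrow> j < 3 \<Longrightarrow> \<bar>(mprod F 0 m ^\<^sub>m n) $$ (i, j)\<bar> \<le> K1 * (l ^ n * real (Suc n) ^ d)"
    and lim: "\<And>i. i < 3 \<Longrightarrow> (\<lambda>q. act 0 (q * m) v i / (l ^ q * real (Suc q) ^ d)) \<longlonglongrightarrow> u i"
    and u: "\<And>r i. r < m \<Longrightarrow> i < 3 \<Longrightarrow> 0 < act 0 r u i"
  proof (rule growth_over_period, goal_cases)
    case (1 l d K u v)
    show ?case by (rule 1(1)[OF 1(2-)])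
  qed
  have m0: "0 < m" using m by simp
  define \<beta> where "\<beta> = root m l"
  have \<beta>m: "\<beta> ^ m = l" unfolding \<beta>_def using m0 l by simp
  have \<beta>: "1 < \<beta>" unfolding \<beta>_def using m0 l by simp
  define g where "g n = \<beta> ^ n * real (Suc n) ^ d" for n
  define G where "G q = l ^ q * real (Suc q) ^ d" for q
  have G0: "0 < G q" for q using l by (simp add: G_def)
  have g1: "1 \<le> g n" for n
    unfolding g_def using \<beta> mult_mono[of 1 "\<beta> ^ n" 1 "real (Suc n) ^ d"] by (simp add: one_le_power)
  have gmono: "g n \<le> g k" if "n \<le> k" for n k
    unfolding g_def using \<beta> that by (intro mult_mono power_increasing power_mono) auto
  have \<beta>q: "\<beta> ^ (q * m + r) = l ^ q * \<beta> ^ r" for q r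
    by (simp add: power_add mult.commute[of q] power_mult \<beta>m)
  have gG: "G q \<le> g (q * m + r)" for q r
  proof -
    have "l ^ q * 1 \<le> l ^ q * \<beta> ^ r" using l \<beta> by (intro mult_left_mono) auto
    moreover have "Suc q \<le> Suc (q * m + r)" using m0 by (simp add: trans_le_add1)
    then have "real (Suc q) \<le> real (Suc (q * m + r))" by (simp only: of_nat_le_iff)
    ultimately show ?thesis
      unfolding g_def G_def \<beta>q using l by (intro mult_mono power_mono) auto
  qed
  have Gg: "g (q * m + r) \<le> l * real m ^ d * G q" if "r < m" for q r
  proof -
    have "\<beta> ^ r \<le> \<beta> ^ m" using \<beta> that by (intro power_increasing) auto
    then have 1: "l ^ q * \<beta> ^ r \<le> l ^ q * l" using l unfolding \<beta>m by (intro mult_left_mono) auto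
    have "Suc (q * m + r) \<le> m * Suc q" using that by simp
    then have "real (Suc (q * m + r)) \<le> real m * real (Suc q)" by (metis of_nat_mult of_nat_mono)
    then have 2: "real (Suc (q * m + r)) ^ d \<le> (real m * real (Suc q)) ^ d" by (intro power_mono) auto
    have "g (q * m + r) \<le> (l ^ q * l) * (real m * real (Suc q)) ^ d"
      unfolding g_def \<beta>q using 1 2 l \<beta> by (intro mult_mono) auto
    then show ?thesis by (simp add: G_def power_mult_distrib mult_ac)
  qed
  define Ents where "Ents = (\<lambda>(a, n, i, j). \<bar>mprod F a n $$ (i, j)\<bar>) ` ({..<m} \<times> {..m} \<times> {..<3} \<times> {..<3})"
  define K2 where "K2 = max 1 (Max Ents)"
  have K2: "\<bar>mprod F a n $$ (i, j)\<bar> \<le> K2" if "a < m" "n \<le> m" "i < 3" "j < 3" for a n i j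
  proof -
    have "\<bar>mprod F a n $$ (i, j)\<bar> \<in> Ents" unfolding Ents_def using that by force
    then have "\<bar>mprod F a n $$ (i, j)\<bar> \<le> Max Ents" by (intro Max_ge) (auto simp: Ents_def)
    then show ?thesis by (simp add: K2_def)
  qed
  have K2_1: "1 \<le> K2" by (simp add: K2_def)
  have sum_bd: "\<bar>\<Sum>k<3. x k * y k\<bar> \<le> 3 * (X * Y)"
    if "\<And>k. k < 3 \<Longrightarrow> \<bar>x k\<bar> \<le> X" "\<And>k. k < 3 \<Longrightarrow> \<bar>y k\<bar> \<le> Y" "0 \<le> X" for x y :: "nat \<Rightarrow> real" and X Y
  proof -
    have "\<bar>\<Sum>k<3. x k * y k\<bar> \<le> (\<Sum>k<3::nat. X * Y)"
      by (rule order_trans[OF sum_abs], rule sum_mono)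
        (use that in \<open>auto simp: abs_mult intro!: mult_mono\<close>)
    then show ?thesis by simp
  qed
  have up0: "\<bar>mprod F 0 n $$ (i, j)\<bar> \<le> 3 * (K2 * K1) * g n" if ij: "i < 3" "j < 3" for n i j
  proof -
    define q r where "q = n div m" and "r = n mod m"
    have n: "n = q * m + r" and r: "r < m" using m0 by (auto simp: q_def r_def)
    have "mprod F 0 n $$ (i, j) = (\<Sum>k<3. mprod F (0 + q * m) r $$ (i, k) * (mprod F 0 m ^\<^sub>m q) $$ (k, j))"
      unfolding n mprod_entry_add[OF ij] mprod_period_pow by simp
    also have "\<bar>\<dots>\<bar> \<le> 3 * (K2 * (K1 * G q))"
      unfolding mprod_periodic by (rule sum_bd) (use K2[OF m0] K1 r ij K2_1 in \<open>auto simp: G_def\<close>)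
    also have "\<dots> \<le> 3 * (K2 * (K1 * g n))"
      using gG[of q r] K1 K2_1 unfolding n[symmetric] by (intro mult_left_mono) auto
    finally show ?thesis by (simp add: mult_ac)
  qed
  \<comment> \<open>A long product from phase a splits into the rest of the first period, whole
    periods and a final piece; the two multiplications contribute a factor 3 each. The last summand
    covers products of at most one period.\<close>
  define K where "K = 9 * K1 * K2 * K2 + K2"
  have K0: "0 \<le> K" using K1 K2_1 by (simp add: K_def)
  have upa: "\<bar>mprod F a n $$ (i, j)\<bar> \<le> K * g n" if a: "a < m" and ij: "i < 3" "j < 3" for a n i j
  proof (cases "n \<le> m")
    case True
    have "K2 * 1 \<le> K * g n" using K1 K2_1 g1[of n] by (intro mult_mono) (auto simp: K_def)
    with K2[OF a True ij] show ?thesis by simp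
  next
    case False
    define n' where "n' = n - (m - a)"
    have n: "n = (m - a) + n'" using False by (simp add: n'_def)
    have "mprod F (a + (m - a)) n' = mprod F 0 n'" using mprod_periodic[of 0 1 n'] a by simp
    then have "mprod F a n $$ (i, j) = (\<Sum>k<3. mprod F 0 n' $$ (i, k) * mprod F a (m - a) $$ (k, j))"
      unfolding n mprod_entry_add[OF ij] by simp
    also have "\<bar>\<dots>\<bar> \<le> 3 * ((3 * (K2 * K1) * g n') * K2)"
    proof (rule sum_bd)
      show "0 \<le> 3 * (K2 * K1) * g n'" using K2_1 K1 g1[of n'] by simp
    qed (use up0[OF ij(1), of _ n'] K2[OF a] ij in auto)
    also have "\<dots> = (9 * K1 * K2 * K2) * g n'" by simp
    also have "\<dots> \<le> K * g n"
      using gmono[of n' n] n K1 K2_1 g1[of n'] by (intro mult_mono) (auto simp: K_def)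
    finally show ?thesis .
  qed
  have up: "\<bar>mprod F a n $$ (i, j)\<bar> \<le> K * g n" if "i < 3" "j < 3" for a n i j
  proof -
    have "mprod F (a mod m + a div m * m) n = mprod F (a mod m) n" by (rule mprod_periodic)
    then have "mprod F a n = mprod F (a mod m) n" by simp
    with upa[of "a mod m" i j n] m0 that show ?thesis by simp
  qed
  define U where "U = (\<lambda>(r, i). act 0 r u i) ` ({..<m} \<times> {..<3::nat})"
  define c where "c = Min U / 2"
  have "(0, 0) \<in> {..<m} \<times> {..<3::nat}" using m0 by simp
  then have finU: "finite U" "U \<noteq> {}" unfolding U_def by blast+
  have c0: "0 < c" unfolding c_def using finU u by (auto simp: U_def)
  have cU: "c < act 0 r u i" if "r < m" "i < 3" for r i
  proof -
    have "Min U \<le> act 0 r u i" using that finU by (intro Min_le) (auto simp: U_def)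
    with c0 show ?thesis by (simp add: c_def)
  qed
  have "\<forall>\<^sub>F q in sequentially. \<forall>ri\<in>{..<m} \<times> {..<3}. c < act 0 (q * m + fst ri) v (snd ri) / G q"
  proof (rule eventually_ball_finite)
    show "\<forall>ri\<in>{..<m} \<times> {..<3}. \<forall>\<^sub>F q in sequentially. c < act 0 (q * m + fst ri) v (snd ri) / G q"
    proof
      fix ri :: "nat \<times> nat" assume "ri \<in> {..<m} \<times> {..<3}"
      then have ri: "fst ri < m" "snd ri < 3" by auto
      have "(\<lambda>q. \<Sum>j<3. mprod F 0 (fst ri) $$ (snd ri, j) * (act 0 (q * m) v j / G q))
          \<longlonglongrightarrow> (\<Sum>j<3. mprod F 0 (fst ri) $$ (snd ri, j) * u j)"
        unfolding G_def by (intro tendsto_intros lim) auto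
      moreover have "(\<Sum>j<3. mprod F 0 (fst ri) $$ (snd ri, j) * (act 0 (q * m) v j / G q))
          = act 0 (q * m + fst ri) v (snd ri) / G q" for q
      proof -
        have "act 0 (q * m + fst ri) v (snd ri)
            = (\<Sum>j<3. mprod F (0 + q * m) (fst ri) $$ (snd ri, j) * act 0 (q * m) v j)"
          unfolding act_add[OF ri(2)] act_def[of "0 + q * m"] ..
        then show ?thesis unfolding mprod_periodic by (simp add: sum_divide_distrib)
      qed
      ultimately have "(\<lambda>q. act 0 (q * m + fst ri) v (snd ri) / G q) \<longlonglongrightarrow> act 0 (fst ri) u (snd ri)"
        by (simp add: act_def)
      then show "\<forall>\<^sub>F q in sequentially. c < act 0 (q * m + fst ri) v (snd ri) / G q"
        using cU[OF ri] by (rule order_tendstoD)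
    qed
  qed simp
  then obtain Q where Q: "\<And>q r i. Q \<le> q \<Longrightarrow> r < m \<Longrightarrow> i < 3 \<Longrightarrow> c < act 0 (q * m + r) v i / G q"
    unfolding eventually_sequentially by force
  define c' where "c' = c / (l * real m ^ d)"
  have lm: "0 < l * real m ^ d" using l m0 by simp
  have c'0: "0 < c'" unfolding c'_def using c0 lm by (rule divide_pos_pos)
  have low: "c' * g (Q * m + n) \<le> act 0 (Q * m + n) v i" if i: "i < 3" for n i
  proof -
    define q r where "q = n div m" and "r = n mod m"
    have n: "Q * m + n = (Q + q) * m + r" and r: "r < m"
      using m0 by (auto simp: q_def r_def add_mult_distrib)
    have "c' * g (Q * m + n) \<le> c' * (l * real m ^ d * G (Q + q))"
      unfolding n using Gg[OF r] c'0 by (intro mult_left_mono) auto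
    also have "\<dots> = c * G (Q + q)" using l m0 by (simp add: c'_def)
    also have "\<dots> \<le> act 0 ((Q + q) * m + r) v i"
      using Q[OF _ r i, of "Q + q"] G0[of "Q + q"] by (simp add: pos_less_divide_eq)
    finally show ?thesis unfolding n .
  qed
  show thesis
  \<comment> \<open>The lower bound holds only after Q periods; starting from the image of v at that
    time makes it valid for all n.\<close>
  proof (rule that[of \<beta> K c' d "act 0 (Q * m) v"])
    show "\<bar>mprod F a n $$ (i, j)\<bar> \<le> K * (\<beta> ^ n * real (Suc n) ^ d)" if "i < 3" "j < 3" for a n i j
      using up[OF that, of a n] by (simp add: g_def)
    fix n i :: nat assume i: "i < 3"
    have "act 0 (Q * m + n) v i = act (0 + Q * m) n (act 0 (Q * m) v) i" by (rule act_add[OF i])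
    also have "\<dots> = act 0 n (act 0 (Q * m) v) i" unfolding act_def[of _ n] mprod_periodic ..
    finally have "c' * g (Q * m + n) \<le> act 0 n (act 0 (Q * m) v) i" using low[OF i, of n] by simp
    moreover have "c' * g n \<le> c' * g (Q * m + n)" using gmono[of n "Q * m + n"] c'0 by simp
    ultimately show "c' * (\<beta> ^ n * real (Suc n) ^ d) \<le> act 0 n (act 0 (Q * m) v) i"
      by (simp add: g_def)
  qed (use \<beta> K0 c'0 in auto)
qed

text \<open>Variation of constants: an error made at step k spreads at most at the rate
  \<open>g\<close>, and as \<open>g\<close> grows at least geometrically the contributions sum to a
  multiple of \<open>g n\<close> independent of \<open>\<rho>\<close>. The bound at n uses error
  bounds only for steps below n, so it applies while an orbit is still being constructed.\<close>

theorem perturbed_orbit_growth: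
  obtains v :: "nat \<Rightarrow> real" and \<beta> :: real where "1 < \<beta>"
    "\<And>C L. \<exists>\<rho>. \<forall>W. (\<forall>i<3. \<bar>W 0 i - \<rho> * v i\<bar> \<le> 1) \<longrightarrow>
      (\<forall>n. (\<forall>k<n. \<forall>i<3. \<bar>W (Suc k) i - (\<Sum>j<3. F k $$ (i, j) * W k j)\<bar> \<le> C) \<longrightarrow>
        (\<forall>i<3. L * \<beta> ^ n \<le> W n i))"
proof -
  obtain \<beta> :: real and d :: nat and K c :: real and v where \<beta>: "1 < \<beta>" and K: "0 \<le> K" and c: "0 < c"
    and up: "\<And>a n i j. i < 3 \<Longrightarrow> j < 3 \<Longrightarrow> \<bar>mprod F a n $$ (i, j)\<bar> \<le> K * (\<beta> ^ n * real (Suc n) ^ d)"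
    and low: "\<And>n i. i < 3 \<Longrightarrow> c * (\<beta> ^ n * real (Suc n) ^ d) \<le> act 0 n v i"
  proof (rule product_growth, goal_cases)
    case (1 \<beta> K c d v)
    show ?case by (rule 1(1)[OF 1(2-)])
  qed
  define g where "g n = \<beta> ^ n * real (Suc n) ^ d" for n
  have g0: "0 < g n" for n using \<beta> by (simp add: g_def)
  have gstep: "\<beta> * g n \<le> g (Suc n)" for n
  proof -
    have "\<beta> ^ Suc n * real (Suc n) ^ d \<le> \<beta> ^ Suc n * real (Suc (Suc n)) ^ d"
      using \<beta> by (intro mult_left_mono power_mono) auto
    then show ?thesis by (simp add: g_def mult.assoc)
  qed
  have gsum: "(\<Sum>k<n. g k) \<le> g n / (\<beta> - 1)" for n
  proof (induction n)
    case 0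
    show ?case using g0[of 0] \<beta> by simp
  next
    case (Suc n)
    have "(\<Sum>k<Suc n. g k) \<le> g n / (\<beta> - 1) + g n" using Suc by simp
    also have "\<dots> = \<beta> * g n / (\<beta> - 1)" using \<beta> by (simp add: field_simps)
    also have "\<dots> \<le> g (Suc n) / (\<beta> - 1)" using gstep[of n] \<beta> by (intro divide_right_mono) auto
    finally show ?case .
  qed
  have act_bd: "\<bar>act a n x i\<bar> \<le> 3 * K * X * g n" if "i < 3" "\<And>j. j < 3 \<Longrightarrow> \<bar>x j\<bar> \<le> X" for a n x i X
  proof -
    have "\<bar>act a n x i\<bar> \<le> (\<Sum>j<3::nat. (K * g n) * X)"
      unfolding act_def by (rule order_trans[OF sum_abs], rule sum_mono)
        (use that up[OF that(1)] K g0[of n] in \<open>auto simp: abs_mult g_def intro!: mult_mono\<close>)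
    then show ?thesis by (simp add: mult_ac)
  qed
  show thesis
  proof (rule that[OF \<beta>])
    fix C L :: real
    define D where "D = 3 * K * \<bar>C\<bar>"
    have D: "0 \<le> D" using K by (simp add: D_def)
    \<comment> \<open>The summands pay for the target L, for the initial deviation of at most 1, and
      for the accumulated errors.\<close>
    define \<rho> where "\<rho> = (\<bar>L\<bar> + 3 * K + D / (\<beta> - 1)) / c"
    have \<rho>0: "0 \<le> \<rho>" using K D \<beta> c by (simp add: \<rho>_def)
    show "\<exists>\<rho>. \<forall>W. (\<forall>i<3. \<bar>W 0 i - \<rho> * v i\<bar> \<le> 1) \<longrightarrow>
      (\<forall>n. (\<forall>k<n. \<forall>i<3. \<bar>W (Suc k) i - (\<Sum>j<3. F k $$ (i, j) * W k j)\<bar> \<le> C) \<longrightarrow>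
        (\<forall>i<3. L * \<beta> ^ n \<le> W n i))"
    proof (intro exI[of _ \<rho>] allI impI)
      fix W n i
      assume W0: "\<forall>i<3. \<bar>W 0 i - \<rho> * v i\<bar> \<le> 1"
        and C: "\<forall>k<n. \<forall>i<3. \<bar>W (Suc k) i - (\<Sum>j<3. F k $$ (i, j) * W k j)\<bar> \<le> C"
        and i: "i < (3::nat)"
      define r where "r k i = W (Suc k) i - (\<Sum>j<3. F k $$ (i, j) * W k j)" for k i
      have rep: "W n i = act 0 n (W 0) i + (\<Sum>k<n. act (Suc k) (n - Suc k) (r k) i)" if "i < 3" for n i
        using that
      proof (induction n arbitrary: i)
        case 0
        then show ?case by (simp add: act_0)
      next
        case (Suc n)
        have "W (Suc n) i = (\<Sum>j<3. F n $$ (i, j) * W n j) + r n i" by (simp add: r_def)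
        also have "(\<Sum>j<3. F n $$ (i, j) * W n j) = (\<Sum>j<3. F n $$ (i, j) *
            (act 0 n (W 0) j + (\<Sum>k<n. act (Suc k) (n - Suc k) (r k) j)))"
          using Suc.IH by (intro sum.cong) auto
        also have "\<dots> = (\<Sum>j<3. F (0 + n) $$ (i, j) * act 0 n (W 0) j)
            + (\<Sum>k<n. \<Sum>j<3. F n $$ (i, j) * act (Suc k) (n - Suc k) (r k) j)"
          by (simp add: distrib_left sum.distrib sum_distrib_left sum.swap[of _ "{..<3}"])
        also have "(\<Sum>j<3. F (0 + n) $$ (i, j) * act 0 n (W 0) j) = act 0 (Suc n) (W 0) i"
          by (rule act_Suc[OF Suc.prems, symmetric])
        also have "(\<Sum>k<n. \<Sum>j<3. F n $$ (i, j) * act (Suc k) (n - Suc k) (r k) j)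
            = (\<Sum>k<n. act (Suc k) (Suc n - Suc k) (r k) i)"
        proof (rule sum.cong[OF refl])
          fix k assume "k \<in> {..<n}"
          then have "Suc n - Suc k = Suc (n - Suc k)" "Suc k + (n - Suc k) = n" by auto
          then show "(\<Sum>j<3. F n $$ (i, j) * act (Suc k) (n - Suc k) (r k) j) = act (Suc k) (Suc n - Suc k) (r k) i"
            using act_Suc[OF Suc.prems, of "Suc k" "n - Suc k" "r k"] by simp
        qed
        finally show ?case using act_0[OF Suc.prems, of "Suc n" "r n"] by simp
      qed
      have C': "\<bar>r k i\<bar> \<le> \<bar>C\<bar>" if "k < n" "i < 3" for k i
        using C that unfolding r_def by fastforce
      have "\<bar>\<Sum>k<n. act (Suc k) (n - Suc k) (r k) i\<bar> \<le> (\<Sum>k<n. D * g (n - Suc k))"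
        unfolding D_def
        by (rule order_trans[OF sum_abs], rule sum_mono, rule act_bd[OF i]) (use C' in auto)
      also have "\<dots> = D * (\<Sum>k<n. g k)"
        unfolding sum_distrib_left[symmetric] by (subst sum.nat_diff_reindex) simp
      also have "\<dots> \<le> D * (g n / (\<beta> - 1))" using gsum D by (intro mult_left_mono) auto
      finally have err: "\<bar>\<Sum>k<n. act (Suc k) (n - Suc k) (r k) i\<bar> \<le> D / (\<beta> - 1) * g n" by simp
      have "act 0 n (W 0) i = act 0 n (\<lambda>i. \<rho> * v i + (W 0 i - \<rho> * v i)) i" by simp
      also have "\<dots> = \<rho> * act 0 n v i + act 0 n (\<lambda>i. W 0 i - \<rho> * v i) i" by (rule act_linear)
      finally have split: "act 0 n (W 0) i = \<rho> * act 0 n v i + act 0 n (\<lambda>i. W 0 i - \<rho> * v i) i" .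
      have "\<bar>act 0 n (\<lambda>i. W 0 i - \<rho> * v i) i\<bar> \<le> 3 * K * 1 * g n"
        by (rule act_bd[OF i]) (use W0 in auto)
      moreover have "\<rho> * (c * g n) \<le> \<rho> * act 0 n v i"
        using low[OF i, of n] \<rho>0 by (intro mult_left_mono) (auto simp: g_def)
      moreover have "\<rho> * (c * g n) = \<bar>L\<bar> * g n + 3 * K * g n + D / (\<beta> - 1) * g n"
        using c by (simp add: \<rho>_def field_simps)
      ultimately have "\<bar>L\<bar> * g n \<le> W n i"
        using rep[OF i, of n] split err by linarith
      moreover have "L * \<beta> ^ n \<le> \<bar>L\<bar> * g n"
      proof -
        have "\<beta> ^ n * 1 \<le> g n" unfolding g_def using \<beta> by (intro mult_left_mono) auto
        then have "\<bar>L\<bar> * \<beta> ^ n \<le> \<bar>L\<bar> * g n" by (intro mult_left_mono) auto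
        moreover have "L * \<beta> ^ n \<le> \<bar>L\<bar> * \<beta> ^ n" using \<beta> by (intro mult_right_mono) auto
        ultimately show ?thesis by linarith
      qed
      ultimately show "L * \<beta> ^ n \<le> W n i" by linarith
    qed
  qed
qed

end

section \<open>Stages of a trajectory\<close>

text \<open>A stage is a visit to the equilibrium with index k after a transition of type a. Then
  \<open>k + prv a\<close> is the equilibrium left last, and the three coordinates tracked by the transition
  matrices are \<open>k + off a 0\<close>, \<open>k + off a 1\<close>, \<open>k + off a 2\<close>, in this order.\<close>

fun dlt :: "transition \<Rightarrow> 5" where
  "dlt Type_A = 1" | "dlt Type_B = 3"

fun prv :: "transition \<Rightarrow> 5" where
  "prv Type_A = 4" | "prv Type_B = 2"

definition off :: "transition \<Rightarrow> nat \<Rightarrow> 5" where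
  "off a i = (if i = 0 then 1 else if i = 1 then 3 else case a of Type_A \<Rightarrow> 2 | Type_B \<Rightarrow> 4)"

lemma dlt_mem: "dlt b \<in> {1, 3}"
  by (cases b) auto

lemma reduce_5: "(5::5) = 0" "(6::5) = 1" "(7::5) = 2"
  by simp_all

lemma dlt_prv: "dlt b + prv b = 0"
  by (cases b) auto

lemma ex_less_3: "(\<exists>i<3. P i) \<longleftrightarrow> P (0::nat) \<or> P 1 \<or> P 2"
  unfolding less_3_cases by blast

lemma not_dlt_imp_off:
  fixes j :: 5
  assumes "j \<notin> {0, dlt b}"
  shows "\<exists>i<3. j = dlt b + off b i"
  using assms exhaust_5[of j] by (cases b) (auto simp: ex_less_3 off_def reduce_5)

lemma dlt_off_neq: "i < 3 \<Longrightarrow> dlt b + off b i \<notin> {0, dlt b}"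
  unfolding less_3_cases by (cases b) (auto simp: off_def reduce_5)

lemma off_cases:
  fixes j :: 5
  assumes "j \<noteq> 0"
  shows "j = prv a \<or> (\<exists>i<3. j = off a i)"
  using assms exhaust_5[of j] by (cases a) (auto simp: ex_less_3 off_def)

lemma dlt_eq_off: "\<exists>i<3. dlt b = off a i"
  by (cases b) (auto simp: ex_less_3 off_def)

lemma trans_mat_carrier: "trans_mat cA cB eA eB a b \<in> carrier_mat 3 3"
  by (cases a; cases b) (auto simp: mat_of_rows_list_def)

lemma letter_periodic: "letter Z (n + length Z) = letter Z n"
proof (cases "length Z = 0")
  case False
  then have "n + length Z + length Z - 1 = (n + length Z - 1) + length Z" by simp
  then show ?thesis unfolding letter_def by (metis mod_add_self2)
qed simp

lemma foldr_mprod: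
  "foldr (*) (map (\<lambda>k. F (a + k)) (rev [0..<n])) (1\<^sub>m 3) = mprod F a n"
  by (induction n) auto

lemma seq_trans_mat_eq_mprod:
  assumes "1 \<le> j"
  shows "seq_trans_mat cA cB eA eB Z j =
    mprod (\<lambda>n. trans_mat cA cB eA eB (letter Z n) (letter Z (Suc n))) (j - 1) (length Z)"
proof -
  have "Suc (j - 1 + k) = j + k" for k using assms by simp
  then show ?thesis
    unfolding seq_trans_mat_def
    using foldr_mprod[of "\<lambda>n. trans_mat cA cB eA eB (letter Z n) (letter Z (Suc n))" "j - 1" "length Z"]
    by simp
qed

context lotka_volterra
begin

text \<open>The row is that of the equilibrium left last: its own logarithm counts as 0, so only the
  entry \<open>- rho\<close> remains, a positive quotient of a contraction rate and an expansion
  rate.\<close>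

lemma trans_mat_row:
  "\<exists>i<3. (\<forall>j<3. 0 \<le> trans_mat cA cB eA eB a b $$ (i, j)) \<and> (\<exists>j<3. 0 < trans_mat cA cB eA eB a b $$ (i, j))"
proof (cases a; cases b)
  assume "a = Type_A" "b = Type_A"
  then show ?thesis using pos
    by (intro exI[of _ 1]) (auto simp: mat_of_rows_list_def less_3_cases ex_less_3)
next
  assume "a = Type_A" "b = Type_B"
  then show ?thesis using pos
    by (intro exI[of _ 0]) (auto simp: mat_of_rows_list_def less_3_cases ex_less_3)
next
  assume "a = Type_B" "b = Type_A"
  then show ?thesis using pos
    by (intro exI[of _ 0]) (auto simp: mat_of_rows_list_def less_3_cases ex_less_3)
next
  assume "a = Type_B" "b = Type_B"
  then show ?thesis using pos
    by (intro exI[of _ 2]) (auto simp: mat_of_rows_list_def less_3_cases ex_less_3)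
qed

lemma periodic_product_trans_mat:
  assumes "1 \<le> length Z"
    and "\<forall>j\<in>{1..length Z}. frag_asymp_stability_type (seq_trans_mat cA cB eA eB Z j)"
  shows "periodic_product (\<lambda>n. trans_mat cA cB eA eB (letter Z n) (letter Z (Suc n))) (length Z)"
proof
  show "trans_mat cA cB eA eB (letter Z n) (letter Z (Suc n)) \<in> carrier_mat 3 3" for n
    by (rule trans_mat_carrier)
  show "1 \<le> length Z" by fact
  show "trans_mat cA cB eA eB (letter Z (n + length Z)) (letter Z (Suc (n + length Z)))
      = trans_mat cA cB eA eB (letter Z n) (letter Z (Suc n))" for n
    using letter_periodic[of Z n] letter_periodic[of Z "Suc n"] by simp
  show "\<exists>i<3. (\<forall>j<3. 0 \<le> trans_mat cA cB eA eB (letter Z n) (letter Z (Suc n)) $$ (i, j)) \<and>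
      (\<exists>j<3. 0 < trans_mat cA cB eA eB (letter Z n) (letter Z (Suc n)) $$ (i, j))" for n
    by (rule trans_mat_row)
  fix i assume "i < length Z"
  then have "Suc i \<in> {1..length Z}" by simp
  from bspec[OF assms(2) this] seq_trans_mat_eq_mprod[of "Suc i" cA cB eA eB Z]
  show "frag_asymp_stability_type (mprod (\<lambda>n. trans_mat cA cB eA eB (letter Z n) (letter Z (Suc n))) i (length Z))"
    by simp
qed

text \<open>Here the explicit matrices meet the dynamics: row i is \<open>- Ef\<close> with the
  bounded coordinate k dropped, and likewise that of the previous equilibrium where it occurs. The
  vectors hold negated logarithms, hence the minus signs.\<close>

lemma trans_mat_action:
  assumes i: "i < 3"
  shows "(\<Sum>j<3. trans_mat cA cB eA eB a b $$ (i, j) * - y $ (k + off a j))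
    = (if dlt b + off b i = prv a then 0 else - y $ (k + (dlt b + off b i)))
      + rho k (k + dlt b) (k + (dlt b + off b i)) * y $ (k + dlt b)"
proof -
  have *: "k + x - k = x" for x :: 5 by simp
  consider "i = 0" | "i = 1" | "i = 2" using i by linarith
  then show ?thesis
    unfolding rho_def * sum_less_3
    by cases (cases a; cases b; simp add: mat_of_rows_list_def off_def reduce_5 al_simps)+
qed

text \<open>\<open>G\<close> accounts for the dropped multiple of \<open>y $ k\<close>, and Cp for
  the dropped coordinate of the previous equilibrium.\<close>

lemma trans_mat_approx:
  assumes i: "i < 3" and yk: "\<bar>y $ k\<bar> \<le> 1" and yp: "\<bar>y $ (k + prv a)\<bar> \<le> Cp"
  shows "\<bar>- Ef k (k + dlt b) (k + (dlt b + off b i)) y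
    - (\<Sum>j<3. trans_mat cA cB eA eB a b $$ (i, j) * - y $ (k + off a j))\<bar> \<le> G + Cp"
proof -
  define j l where "j = k + (dlt b + off b i)" and "l = k + dlt b"
  have "l - k \<in> {1, 3}" using dlt_mem[of b] by (simp add: l_def)
  from abs_rho[OF this, of j] have "\<bar>1 - rho k l j\<bar> \<le> G" by linarith
  then have "\<bar>(1 - rho k l j) * y $ k\<bar> \<le> G * 1"
    unfolding abs_mult using yk by (intro mult_mono) auto
  moreover have "- Ef k l j y = - y $ j + rho k l j * y $ l + (1 - rho k l j) * y $ k"
    by (simp add: Ef_def algebra_simps)
  moreover have "dlt b + off b i = prv a \<Longrightarrow> \<bar>y $ j\<bar> \<le> Cp" using yp by (simp add: j_def)
  moreover have "0 \<le> Cp" using yp by linarith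
  ultimately show ?thesis
    unfolding trans_mat_action[OF i] j_def[symmetric] l_def[symmetric] by auto
qed

end

text \<open>Step n has type \<open>letter Z (Suc n)\<close>; the start counts as reached by a
  transition of type \<open>letter Z 0\<close>, the last letter of Z.\<close>

primrec ks :: "transition list \<Rightarrow> nat \<Rightarrow> 5" where
  "ks Z 0 = 0"
| "ks Z (Suc n) = ks Z n + dlt (letter Z (Suc n))"

lemma ks_diff: "ks Z (Suc n) - ks Z n \<in> {1, 3}"
  using dlt_mem[of "letter Z (Suc n)"] by simp

lemma ks_neq: "ks Z (Suc n) \<noteq> ks Z n"
  using ks_diff[of Z n] by auto

lemma ks_prv: "ks Z (Suc n) + prv (letter Z (Suc n)) = ks Z n"
  using dlt_prv[of "letter Z (Suc n)"] by (simp add: add.assoc)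

lemma ks_itin_words:
  assumes "1 \<le> length Z"
  shows "ks Z \<in> itin_words Z"
proof -
  define w where "w n = letter Z (Suc n)" for n
  have "word_of (ks Z) w"
    unfolding word_of_def
  proof
    fix n
    show "w n = Type_A \<and> ks Z (Suc n) - ks Z n = 1 \<or> w n = Type_B \<and> ks Z (Suc n) - ks Z n = 3"
      by (cases "w n") (auto simp: w_def)
  qed
  moreover have "eventually_periodic w Z"
    unfolding eventually_periodic_def
  \<comment> \<open>As \<open>w n = letter Z (Suc n)\<close>, the offset \<open>length Z - 1\<close>
    aligns \<open>w (N + 1)\<close> with the first letter of Z.\<close>
  proof (intro exI[of _ "length Z - 1"] conjI allI impI ballI)
    show "w (n + length Z) = w n" for n using letter_periodic[of Z "Suc n"] by (simp add: w_def)
    fix j assume j: "j \<in> {1..length Z}"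
    then have "Suc (length Z - 1 + j) + length Z - 1 = (j - 1) + length Z + length Z"
      using assms by auto
    then have "(Suc (length Z - 1 + j) + length Z - 1) mod length Z = j - 1"
      using j by (simp only: mod_add_self2) auto
    then show "w (length Z - 1 + j) = Z ! (j - 1)" by (simp only: w_def letter_def)
  qed
  ultimately show ?thesis unfolding itin_words_def by blast
qed

text \<open>If \<open>x $ j \<le> x $ i\<close>, then
  \<open>(x $ i)\<^sup>2 + (1 - x $ j)\<^sup>2\<close> is at least 1/2, which puts x outside the
  ball. So comparing two coordinates decides which of two balls can be entered.\<close>

lemma ball_dominates:
  assumes "dist x (\<xi> j) \<le> H" "H < sqrt 2 / 2" "i \<noteq> j"
  shows "x $ i < x $ j"
proof (rule ccontr)
  assume "\<not> ?thesis"
  then have le: "x $ j \<le> x $ i" by simp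
  have "(\<Sum>p\<in>{i, j}. ((x - \<xi> j) $ p)\<^sup>2) \<le> (\<Sum>p\<in>UNIV. ((x - \<xi> j) $ p)\<^sup>2)"
    by (rule sum_mono2) auto
  also have "\<dots> = (dist x (\<xi> j))\<^sup>2"
    by (simp add: dist_norm norm_vec_def L2_set_def sum_nonneg)
  also have "\<dots> \<le> H\<^sup>2" using assms(1) by (intro power_mono) auto
  also have "\<dots> < (sqrt 2 / 2)\<^sup>2"
    using assms(1,2) zero_le_dist[of x "\<xi> j"] by (intro power_strict_mono) linarith+
  also have "\<dots> = 1 / 2" by (simp add: power_divide)
  finally have "(x $ i)\<^sup>2 + (x $ j - 1)\<^sup>2 < 1 / 2"
    using assms(3) by (simp add: \<xi>_def axis_def)
  moreover have "1 / 2 \<le> (x $ i)\<^sup>2 + (1 - x $ j)\<^sup>2"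
  proof -
    have "0 \<le> (x $ i - (1 - x $ j))\<^sup>2" by simp
    moreover have "1 \<le> (x $ i + (1 - x $ j))\<^sup>2" using le by (intro one_le_power) simp
    ultimately show ?thesis by (simp add: power2_eq_square algebra_simps)
  qed
  ultimately show False by (simp add: power2_commute[of 1])
qed

lemma ball_component:
  assumes "dist x (\<xi> j) \<le> H" "H < sqrt 2 / 2"
  shows "1 / 4 < x $ j"
proof -
  have "\<bar>(x - \<xi> j) $ j\<bar> \<le> H"
    using component_le_norm_cart[of "x - \<xi> j" j] assms(1) by (simp add: dist_norm)
  moreover have "sqrt 2 < 3 / 2" by (rule real_less_lsqrt) (auto simp: power2_eq_square)
  ultimately show ?thesis using assms(2) by (simp add: \<xi>_def axis_def)
qed

context lotka_volterra
begin

section \<open>Construction of the sequence of stages\<close>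

definition Fm :: "transition list \<Rightarrow> nat \<Rightarrow> real mat" where
  "Fm Z n = trans_mat cA cB eA eB (letter Z n) (letter Z (Suc n))"

text \<open>The bound Cp is two-sided because the transition matrices treat the logarithm of the
  previous equilibrium's coordinate as 0.\<close>

definition stage :: "real \<Rightarrow> real \<Rightarrow> transition list \<Rightarrow> (real \<Rightarrow> real ^ 5) \<Rightarrow> nat \<Rightarrow> real \<Rightarrow> bool" where
  "stage h Cp Z y n t \<longleftrightarrow> 0 \<le> t \<and> (\<forall>j. j \<noteq> ks Z n \<longrightarrow> y t $ j < ln h) \<and>
     \<bar>exp (y t $ ks Z n) - 1\<bar> < 5 * Lam * h \<and> \<bar>y t $ (ks Z n + prv (letter Z n))\<bar> \<le> Cp"

definition passes :: "real \<Rightarrow> real \<Rightarrow> transition list \<Rightarrow> (real \<Rightarrow> real ^ 5) \<Rightarrow> nat \<Rightarrow> real \<Rightarrow> real \<Rightarrow> bool" where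
  "passes h Cp Z y n t s \<longleftrightarrow> t \<le> s \<and>
     (\<forall>u\<in>{t..s}. inbox h (ks Z n) (ex (y u))) \<and>
     ln h - y t $ ks Z (Suc n) \<le> B * (s - t) \<and>
     (\<forall>u\<in>{t..s + T0 h}. \<forall>i. exp (y u $ i) \<le> bigR) \<and>
     (\<forall>u\<in>{t..s + T0 h}. \<forall>j. j \<notin> {ks Z n, ks Z (Suc n)} \<longrightarrow> exp (y u $ j) \<le> h) \<and>
     (\<forall>u u'. t \<le> u \<longrightarrow> u < u' \<longrightarrow> u' \<le> s + T0 h \<longrightarrow>
        y u $ ks Z (Suc n) - y u $ ks Z n < y u' $ ks Z (Suc n) - y u' $ ks Z n) \<and>
     (\<forall>j. j \<notin> {ks Z n, ks Z (Suc n)} \<longrightarrow>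
        \<bar>y (s + T0 h) $ j - Ef (ks Z n) (ks Z (Suc n)) j (y t)\<bar> \<le> Cpass h) \<and>
     stage h Cp Z y (Suc n) (s + T0 h)"

definition vec_at :: "transition list \<Rightarrow> (real \<Rightarrow> real ^ 5) \<Rightarrow> nat \<Rightarrow> real \<Rightarrow> nat \<Rightarrow> real" where
  "vec_at Z y n t i = - y t $ (ks Z n + off (letter Z n) i)"

lemma stage_inbox:
  assumes sm: "small h" and st: "stage h Cp Z y n t"
  shows "inbox h (ks Z n) (ex (y t))"
  unfolding inbox_def
proof (intro conjI allI impI)
  fix j assume "j \<noteq> ks Z n"
  then have "exp (y t $ j) < exp (ln h)" using st by (simp add: stage_def)
  then show "ex (y t) $ j \<le> h" using smallD(1)[OF sm] by simp
qed (use st in \<open>auto simp: stage_def\<close>)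

lemma stage_approx:
  assumes sm: "small h" and st: "stage h Cp Z y n t" and i: "i < 3"
  shows "\<bar>- Ef (ks Z n) (ks Z (Suc n)) (ks Z (Suc n) + off (letter Z (Suc n)) i) (y t)
    - (\<Sum>j<3. Fm Z n $$ (i, j) * vec_at Z y n t j)\<bar> \<le> G + Cp"
proof -
  have 1: "\<bar>y t $ ks Z n\<bar> \<le> 1" by (rule inbox_log(1)[OF sm stage_inbox[OF sm st]])
  have 2: "\<bar>y t $ (ks Z n + prv (letter Z n))\<bar> \<le> Cp" using st by (simp add: stage_def)
  show ?thesis
    using trans_mat_approx[OF i 1 2, of "letter Z (Suc n)"]
    unfolding Fm_def vec_at_def ks.simps by (simp only: add.assoc)
qed

lemma stage_step:
  assumes y: "lsol y" and sm: "small h" and st: "stage h Cp Z y n t" and Cp: "Cpass h \<le> Cp"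
    and big: "\<And>i. i < 3 \<Longrightarrow> Lpass h + G + Cp \<le> (\<Sum>j<3. Fm Z n $$ (i, j) * vec_at Z y n t j)"
  shows "\<exists>s. passes h Cp Z y n t s"
proof -
  define k l where "k = ks Z n" and "l = ks Z (Suc n)"
  have lk: "l - k \<in> {1, 3}" unfolding k_def l_def by (rule ks_diff)
  have t0: "0 \<le> t" and st1: "\<And>j. j \<noteq> k \<Longrightarrow> y t $ j < ln h" and st2: "\<bar>exp (y t $ k) - 1\<bar> < 5 * Lam * h"
    using st by (auto simp: stage_def k_def)
  have E: "Ef k l j (y t) \<le> - Lpass h" if j: "j \<notin> {k, l}" for j
  proof -
    have "j - k \<notin> {0, dlt (letter Z (Suc n))}"
      using j by (auto simp: k_def l_def algebra_simps)
    then obtain i where i: "i < 3" "j - k = dlt (letter Z (Suc n)) + off (letter Z (Suc n)) i"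
      using not_dlt_imp_off by blast
    then have j: "j = ks Z (Suc n) + off (letter Z (Suc n)) i"
      unfolding k_def by (simp add: algebra_simps)
    show ?thesis
      using stage_approx[OF sm st i(1)] big[OF i(1)] unfolding j k_def l_def by linarith
  qed
  show ?thesis
  proof (rule passage[OF y sm lk t0], goal_cases)
    case (4 s)
    note p = 4
    have "stage h Cp Z y (Suc n) (s + T0 h)"
      unfolding stage_def ks_prv
    proof (intro conjI allI impI)
      show "0 \<le> s + T0 h" using p(1) t0 T_pos[OF sm] by simp
      show "\<bar>exp (y (s + T0 h) $ ks Z (Suc n)) - 1\<bar> < 5 * Lam * h" using p(7) by (simp add: l_def)
      show "\<bar>y (s + T0 h) $ ks Z n\<bar> \<le> Cp" using p(9) Cp by (simp add: k_def)
      fix j assume "j \<noteq> ks Z (Suc n)"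
      then show "y (s + T0 h) $ j < ln h" using p(8) p(11)[of j] by (cases "j = k") (auto simp: l_def)
    qed
    then have "passes h Cp Z y n t s"
      unfolding passes_def k_def[symmetric] l_def[symmetric]
      using p(1-6,12) by blast
    then show ?case ..
  qed (use st1 st2 E in auto)
qed

lemma stage_error:
  assumes sm: "small h" and st: "stage h Cp Z y n t" and ps: "passes h Cp Z y n t s" and i: "i < 3"
  shows "\<bar>vec_at Z y (Suc n) (s + T0 h) i - (\<Sum>j<3. Fm Z n $$ (i, j) * vec_at Z y n t j)\<bar>
    \<le> Cpass h + G + Cp"
proof -
  define j where "j = ks Z (Suc n) + off (letter Z (Suc n)) i"
  have "dlt (letter Z (Suc n)) + off (letter Z (Suc n)) i \<notin> {0, dlt (letter Z (Suc n))}"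
    by (rule dlt_off_neq[OF i])
  then have "j \<notin> {ks Z n, ks Z (Suc n)}" unfolding j_def by (auto simp: add.assoc)
  then have "\<bar>y (s + T0 h) $ j - Ef (ks Z n) (ks Z (Suc n)) j (y t)\<bar> \<le> Cpass h"
    using ps unfolding passes_def by blast
  with stage_approx[OF sm st i] show ?thesis
    unfolding vec_at_def[of Z y "Suc n"] j_def by linarith
qed

lemma stage_sequence:
  assumes y: "lsol y" and sm: "small h" and st0: "stage h Cp Z y 0 0" and Cp: "Cpass h \<le> Cp"
    and L: "Lpass h + G + Cp \<le> L" "0 \<le> L" and \<beta>: "1 < \<beta>"
    and growth: "\<And>W n. W 0 = vec_at Z y 0 0 \<Longrightarrow>
      (\<And>k i. k < n \<Longrightarrow> i < 3 \<Longrightarrow> \<bar>W (Suc k) i - (\<Sum>j<3. Fm Z k $$ (i, j) * W k j)\<bar> \<le> Cpass h + G + Cp) \<Longrightarrow>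
      (\<forall>i<3. L * \<beta> ^ n \<le> W n i)"
  shows "\<exists>t s. t 0 = 0 \<and> (\<forall>n. stage h Cp Z y n (t n) \<and> passes h Cp Z y n (t n) (s n) \<and>
      t (Suc n) = s n + T0 h \<and> (\<forall>i<3. L * \<beta> ^ n \<le> vec_at Z y n (t n) i))"
proof -
  define S where "S n \<tau> = (SOME s. passes h Cp Z y n \<tau> s)" for n \<tau>
  define t where "t = rec_nat 0 (\<lambda>n \<tau>. S n \<tau> + T0 h)"
  have t0: "t 0 = 0" and tS: "t (Suc n) = S n (t n) + T0 h" for n by (simp_all add: t_def)
  define W where "W n = vec_at Z y n (t n)" for n
  have C0: "0 \<le> Cpass h + G + Cp"
  proof -
    have "0 \<le> Cp" using st0 unfolding stage_def by linarith
    moreover have "0 \<le> Cpass h"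
      unfolding Cpass_def Cbox_def using Lam_gt_1 G_gt_1 mu_pos B_pos T_pos(3)[OF sm] by simp
    ultimately show ?thesis using G_gt_1 by linarith
  qed
  have main: "stage h Cp Z y n (t n) \<and> (\<forall>k<n. stage h Cp Z y k (t k) \<and> passes h Cp Z y k (t k) (S k (t k)))" for n
  proof (induction n)
    case 0
    show ?case using st0 t0 by simp
  next
    case (Suc n)
    \<comment> \<open>Circularity is broken by extending the orbit with its exact image, which has
      error 0: the growth bound at n + 1 then says that this image is large, and that is what the
      next passage requires.\<close>
    define W' where "W' k = (if k \<le> n then W k else (\<lambda>i. \<Sum>j<3. Fm Z n $$ (i, j) * W n j))" for k
    have "\<forall>i<3. L * \<beta> ^ Suc n \<le> W' (Suc n) i"
    proof (rule growth)
      show "W' 0 = vec_at Z y 0 0" by (simp add: W'_def W_def t0)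
      fix k i :: nat assume k: "k < Suc n" and i: "i < 3"
      show "\<bar>W' (Suc k) i - (\<Sum>j<3. Fm Z k $$ (i, j) * W' k j)\<bar> \<le> Cpass h + G + Cp"
      proof (cases "k = n")
        case True
        then show ?thesis using C0 by (simp add: W'_def)
      next
        case False
        then have "k < n" using k by simp
        then show ?thesis
          using stage_error[OF sm, of Cp Z y k "t k" "S k (t k)" i] Suc i
          by (simp add: W'_def W_def tS)
      qed
    qed
    moreover have "L \<le> L * \<beta> ^ Suc n"
      using mult_left_mono[OF one_le_power[OF less_imp_le[OF \<beta>], of "Suc n"] L(2)] by simp
    ultimately have "Lpass h + G + Cp \<le> (\<Sum>j<3. Fm Z n $$ (i, j) * W n j)" if "i < 3" for i
      using that L(1) by (fastforce simp: W'_def)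
    then have "\<exists>s. passes h Cp Z y n (t n) s"
      using stage_step[OF y sm _ Cp] Suc unfolding W_def by blast
    then have p: "passes h Cp Z y n (t n) (S n (t n))" unfolding S_def by (rule someI_ex)
    then have "stage h Cp Z y (Suc n) (t (Suc n))" unfolding passes_def tS by blast
    with p Suc show ?case by (auto simp: less_Suc_eq)
  qed
  have "stage h Cp Z y n (t n) \<and> passes h Cp Z y n (t n) (S n (t n)) \<and>
      t (Suc n) = S n (t n) + T0 h \<and> (\<forall>i<3. L * \<beta> ^ n \<le> vec_at Z y n (t n) i)" for n
  proof (intro conjI)
    show "stage h Cp Z y n (t n)" "passes h Cp Z y n (t n) (S n (t n))" using main[of "Suc n"] by auto
    show "t (Suc n) = S n (t n) + T0 h" by (rule tS)
    have "\<forall>i<3. L * \<beta> ^ n \<le> W n i"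
    proof (rule growth)
      show "W 0 = vec_at Z y 0 0" by (simp add: W_def t0)
      show "\<bar>W (Suc k) i - (\<Sum>j<3. Fm Z k $$ (i, j) * W k j)\<bar> \<le> Cpass h + G + Cp"
        if "k < n" "i < 3" for k i
        using stage_error[OF sm, of Cp Z y k "t k" "S k (t k)" i] main[of n] that by (simp add: W_def tS)
    qed
    then show "\<forall>i<3. L * \<beta> ^ n \<le> vec_at Z y n (t n) i" by (simp add: W_def)
  qed
  with t0 show ?thesis by (intro exI[of _ t] exI[of _ "\<lambda>n. S n (t n)"]) blast
qed

lemma inbox_dist:
  assumes "inbox h k x"
  shows "dist x (\<xi> k) \<le> 4 * h + 5 * Lam * h"
proof -
  have "dist x (\<xi> k) \<le> (\<Sum>i\<in>UNIV. \<bar>(x - \<xi> k) $ i\<bar>)"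
    unfolding dist_norm by (rule norm_le_l1_cart)
  also have "\<dots> = \<bar>x $ k - 1\<bar> + (\<Sum>i\<in>UNIV - {k}. \<bar>(x - \<xi> k) $ i\<bar>)"
    by (subst sum.remove[of UNIV k]) (auto simp: \<xi>_def axis_def)
  also have "(\<Sum>i\<in>UNIV - {k}. \<bar>(x - \<xi> k) $ i\<bar>) = (\<Sum>i\<in>UNIV - {k}. \<bar>x $ i\<bar>)"
    by (intro sum.cong) (auto simp: \<xi>_def axis_def)
  finally show ?thesis using inbox_sum[OF assms] assms by (simp add: inbox_def)
qed

lemma \<xi>_in_network: "\<xi> k \<in> \<Sigma>"
  unfolding network_def orthant_def by (auto simp: \<xi>_def axis_def)

text \<open>The final time is moved from 0 to t, and one N serves all five equilibria as a
  maximum.\<close>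

lemma near_network_along:
  assumes sm: "small h" and c: "0 \<le> c" and \<delta>: "0 < \<delta>"
  shows "\<exists>N::nat. \<forall>f k t. sol {0..} f \<longrightarrow> (\<forall>u\<ge>0. norm (f u) \<le> R \<and> (\<forall>i. 0 \<le> f u $ i)) \<longrightarrow>
    0 \<le> t - real N - c \<longrightarrow> (\<forall>u\<in>{t - real N - c..t - c}. inbox h k (f u)) \<longrightarrow> infdist (f t) \<Sigma> < \<delta>"
proof -
  have "\<exists>N::nat. \<forall>f. sol {- real N - c..0} f \<longrightarrow>
      (\<forall>t\<in>{- real N - c..0}. norm (f t) \<le> R \<and> (\<forall>i. 0 \<le> f t $ i)) \<longrightarrow>
      (\<forall>t\<in>{- real N - c..- c}. inbox h k (f t)) \<longrightarrow> infdist (f 0) \<Sigma> < \<delta>" for k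
  proof -
    obtain N :: nat where N: "\<And>f. sol {- real N - c..0} f \<Longrightarrow>
      (\<And>t. t \<in> {- real N - c..0} \<Longrightarrow> norm (f t) \<le> R \<and> (\<forall>i. 0 \<le> f t $ i)) \<Longrightarrow>
      (\<And>t. t \<in> {- real N - c..- c} \<Longrightarrow> inbox h k (f t)) \<Longrightarrow> infdist (f 0) \<Sigma> < \<delta>"
    proof (rule near_network[OF sm c \<delta>, of R k], goal_cases)
      case (1 N)
      show ?case by (rule 1(1)[of N], rule 1(2)) blast+
    qed
    then show ?thesis by (intro exI[of _ N] allI impI) auto
  qed
  then obtain N :: "5 \<Rightarrow> nat" where N: "\<And>k f. sol {- real (N k) - c..0} f \<Longrightarrow>
      \<forall>t\<in>{- real (N k) - c..0}. norm (f t) \<le> R \<and> (\<forall>i. 0 \<le> f t $ i) \<Longrightarrow>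
      \<forall>t\<in>{- real (N k) - c..- c}. inbox h k (f t) \<Longrightarrow> infdist (f 0) \<Sigma> < \<delta>"
    by metis
  define M where "M = Max (range N)"
  have M: "N k \<le> M" for k unfolding M_def by (rule Max_ge) auto
  show ?thesis
  proof (intro exI[of _ M] allI impI)
    fix f k t assume f: "sol {0..} f" and bd: "\<forall>u\<ge>0. norm (f u) \<le> R \<and> (\<forall>i. 0 \<le> f u $ i)"
      and t: "0 \<le> t - real M - c" and bx: "\<forall>u\<in>{t - real M - c..t - c}. inbox h k (f u)"
    have NM: "real (N k) \<le> real M" using M[of k] by simp
    have "infdist (f (0 + t)) \<Sigma> < \<delta>"
    proof (rule N[of k "\<lambda>u. f (u + t)"])
      have "sol {t - real (N k) - c..t} f"
        by (rule solution_on_subset[OF f]) (use t NM in auto)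
      moreover have "t - real (N k) - c - t = - real (N k) - c" "t - t = 0" by simp_all
      ultimately show "sol {- real (N k) - c..0} (\<lambda>u. f (u + t))"
        using solution_on_shift[of cA cB eA eB "t - real (N k) - c" t f t] by (simp only:)
      show "\<forall>u\<in>{- real (N k) - c..0}. norm (f (u + t)) \<le> R \<and> (\<forall>i. 0 \<le> f (u + t) $ i)"
        using bd t NM by auto
      show "\<forall>u\<in>{- real (N k) - c..- c}. inbox h k (f (u + t))"
        using bx NM by auto
    qed
    then show "infdist (f t) \<Sigma> < \<delta>" by simp
  qed
qed

end

section \<open>An open set in the basin\<close>

context lotka_volterra
begin

definition shadow :: "real \<Rightarrow> real \<Rightarrow> real \<Rightarrow> nat \<Rightarrow> bool" where
  "shadow h c \<delta> N \<longleftrightarrow> (\<forall>f k t. sol {0..} f \<longrightarrow>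
     (\<forall>u\<ge>0. norm (f u) \<le> 5 * bigR \<and> (\<forall>i. 0 \<le> f u $ i)) \<longrightarrow>
     0 \<le> t - real N - c \<longrightarrow> (\<forall>u\<in>{t - real N - c..t - c}. inbox h k (f u)) \<longrightarrow> infdist (f t) \<Sigma> < \<delta>)"

lemma ex_shadow: "small h \<Longrightarrow> 0 \<le> c \<Longrightarrow> 0 < \<delta> \<Longrightarrow> \<exists>N. shadow h c \<delta> N"
  unfolding shadow_def by (rule near_network_along)

end

locale stage_run = lotka_volterra +
  fixes y :: "real \<Rightarrow> real ^ 5" and h Cp L \<beta> :: real and Z :: "transition list"
    and t s :: "nat \<Rightarrow> real"
  assumes y: "lsol y" and sm: "small h" and Z: "1 \<le> length Z" and t0: "t 0 = 0"
    and st: "\<And>n. stage h Cp Z y n (t n)" and ps: "\<And>n. passes h Cp Z y n (t n) (s n)"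
    and tS: "\<And>n. t (Suc n) = s n + T0 h"
    and growth: "\<And>n i. i < 3 \<Longrightarrow> L * \<beta> ^ n \<le> vec_at Z y n (t n) i"
    and L: "0 < L" and \<beta>: "1 < \<beta>"
begin

abbreviation f :: "real \<Rightarrow> real ^ 5" where "f u \<equiv> ex (y u)"

lemmas T0_pos = T_pos(3)[OF sm]

lemma t_le_s: "t n \<le> s n" using ps[of n] by (simp add: passes_def)

lemma t_nonneg: "0 \<le> t n" using st[of n] by (simp add: stage_def)

lemma t_step: "t n + T0 h \<le> t (Suc n)" using t_le_s[of n] tS[of n] by simp

lemma t_linear: "real n * T0 h \<le> t n"
proof (induction n)
  case (Suc n)
  then show ?case using t_step[of n] by (simp add: algebra_simps)
qed (simp add: t0)

lemma t_mono: "n \<le> m \<Longrightarrow> t n \<le> t m"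
  by (rule lift_Suc_mono_le) (use t_step T0_pos in \<open>smt (verit)\<close>)+

lemma ex_stage:
  assumes "0 \<le> u"
  shows "\<exists>n. t n \<le> u \<and> u < t (Suc n)"
proof -
  obtain N where "u < real N * T0 h" using reals_Archimedean3[OF T0_pos] by blast
  then have N: "u < t N" using t_linear[of N] by simp
  define m where "m = (LEAST n. u < t n)"
  have m: "u < t m" unfolding m_def by (rule LeastI[of _ N]) (rule N)
  have "m \<noteq> 0" using m assms t0 by (metis not_le)
  then obtain n where n: "m = Suc n" using not0_implies_Suc by blast
  have "\<not> u < t n" using not_less_Least[of n "\<lambda>n. u < t n"] n unfolding m_def by simp
  with m n show ?thesis using not_le by blast
qed

lemma le_bigR:
  assumes "0 \<le> u"
  shows "exp (y u $ i) \<le> bigR"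
proof -
  obtain n where "t n \<le> u" "u < t (Suc n)" using ex_stage[OF assms] by blast
  then have "u \<in> {t n..s n + T0 h}" by (simp add: tS)
  then show ?thesis using ps[of n] unfolding passes_def by blast
qed

lemma sol_f: "sol {0..} f"
  unfolding ex_def using log_sol_imp_sol[OF y[unfolded lsol_def] le_bigR] by simp

lemma f_bounds: "0 \<le> u \<Longrightarrow> norm (f u) \<le> 5 * bigR \<and> (\<forall>i. 0 \<le> f u $ i)"
proof (intro conjI allI)
  assume u: "0 \<le> u"
  have "norm (f u) \<le> (\<Sum>i\<in>UNIV. \<bar>f u $ i\<bar>)" by (rule norm_le_l1_cart)
  also have "\<dots> \<le> (\<Sum>i\<in>(UNIV :: 5 set). bigR)" using le_bigR[OF u] by (intro sum_mono) simp
  finally show "norm (f u) \<le> 5 * bigR" by simp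
qed simp

lemma in_box: "t n \<le> u \<Longrightarrow> u \<le> s n \<Longrightarrow> inbox h (ks Z n) (f u)"
  using ps[of n] by (simp add: passes_def)

lemma leaving_below: "stage h Cp Z y n u \<Longrightarrow> i \<noteq> ks Z n \<Longrightarrow> y u $ i < y u $ ks Z n"
proof -
  assume a: "stage h Cp Z y n u" "i \<noteq> ks Z n"
  then have "y u $ i < ln h" by (simp add: stage_def)
  then have "exp (y u $ i) < exp (ln h)" by (simp only: exp_less_cancel_iff)
  then have "exp (y u $ i) < h" using smallD(1)[OF sm] by simp
  moreover have "1 / 2 \<le> exp (y u $ ks Z n)" using inbox_le(2)[OF sm stage_inbox[OF sm a(1)]] by simp
  ultimately have "exp (y u $ i) < exp (y u $ ks Z n)" using smallD(4)[OF sm] by linarith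
  then show ?thesis by simp
qed

text \<open>The difference \<open>\<phi>\<close> of logarithms rises strictly from negative to
  positive. The ball around \<open>\<xi> j\<close> lies where coordinate j is largest, so k is
  visited only before the zero of \<open>\<phi>\<close> and l only after it; the remaining
  coordinates are too small for their balls. The size of H relative to h does not matter.\<close>

lemma crossing:
  assumes H: "H < sqrt 2 / 2"
  shows "\<exists>q. t n < q \<and> q < t (Suc n) \<and> visits_only H f (t n) q (ks Z n) \<and>
    visits_only H f q (t (Suc n)) (ks Z (Suc n))"
proof -
  define k l where "k = ks Z n" and "l = ks Z (Suc n)"
  have kl: "l \<noteq> k" unfolding k_def l_def by (rule ks_neq)
  define \<phi> where "\<phi> u = y u $ l - y u $ k" for u
  have mono: "\<phi> u < \<phi> u'" if "t n \<le> u" "u < u'" "u' \<le> t (Suc n)" for u u'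
    using ps[of n] that unfolding passes_def \<phi>_def l_def k_def tS by blast
  have a: "\<phi> (t n) < 0" using leaving_below[OF st[of n]] kl by (simp add: \<phi>_def k_def)
  have b: "0 < \<phi> (t (Suc n))" using leaving_below[OF st[of "Suc n"]] kl by (simp add: \<phi>_def l_def)
  have "\<exists>q. t n \<le> q \<and> q \<le> t (Suc n) \<and> \<phi> q = 0"
  proof (rule IVT')
    show "continuous_on {t n..t (Suc n)} \<phi>"
      unfolding \<phi>_def by (intro continuous_intros lsol_continuous[OF y t_nonneg])
  qed (use a b t_step[of n] T0_pos in auto)
  then obtain q where q: "t n \<le> q" "q \<le> t (Suc n)" "\<phi> q = 0" by blast
  have q': "t n < q" "q < t (Suc n)" using q a b by (auto simp: less_le)
  have other: "j \<in> {k, l}" if u: "t n \<le> u" "u \<le> t (Suc n)" and d: "dist (f u) (\<xi> j) \<le> H" for u j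
  proof (rule ccontr)
    assume "j \<notin> {k, l}"
    then have "exp (y u $ j) \<le> h" using ps[of n] u unfolding passes_def l_def k_def tS by auto
    then show False using ball_component[OF d H] smallD(4)[OF sm] by simp
  qed
  have le: "\<phi> u \<le> 0" if "t n \<le> u" "u \<le> q" for u
    using mono[of u q] that q by (cases "u = q") auto
  have ge: "0 \<le> \<phi> u" if "q \<le> u" "u \<le> t (Suc n)" for u
    using mono[of q u] that q by (cases "u = q") auto
  have "visits_only H f (t n) q k"
  proof (rule visits_onlyI)
    fix u j assume u: "t n \<le> u" "u \<le> q" and d: "dist (f u) (\<xi> j) \<le> H"
    show "j = k"
      using other[OF u(1) _ d] ball_dominates[OF d H, of k] kl le[OF u] u q by (auto simp: \<phi>_def)
  qed
  moreover have "visits_only H f q (t (Suc n)) l"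
  proof (rule visits_onlyI)
    fix u j assume u: "q \<le> u" "u \<le> t (Suc n)" and d: "dist (f u) (\<xi> j) \<le> H"
    show "j = l"
      using other[OF _ u(2) d] ball_dominates[OF d H, of l] kl ge[OF u] u q by (auto simp: \<phi>_def)
  qed
  ultimately show ?thesis using q' unfolding k_def l_def by blast
qed

lemma ex_itinerary:
  assumes H: "H < sqrt 2 / 2" and hH: "4 * h + 5 * Lam * h \<le> H"
  shows "\<exists>\<tau>. itinerary H f (ks Z) \<tau>"
proof -
  interpret trajectory H f
    by unfold_locales (use H solution_on_continuous[OF sol_f] in auto)
  obtain q where q: "\<And>n. t n < q n" "\<And>n. q n < t (Suc n)"
      "\<And>n. visits_only H f (t n) (q n) (ks Z n)"
      "\<And>n. visits_only H f (q n) (t (Suc n)) (ks Z (Suc n))"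
    using crossing[OF H] by metis
  have near: "dist (f (t n)) (\<xi> (ks Z n)) \<le> H" for n
    using inbox_dist[OF stage_inbox[OF sm st[of n]]] hH by simp
  show ?thesis
  proof (rule itinerary_of_chain[of q])
    show "0 \<le> q 0" using q(1)[of 0] t0 by simp
    show "q n < q (Suc n)" for n using q(2)[of n] q(1)[of "Suc n"] by simp
    show "ks Z (Suc n) \<noteq> ks Z n" for n by (rule ks_neq)
    show "visits_only H f 0 (q 0) (ks Z 0)" using q(3)[of 0] unfolding t0 .
    show "visits H f 0 (q 0) (ks Z 0)"
      unfolding visits_def using near[of 0] q(1)[of 0] t0 by (intro bexI[of _ 0]) auto
    fix n
    show "visits_only H f (q n) (q (Suc n)) (ks Z (Suc n))"
    proof (rule visits_onlyI)
      fix u j assume "q n \<le> u" "u \<le> q (Suc n)" "dist (f u) (\<xi> j) \<le> H"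
      then show "j = ks Z (Suc n)"
        using visits_onlyD[OF q(4)[of n], of u j] visits_onlyD[OF q(3)[of "Suc n"], of u j] by linarith
    qed
    show "visits H f (q n) (q (Suc n)) (ks Z (Suc n))"
      unfolding visits_def using near[of "Suc n"] q(2)[of n] q(1)[of "Suc n"]
      by (intro bexI[of _ "t (Suc n)"]) auto
  qed
qed

text \<open>The next equilibrium is one of the tracked directions, so its logarithm starts at
  \<open>- L * \<beta> ^ n\<close> or below; climbing to \<open>ln h\<close> at speed at most
  \<open>B\<close> takes correspondingly long.\<close>

lemma box_length: "L * \<beta> ^ n + ln h \<le> B * (s n - t n)"
proof -
  obtain i where "i < 3" "dlt (letter Z (Suc n)) = off (letter Z n) i" using dlt_eq_off by blast
  then have "L * \<beta> ^ n \<le> - y (t n) $ ks Z (Suc n)" using growth[of i n] by (simp add: vec_at_def)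
  moreover have "ln h - y (t n) $ ks Z (Suc n) \<le> B * (s n - t n)" using ps[of n] by (simp add: passes_def)
  ultimately show ?thesis by linarith
qed

lemma near_in_box:
  assumes "t n \<le> u" "u \<le> s n" "4 * h + 5 * Lam * h < \<delta>"
  shows "infdist (f u) \<Sigma> < \<delta>"
  using infdist_le[OF \<xi>_in_network, of "f u" "ks Z n"] inbox_dist[OF in_box[OF assms(1,2)]] assms(3)
  by linarith

lemma shadowD:
  assumes "shadow h c \<delta> N" "t n \<le> u - real N - c" "u - c \<le> s n"
  shows "infdist (f u) \<Sigma> < \<delta>"
proof -
  have "0 \<le> u - real N - c" using assms(2) t_nonneg[of n] by linarith
  moreover have "\<forall>v\<in>{u - real N - c..u - c}. inbox h (ks Z n) (f v)"
    using in_box[of n] assms(2,3) by auto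
  ultimately show ?thesis using assms(1) sol_f f_bounds unfolding shadow_def by blast
qed

text \<open>Inside a box the distance is small by the choice of h; afterwards at most
  \<open>T0 h\<close> has passed, and the preceding stay was long enough for
  \<open>shadow\<close>.\<close>

lemma always_near:
  assumes h: "4 * h + 5 * Lam * h < \<delta>" and N: "shadow h (T0 h) \<delta> N"
    and LN: "B * (real N + T0 h) \<le> L + ln h" and u: "0 \<le> u"
  shows "infdist (f u) \<Sigma> < \<delta>"
proof -
  obtain n where n: "t n \<le> u" "u < t (Suc n)" using ex_stage[OF u] by blast
  show ?thesis
  proof (cases "u \<le> s n")
    case True
    then show ?thesis using near_in_box n h by blast
  next
    case False
    have "L * 1 \<le> L * \<beta> ^ n" using L \<beta> by (intro mult_left_mono one_le_power) auto
    then have "B * (real N + T0 h) \<le> B * (s n - t n)" using LN box_length[of n] by linarith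
    then have "real N + T0 h \<le> s n - t n" using B_pos by simp
    then show ?thesis using False n tS[of n] by (intro shadowD[OF N, of n]) auto
  qed
qed

text \<open>Inside a box closeness is only of order h, so compactness is needed there too. Shortly
  after arrival the unstable manifold of the previous equilibrium is near, its box having been left
  at most \<open>T0 h + real N1\<close> ago; later it is that of the current one. Hence two
  constants N1 and N2.\<close>

lemma infdist_tendsto_0: "((\<lambda>u. infdist (f u) \<Sigma>) \<longlongrightarrow> 0) at_top"
proof (rule tendstoI)
  fix \<delta> :: real assume \<delta>: "0 < \<delta>"
  obtain N1 where N1: "shadow h 0 \<delta> N1" using ex_shadow[OF sm _ \<delta>] by blast
  obtain N2 where N2: "shadow h (T0 h + real N1) \<delta> N2"
    using ex_shadow[OF sm _ \<delta>, of "T0 h + real N1"] T0_pos by auto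
  define b where "b = real N1 + real N2 + T0 h"
  obtain n0 where n0: "(B * b - ln h) / L < \<beta> ^ n0" using real_arch_pow[OF \<beta>] by blast
  have long: "b \<le> s n - t n" if n: "n0 \<le> n" for n
  proof -
    have "(B * b - ln h) / L < \<beta> ^ n" using n0 power_increasing[OF n, of \<beta>] \<beta> by linarith
    then have "B * b - ln h < L * \<beta> ^ n" using L by (simp add: field_simps)
    then have "B * b \<le> B * (s n - t n)" using box_length[of n] by linarith
    then show ?thesis using B_pos by simp
  qed
  have "dist (infdist (f u) \<Sigma>) 0 < \<delta>" if u: "t (Suc n0) \<le> u" for u
  proof -
    have "0 \<le> u" using u t_nonneg order_trans by blast
    then obtain n where n: "t n \<le> u" "u < t (Suc n)" using ex_stage by blast
    have "\<not> Suc n \<le> Suc n0" using t_mono[of "Suc n" "Suc n0"] n u by linarith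
    then obtain p where p: "n = Suc p" "n0 \<le> p" by (cases n) auto
    have "infdist (f u) \<Sigma> < \<delta>"
    proof -
      consider "u \<le> t n + real N1" | "t n + real N1 \<le> u" "u \<le> s n" | "s n \<le> u" by linarith
      then show ?thesis
      proof cases
        case 1
        then show ?thesis
          using n(1) long[OF p(2)] tS[of p] T0_pos unfolding p(1) b_def by (intro shadowD[OF N2, of p]) linarith+
      next
        case 2
        then show ?thesis by (intro shadowD[OF N1, of n]) auto
      next
        case 3
        then show ?thesis
          using n(2) long[of n] tS[of n] p(1) le_SucI[OF p(2)] unfolding b_def by (intro shadowD[OF N2, of n]) auto
      qed
    qed
    then show ?thesis by (simp add: infdist_nonneg)
  qed
  then show "\<forall>\<^sub>F u in at_top. dist (infdist (f u) \<Sigma>) 0 < \<delta>"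
    unfolding eventually_at_top_linorder by blast
qed

lemma initial_in_basin:
  assumes "H < sqrt 2 / 2" "4 * h + 5 * Lam * h \<le> H" "4 * h + 5 * Lam * h < \<delta>"
    and "shadow h (T0 h) \<delta> N" "B * (real N + T0 h) \<le> L + ln h"
  shows "ex (y 0) \<in> local_basin cA cB eA eB H \<delta> Z"
proof -
  have "ex (y 0) \<in> orthant" by (simp add: orthant_def)
  moreover obtain \<tau> where "itinerary H f (ks Z) \<tau>" using ex_itinerary[OF assms(1,2)] by blast
  moreover obtain w where "word_of (ks Z) w" "eventually_periodic w Z"
    using ks_itin_words[OF Z] unfolding itin_words_def by blast
  ultimately show ?thesis
    unfolding local_basin_def using sol_f always_near[OF assms(3-5)] infdist_tendsto_0 by blast
qed

end

text \<open>One inverse serves both transition types, since \<open>off\<close> differs between them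
  only at index 2.\<close>

definition off_inv :: "5 \<Rightarrow> nat" where
  "off_inv j = (if j = 1 then 0 else if j = 3 then 1 else 2)"

lemma off_inv_off: "i < 3 \<Longrightarrow> off_inv (off a i) = i"
  unfolding less_3_cases by (cases a) (auto simp: off_inv_def off_def)

lemma off_not_in: "i < 3 \<Longrightarrow> off a i \<notin> {0, prv a}"
  unfolding less_3_cases by (cases a) (auto simp: off_def)

lemma off_off_inv:
  assumes "j \<notin> {0, prv a}"
  shows "j = off a (off_inv j) \<and> off_inv j < 3"
  using off_cases[of j a] assms off_inv_off by auto

context lotka_volterra
begin

lemma basin_contains_open:
  assumes Z: "1 \<le> length Z"
    and type: "\<forall>j\<in>{1..length Z}. frag_asymp_stability_type (seq_trans_mat cA cB eA eB Z j)"
    and H: "0 < H" "H < sqrt 2 / 2" and \<delta>: "0 < \<delta>"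
  shows "\<exists>U. open U \<and> U \<noteq> {} \<and> U \<subseteq> local_basin cA cB eA eB H \<delta> Z"
proof -
  have "Fm Z = (\<lambda>n. trans_mat cA cB eA eB (letter Z n) (letter Z (Suc n)))"
    by (rule ext) (simp only: Fm_def)
  then interpret P: periodic_product "Fm Z" "length Z"
    using periodic_product_trans_mat[OF Z type] by (simp only:)
  obtain v \<beta> where \<beta>: "1 < \<beta>" and gr: "\<And>C L. \<exists>\<rho>. \<forall>W. (\<forall>i<3. \<bar>W 0 i - \<rho> * v i\<bar> \<le> 1) \<longrightarrow>
      (\<forall>n. (\<forall>k<n. \<forall>i<3. \<bar>W (Suc k) i - (\<Sum>j<3. Fm Z k $$ (i, j) * W k j)\<bar> \<le> C) \<longrightarrow>
        (\<forall>i<3. L * \<beta> ^ n \<le> W n i))"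
  proof (rule P.perturbed_orbit_growth, goal_cases)
    case (1 v \<beta>)
    show ?case by (rule 1(1)[OF 1(2)]) (rule 1(3))
  qed
  \<comment> \<open>The first term gives \<open>small h\<close>; the others put a box within H and
    \<open>\<delta>\<close> of its equilibrium, as
    \<open>4 * h + 5 * Lam * h < 9 * (Lam * h)\<close>.\<close>
  define h where "h = min (mu / (36 * Lam\<^sup>2)) (min (H / (9 * Lam)) (\<delta> / (10 * Lam)))"
  have L1: "1 < Lam" by (rule Lam_gt_1)
  have h0: "0 < h" using mu_pos L1 H \<delta> by (simp add: h_def)
  have sm: "small h"
  proof -
    have "h \<le> mu / (36 * Lam\<^sup>2)" by (simp add: h_def)
    then show ?thesis unfolding small_def using h0 L1 by (simp add: pos_le_divide_eq mult.commute)
  qed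
  have "h \<le> H / (9 * Lam)" "h \<le> \<delta> / (10 * Lam)" by (simp_all add: h_def)
  then have "9 * (Lam * h) \<le> H" "10 * (Lam * h) \<le> \<delta>"
    using L1 by (simp_all add: pos_le_divide_eq mult_ac)
  moreover have "h < Lam * h" using h0 L1 by simp
  ultimately have hH: "4 * h + 5 * Lam * h \<le> H" and h\<delta>: "4 * h + 5 * Lam * h < \<delta>"
    unfolding mult.assoc using h0 by linarith+
  have lnh: "ln h < 0" using smallD(1,4)[OF sm] by simp
  obtain N where N: "shadow h (T0 h) \<delta> N" using ex_shadow[OF sm less_imp_le[OF T_pos(3)[OF sm]] \<delta>] by blast
  define Cp where "Cp = max (Cpass h) (2 * \<bar>ln h\<bar>)"
  \<comment> \<open>Three demands: every passage is possible, the tracked coordinates start below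
    \<open>ln h\<close>, and every stay in a box lasts at least
    \<open>real N + T0 h\<close>.\<close>
  define L where "L = max (Lpass h + G + Cp) (max (1 - ln h) (B * (real N + T0 h) - ln h))"
  obtain \<rho> where \<rho>: "\<forall>W. (\<forall>i<3. \<bar>W 0 i - \<rho> * v i\<bar> \<le> 1) \<longrightarrow>
      (\<forall>n. (\<forall>k<n. \<forall>i<3. \<bar>W (Suc k) i - (\<Sum>j<3. Fm Z k $$ (i, j) * W k j)\<bar>
          \<le> Cpass h + G + Cp) \<longrightarrow>
        (\<forall>i<3. L * \<beta> ^ n \<le> W n i))"
    using gr[of "Cpass h + G + Cp" L] by (rule exE)
  define a where "a = letter Z 0"
  \<comment> \<open>Near 1 in direction 0, between \<open>h\<^sup>2\<close> and h for the previous
    equilibrium, which matches \<open>2 * \<bar>ln h\<bar>\<close> in Cp, and within one logarithmic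
    unit of the multiple of v in the tracked directions, the tolerance granted by
    \<open>\<rho>\<close>.\<close>
  define lo hi :: "real ^ 5" where
    "lo = (\<chi> j. if j = 0 then 1 - 5 * Lam * h else if j = prv a then h\<^sup>2 else exp (- (\<rho> * v (off_inv j)) - 1))" and
    "hi = (\<chi> j. if j = 0 then 1 + 5 * Lam * h else if j = prv a then h else exp (- (\<rho> * v (off_inv j)) + 1))"
  have h2: "h\<^sup>2 < h" using smallD(1,4)[OF sm] by (simp add: power2_eq_square)
  have "box lo hi \<noteq> {}"
    unfolding interval_ne_empty_cart using h0 L1 h2 by (auto simp: lo_def hi_def)
  moreover have "box lo hi \<subseteq> local_basin cA cB eA eB H \<delta> Z"
  proof
    fix x assume "x \<in> box lo hi"
    then have x: "lo $ j < x $ j" "x $ j < hi $ j" for j by (auto simp: mem_box_cart)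
    have "0 \<le> lo $ j" for j using smallD(3)[OF sm] by (auto simp: lo_def)
    then have xp: "0 < x $ j" for j using x(1)[of j] by (rule le_less_trans)
    obtain y where y0: "y 0 = (\<chi> j. ln (x $ j))" and y: "lsol y"
      using log_sol_exists[of bigR "\<chi> j. ln (x $ j)"] bigR_gt_2 unfolding lsol_def by auto
    have ex0: "ex (y 0) = x" using xp by (simp add: Finite_Cartesian_Product.vec_eq_iff y0)
    have pa: "prv a \<noteq> 0" by (cases a) auto
    have base: "\<forall>i<3. \<bar>vec_at Z y 0 0 i - \<rho> * v i\<bar> \<le> 1"
    proof (intro allI impI)
      fix i :: nat assume i: "i < 3"
      have n: "off a i \<noteq> 0" "off a i \<noteq> prv a" using off_not_in[OF i] by auto
      have "exp (- (\<rho> * v i) - 1) < exp (ln (x $ off a i))" "exp (ln (x $ off a i)) < exp (- (\<rho> * v i) + 1)"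
        using x[of "off a i"] xp[of "off a i"] n by (auto simp: lo_def hi_def off_inv_off[OF i])
      then show "\<bar>vec_at Z y 0 0 i - \<rho> * v i\<bar> \<le> 1"
        unfolding exp_less_cancel_iff by (simp add: vec_at_def y0 a_def[symmetric])
    qed
    have growth: "\<forall>i<3. L * \<beta> ^ n \<le> W n i"
      if "W 0 = vec_at Z y 0 0" and "\<And>k i. k < n \<Longrightarrow> i < 3 \<Longrightarrow>
        \<bar>W (Suc k) i - (\<Sum>j<3. Fm Z k $$ (i, j) * W k j)\<bar> \<le> Cpass h + G + Cp" for W n
    proof -
      have 1: "\<forall>i<3. \<bar>W 0 i - \<rho> * v i\<bar> \<le> 1" using base that(1) by simp
      have 2: "\<forall>k<n. \<forall>i<3. \<bar>W (Suc k) i - (\<Sum>j<3. Fm Z k $$ (i, j) * W k j)\<bar> \<le> Cpass h + G + Cp"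
        using that(2) by blast
      show ?thesis by (rule mp[OF spec[OF mp[OF spec[OF \<rho>, of W] 1]] 2])
    qed
    have st0: "stage h Cp Z y 0 0"
      unfolding stage_def ks.simps add_0_left a_def[symmetric]
    proof (intro conjI allI impI)
      have "1 - 5 * Lam * h < x $ 0" "x $ 0 < 1 + 5 * Lam * h" using x[of 0] by (simp_all add: lo_def hi_def)
      then have "\<bar>x $ 0 - 1\<bar> < 5 * Lam * h" by linarith
      then show "\<bar>exp (y 0 $ 0) - 1\<bar> < 5 * Lam * h" using xp[of 0] by (simp add: y0)
      have p: "h\<^sup>2 < x $ prv a" "x $ prv a < h" using x[of "prv a"] pa by (auto simp: lo_def hi_def)
      have p1: "2 * ln h < y 0 $ prv a"
      proof -
        have "ln (h\<^sup>2) < ln (x $ prv a)" using p h0 xp by (subst ln_less_cancel_iff) auto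
        then show ?thesis using h0 by (simp add: y0 ln_realpow)
      qed
      have p2: "y 0 $ prv a < ln h" using p h0 xp by (simp add: y0)
      show "\<bar>y 0 $ prv a\<bar> \<le> Cp" using p1 p2 lnh unfolding Cp_def by linarith
      fix j :: 5 assume j: "j \<noteq> 0"
      show "y 0 $ j < ln h"
      proof (cases "j = prv a")
        case False
        with j off_off_inv[of j a] have i: "j = off a (off_inv j)" "off_inv j < 3" by auto
        \<comment> \<open>The growth bound at n = 0, where its error hypothesis is vacuous, puts the
          tracked logarithms at \<open>- L\<close> or below.\<close>
        have "\<forall>i<3. L * \<beta> ^ 0 \<le> (\<lambda>n. vec_at Z y 0 0) 0 i" by (rule growth) auto
        then have "L \<le> - y 0 $ j" using i by (auto simp: vec_at_def a_def[symmetric])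
        moreover have "1 - ln h \<le> L" by (simp add: L_def)
        ultimately show ?thesis using lnh by linarith
      qed (use p2 in simp)
    qed simp
    have L0: "0 < L" using lnh by (auto simp: L_def less_max_iff_disj)
    have CpC: "Cpass h \<le> Cp" and LC: "Lpass h + G + Cp \<le> L" by (simp_all add: Cp_def L_def)
    have "\<exists>t s. t 0 = 0 \<and> (\<forall>n. stage h Cp Z y n (t n) \<and> passes h Cp Z y n (t n) (s n) \<and>
        t (Suc n) = s n + T0 h \<and> (\<forall>i<3. L * \<beta> ^ n \<le> vec_at Z y n (t n) i))"
    proof (rule stage_sequence[OF y sm st0 CpC LC less_imp_le[OF L0] \<beta>], goal_cases)
      case (1 W n)
      show ?case by (rule growth[OF 1(1) 1(2)])
    qed
    then obtain t s where t0: "t 0 = 0" and ts: "\<forall>n. stage h Cp Z y n (t n) \<and> passes h Cp Z y n (t n) (s n) \<and>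
        t (Suc n) = s n + T0 h \<and> (\<forall>i<3. L * \<beta> ^ n \<le> vec_at Z y n (t n) i)"
      by (elim exE conjE)
    have st: "stage h Cp Z y n (t n)" and ps: "passes h Cp Z y n (t n) (s n)"
      and tS: "t (Suc n) = s n + T0 h" for n
      using ts by simp_all
    have gt: "L * \<beta> ^ n \<le> vec_at Z y n (t n) i" if "i < 3" for n i
      using ts that by simp
    interpret stage_run cA cB eA eB y h Cp L \<beta> Z t s
      by unfold_locales (fact y sm Z t0 st ps tS L0 \<beta> | rule gt, assumption)+
    have "B * (real N + T0 h) \<le> L + ln h" unfolding L_def by linarith
    from initial_in_basin[OF H(2) hH h\<delta> N this]
    show "x \<in> local_basin cA cB eA eB H \<delta> Z" unfolding ex0 .
  qed
  ultimately show ?thesis using open_box by blast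
qed

end

text \<open>Measurability turns measure 0 into negligibility, which a nonempty open subset rules
  out; for a nonmeasurable S the value 0 would say nothing.\<close>

lemma emeasure_pos_if_contains_open:
  fixes S :: "'a::euclidean_space set"
  assumes "S \<in> sets borel" "open U" "U \<noteq> {}" "U \<subseteq> S"
  shows "0 < emeasure lebesgue S"
proof -
  have S: "S \<in> sets lebesgue" using assms(1) by simp
  have "emeasure lebesgue S \<noteq> 0"
  proof
    assume "emeasure lebesgue S = 0"
    then have "negligible S" using S by (simp add: negligible_iff_null_sets null_sets_def)
    then show False using assms negligible_subset open_not_negligible by blast
  qed
  then show ?thesis by (simp add: zero_less_iff_neq_zero)
qed

theorem lemma1:
  fixes cA cB eA eB H :: real and Z :: "transition list"
  assumes "cA > 0" and "cB > 0" and "eA > 0" and "eB > 0"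
    and "0 < H" and "H < 1 / 2 * Min {dist (\<xi> i) (\<xi> j) | i j. i \<noteq> j}"
    and "length Z \<ge> 1"
    and "\<forall>j\<in>{1..length Z}. frag_asymp_stability_type (seq_trans_mat cA cB eA eB Z j)"
  shows "frag_asymp_stable cA cB eA eB H Z"
proof -
  interpret lotka_volterra cA cB eA eB by unfold_locales (use assms in auto)
  \<comment> \<open>Distinct equilibria all have the same distance, which turns the hypothesis on H
    into \<open>H < sqrt 2 / 2\<close>.\<close>
  have "{dist (\<xi> i) (\<xi> j) | i j. i \<noteq> j} = {sqrt 2}"
  proof
    show "{dist (\<xi> i) (\<xi> j) | i j. i \<noteq> j} \<subseteq> {sqrt 2}" by (auto simp: dist_\<xi>)
    have "(0 :: 5) \<noteq> 1" by simp
    then have "sqrt 2 = dist (\<xi> 0) (\<xi> 1) \<and> (0 :: 5) \<noteq> 1" by (simp only: dist_\<xi> simp_thms)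
    then show "{sqrt 2} \<subseteq> {dist (\<xi> i) (\<xi> j) | i j. i \<noteq> j}" by blast
  qed
  then have H: "H < sqrt 2 / 2" using assms(6) by (simp only: Min_singleton)
  show ?thesis
    unfolding frag_asymp_stable_def
  proof (intro allI impI)
    fix \<delta> :: real assume \<delta>: "0 < \<delta>"
    obtain U where U: "open U" "U \<noteq> {}" "U \<subseteq> local_basin cA cB eA eB H \<delta> Z"
      using basin_contains_open[OF assms(7,8,5) H \<delta>] by blast
    show "0 < emeasure lebesgue (local_basin cA cB eA eB H \<delta> Z)"
      by (rule emeasure_pos_if_contains_open[OF local_basin_borel[OF H \<delta> assms(7)] U])
  qed
qed

end
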